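(* Let $1 \le p < \infty$ and let $\big\{ \sum a_n^{(N)} n^{-s} \big\}_{N\in\mathbb{N}}$ be a bounded sequence in $\mathcal{H}^p$. Then there exist a Dirichlet series $\sum a_n n^{-s} \in \mathcal{H}^p$ and a subsequence $\big\{ \sum a_n^{(N_k)} n^{-s} \big\}_k$ such that, for every $\varepsilon > 0$, the sequence $\big\{ \sum \frac{a_n^{(N_k)}}{n^{\varepsilon}} n^{-s} \big\}_k$ converges to $\sum \frac{a_n}{n^{\varepsilon}} n^{-s}$ in $\mathcal{H}^p$ as $k\to\infty$.
   Context: A Dirichlet series is a formal series $\sum_{n\ge1} a_n n^{-s}$ with $a_n\in\mathbb{C}$; a Dirichlet polynomial is one with finitely many nonzero coefficients. For $1\le p<\infty$, the expression $$\Big\Vert \sum_{n=1}^{N} a_{n} n^{-s} \Big\Vert_{p} = \lim_{R \to \infty} \bigg( \frac{1}{2R} \int_{-R}^{R} \Big\vert \sum_{n=1}^{N} a_{n} n^{-it} \Big\vert^{p}\, dt \bigg)^{1/p}$$ defines a norm on the space of Dirichlet polynomials, and the Hardy space of Dirichlet series $\mathcal{H}^p$ is the completion of the space of Dirichlet polynomials under this norm. Elements of $\mathcal{H}^p$ are regarded as formal Dirichlet series: each coefficient functional $\sum a_n n^{-s}\mapsto a_m$ extends continuously from Dirichlet polynomials to $\mathcal{H}^p$, and an element of $\mathcal{H}^p$ is identified with the (uniquely determining) Dirichlet series formed by its coefficients. Equivalently (a known fact), $\sum a_n n^{-s}$ belongs to $\mathcal{H}^p$ if and only if there is $f\in H_p(\ell_2\cap\mathbb{D}^{\mathbb{N}})$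 with $a_n=c_\alpha(f)$ whenever $n=\mathfrak{p}_1^{\alpha_1}\mathfrak{p}_2^{\alpha_2}\cdots$, with $\mathfrak{p}_k$ the $k$-th prime and $\alpha$ a finitely supported sequence of nonnegative integers, and then both have the same norm. Here $\mathbb{D}$ is the open unit disc, $\mathbb{T}$ the unit circle, $\ell_2\cap\mathbb{D}^{\mathbb{N}}=\{z\in\ell_2: |z_j|<1 \text{ for all } j\}$, and $H_p(\ell_2\cap\mathbb{D}^{\mathbb{N}})$ is the space of holomorphic (Fréchet differentiable) $f:\ell_2\cap\mathbb{D}^{\mathbb{N}}\to\mathbb{C}$ with $$\Vert f\Vert = \sup_{n}\sup_{0<r<1}\Big(\int_{\mathbb{T}^n}|f(rw_1,\ldots,rw_n,0,\ldots)|^p\,\mathrm{d}w_1\cdots\mathrm{d}w_n\Big)^{1/p}<\infty$$ (normalised Lebesgue measure on $\mathbb{T}^n$), and for $\alpha\in\mathbb{N}_0^n$ (extended by zeros) and any $0<r<1$, $$c_\alpha(f)=\frac{1}{(2\pi i)^n}\int_{|\lambda_1|=r}\cdots\int_{|\lambda_n|=r}\frac{f(\lambda_1,\ldots,\lambda_n,0,\ldots)}{\lambda_1^{\alpha_1+1}\cdots\lambda_n^{\alpha_n+1}}\,\mathrm{d}\lambda_n\cdots\mathrm{d}\lambda_1.$$ It is a known fact that if $\sum a_n n^{-s}\in\mathcal{H}^p$ and $\varepsilon>0$, then $\sum \frac{a_n}{n^\varepsilon}n^{-s}\in\mathcal{H}^p$. *)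

theory Defs
  imports "HOL-Analysis.Analysis"
begin

text \<open>
  A formal Dirichlet series \<open>\<Sum>n\<ge>1. a n * n powr (-s)\<close> is given by its coefficient function
  \<open>a :: nat \<Rightarrow> complex\<close>. There is no term of index 0; the convention is \<open>a 0 = 0\<close>, which is
  required of Dirichlet polynomials and is inherited by the elements of the Hardy space.
\<close>

definition dirichlet_poly :: "(nat \<Rightarrow> complex) \<Rightarrow> bool" where
  "dirichlet_poly a \<longleftrightarrow> a 0 = 0 \<and> finite {n. a n \<noteq> 0}"

definition dpoly_eval :: "(nat \<Rightarrow> complex) \<Rightarrow> complex \<Rightarrow> complex" where
  "dpoly_eval a s = (\<Sum>n | a n \<noteq> 0. a n * of_nat n powr (- s))"

definition dpoly_norm :: "real \<Rightarrow> (nat \<Rightarrow> complex) \<Rightarrow> real" where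
  "dpoly_norm p a =
     Lim at_top (\<lambda>R::real.
       (1 / (2 * R) * integral {-R..R} (\<lambda>t. norm (dpoly_eval a (\<i> * of_real t)) powr p))
         powr (1 / p))"

text \<open>
  The completion of the Dirichlet polynomials consists of the Cauchy sequences \<open>P\<close> of Dirichlet
  polynomials modulo null sequences. The coefficient functionals extend continuously to the
  completion and jointly determine its elements, so the class of \<open>P\<close> is identified with the
  series whose \<open>n\<close>-th coefficient is the limit of \<open>P j n\<close> as \<open>j\<close> tends to infinity.
\<close>

definition dpoly_Cauchy :: "real \<Rightarrow> (nat \<Rightarrow> nat \<Rightarrow> complex) \<Rightarrow> bool" where
  "dpoly_Cauchy p P \<longleftrightarrow>
     (\<forall>j. dirichlet_poly (P j)) \<and>
     (\<forall>e>0. \<exists>M. \<forall>i\<ge>M. \<forall>j\<ge>M. dpoly_norm p (\<lambda>n. P i n - P j n) < e)"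

definition Hp_represents :: "real \<Rightarrow> (nat \<Rightarrow> nat \<Rightarrow> complex) \<Rightarrow> (nat \<Rightarrow> complex) \<Rightarrow> bool" where
  "Hp_represents p P a \<longleftrightarrow> dpoly_Cauchy p P \<and> (\<forall>n. (\<lambda>j. P j n) \<longlonglongrightarrow> a n)"

definition Hp :: "real \<Rightarrow> (nat \<Rightarrow> complex) set" where
  "Hp p = {a. \<exists>P. Hp_represents p P a}"

text \<open>
  The norm of the completion: the limit of the norms along a representing Cauchy sequence.
  It does not depend on the representative, because only null sequences represent the zero
  series. Outside \<open>Hp p\<close> the value is meaningless.
\<close>

definition Hp_norm :: "real \<Rightarrow> (nat \<Rightarrow> complex) \<Rightarrow> real" where
  "Hp_norm p a =
     (THE L. \<exists>P. Hp_represents p P a \<and> (\<lambda>j. dpoly_norm p (P j)) \<longlonglongrightarrow> L)"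

definition Hp_bounded_seq :: "real \<Rightarrow> (nat \<Rightarrow> nat \<Rightarrow> complex) \<Rightarrow> bool" where
  "Hp_bounded_seq p A \<longleftrightarrow> (\<forall>N. A N \<in> Hp p) \<and> (\<exists>B. \<forall>N. Hp_norm p (A N) \<le> B)"

definition Hp_converges :: "real \<Rightarrow> (nat \<Rightarrow> nat \<Rightarrow> complex) \<Rightarrow> (nat \<Rightarrow> complex) \<Rightarrow> bool" where
  "Hp_converges p A a \<longleftrightarrow>
     (\<forall>k. A k \<in> Hp p) \<and> a \<in> Hp p \<and> (\<lambda>k. Hp_norm p (\<lambda>n. A k n - a n)) \<longlonglongrightarrow> 0"

definition dirichlet_shift :: "real \<Rightarrow> (nat \<Rightarrow> complex) \<Rightarrow> nat \<Rightarrow> complex" where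
  "dirichlet_shift \<epsilon> a = (\<lambda>n. a n / of_real (real n powr \<epsilon>))"

end

theory Submission
  imports Defs "HOL-Library.Diagonal_Subsequence"
begin

text \<open>
  Everything takes place on Dirichlet polynomials, regarded as almost periodic functions on the
  imaginary axis that extend to the right half-plane; multiplying \<open>a\<^sub>n\<close> by \<open>n powr (-\<epsilon>)\<close> is the translation
  \<open>s \<mapsto> s + \<epsilon>\<close>, which is multiplicative. On \<open>L\<^sup>2\<close> it is a contraction by Parseval. In general
  write \<open>|f|\<^sup>p\<close> as \<open>|K|\<close> to the power \<open>p / j\<close> times \<open>|G|\<close> to the power \<open>2 - p / j\<close>, where \<open>|K|\<^sup>2\<close> and \<open>|G|\<^sup>2\<close>
  have almost the same mean over the axis as \<open>|f|\<^sup>p\<close>, namely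
  \<open>G = exp (p V / 2)\<close>, \<open>K = f\<^sup>j exp ((p / 2 - j) V)\<close> and \<open>Re V\<close> is close to \<open>ln |f|\<close>; Young's inequality then gives
  contractivity for all \<open>p\<close>.

  A polynomial supported on \<open>n \<ge> M\<close> even loses a factor \<open>M powr (-\<epsilon>)\<close>. Hence the translates of a
  bounded sequence with coefficients tending to \<open>0\<close> tend to \<open>0\<close> in norm. This settles the convergence,
  and also that a Cauchy sequence with vanishing coefficients is null. It remains to see that the
  coefficientwise limit \<open>a\<close> of a bounded sequence lies in the Hardy space, i.e. that its translates are
  Cauchy as \<open>\<epsilon>\<close> tends to \<open>0\<close>. Their norms increase to a finite limit. For \<open>p > 1\<close> uniform convexity applies. For
  \<open>p = 1\<close> factor \<open>f = K G\<close> with \<open>K\<close>, \<open>G\<close> in \<open>L\<^sup>2\<close>: if the translation hardly decreases the norm of \<open>f\<close>, it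
  hardly moves \<open>K\<close> and \<open>G\<close>, hence \<open>f\<close>.
\<close>

text \<open>The delicate claim is that the coefficientwise limit lies in the space. For general
  trigonometric polynomials it fails at \<open>p = 1\<close>: Fejer kernels are bounded in the mean
  \<open>L\<^sup>1\<close> norm and converge coefficientwise to the coefficients of a point mass. So
  the sign of the frequencies has to enter, as in the theorem of F. and M. Riesz; it does so through
  the analytic factors \<open>K\<close> and \<open>G\<close>, whose displacement under a shift is
  controlled in \<open>L\<^sup>2\<close> by the norm they lose.

  The second obstacle is that a shift cannot be undone with uniform bounds. After a fixed positive
  shift a bounded, coefficientwise convergent family is Cauchy, but removing the shift requires
  information that is uniform along the family. The level to which the norms of the shifts increase
  provides it, because all sufficiently small shifts have nearly this norm.

  The statement on null sequences has a further purpose: \<open>Hp_norm\<close> is a definite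
  description over all representing sequences of a series and has a value only if they lead to the
  same limit.\<close>

section \<open>Trigonometric polynomials with real frequencies\<close>

inductive trig_poly :: "(real \<Rightarrow> complex) \<Rightarrow> bool" where
  monom: "trig_poly (\<lambda>t. c * cis (l * t))"
| add: "trig_poly f \<Longrightarrow> trig_poly g \<Longrightarrow> trig_poly (\<lambda>t. f t + g t)"

lemma trig_poly_const: "trig_poly (\<lambda>t. c)"
  using trig_poly.monom[of c 0] by simp

lemma trig_poly_mult:
  assumes "trig_poly f" "trig_poly g" shows "trig_poly (\<lambda>t. f t * g t)"
proof -
  have *: "trig_poly (\<lambda>t. (c * cis (l * t)) * g t)" for c l
    using assms(2)
  proof induction
    case (monom d m)
    have "(\<lambda>t. (c * cis (l * t)) * (d * cis (m * t))) = (\<lambda>t. (c * d) * cis ((l + m) * t))"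
      by (auto simp: fun_eq_iff cis_mult[symmetric] algebra_simps)
    then show ?case using trig_poly.monom[of "c * d" "l + m"] by simp
  next
    case (add f g)
    then show ?case using trig_poly.add[OF add.IH] by (simp add: algebra_simps)
  qed
  from assms(1) show ?thesis
  proof induction
    case (monom c l)
    then show ?case by (rule *)
  next
    case (add f g)
    then show ?case using trig_poly.add[OF add.IH] by (simp add: algebra_simps)
  qed
qed

lemma trig_poly_cnj: "trig_poly f \<Longrightarrow> trig_poly (\<lambda>t. cnj (f t))"
proof (induction rule: trig_poly.induct)
  case (monom c l)
  then show ?case using trig_poly.monom[of "cnj c" "-l"] by (simp add: cis_cnj)
next
  case (add f g)
  then show ?case using trig_poly.add[OF add.IH] by simp
qed

lemma trig_poly_of_real_Re: "trig_poly f \<Longrightarrow> trig_poly (\<lambda>t. of_real (Re (f t)))"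
proof -
  assume f: "trig_poly f"
  have "(\<lambda>t. of_real (Re (f t))) = (\<lambda>t. (1/2) * (f t + cnj (f t)))"
    by (auto simp: fun_eq_iff complex_eq_iff)
  with f show ?thesis
    using trig_poly_mult[OF trig_poly_const trig_poly.add[OF f trig_poly_cnj[OF f]]] by metis
qed

lemma trig_poly_continuous: "trig_poly f \<Longrightarrow> continuous_on S f"
  by (induction rule: trig_poly.induct) (auto intro!: continuous_intros)

lemma trig_poly_bounded: "trig_poly f \<Longrightarrow> \<exists>C. \<forall>t. norm (f t) \<le> C"
proof (induction rule: trig_poly.induct)
  case (monom c l)
  then show ?case by (auto simp: norm_mult)
next
  case (add f g)
  then obtain C D where "\<forall>t. norm (f t) \<le> C" "\<forall>t. norm (g t) \<le> D" by auto
  then show ?case by (intro exI[of _ "C + D"]) (meson add_mono norm_triangle_ineq order_trans)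
qed

subsection \<open>Mean values\<close>

definition has_mean :: "(real \<Rightarrow> real) \<Rightarrow> real \<Rightarrow> bool" where
  "has_mean u m \<longleftrightarrow> ((\<lambda>R. 1 / (2 * R) * integral {-R..R} u) \<longlongrightarrow> m) at_top"

definition mean :: "(real \<Rightarrow> real) \<Rightarrow> real" where
  "mean u = Lim at_top (\<lambda>R. 1 / (2 * R) * integral {-R..R} u)"

lemma has_mean_mean: "has_mean u m \<Longrightarrow> mean u = m"
  unfolding has_mean_def mean_def by (intro tendsto_Lim) auto

lemma has_mean_const: "has_mean (\<lambda>t. c) c"
  unfolding has_mean_def
proof (rule tendsto_eventually)
  show "\<forall>\<^sub>F R in at_top. 1 / (2 * R) * integral {- R..R} (\<lambda>t. c) = c"
    using eventually_gt_at_top[of 0] by eventually_elim simp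
qed

lemma has_mean_add:
  assumes "has_mean u m" "has_mean v n" "continuous_on UNIV u" "continuous_on UNIV v"
  shows "has_mean (\<lambda>t. u t + v t) (m + n)"
proof -
  have i: "u integrable_on {-R..R}" "v integrable_on {-R..R}" for R
    using continuous_on_subset[OF assms(3)] continuous_on_subset[OF assms(4)]
    by (simp_all add: integrable_continuous_interval)
  show ?thesis
    using tendsto_add[OF assms(1,2)[unfolded has_mean_def]]
    by (simp add: has_mean_def integral_add[OF i] distrib_left)
qed

lemma has_mean_cmult: "has_mean u m \<Longrightarrow> has_mean (\<lambda>t. c * u t) (c * m)"
  unfolding has_mean_def
  by (drule tendsto_mult_left[where c = c]) (simp add: mult.left_commute)

lemma mean_int_mono:
  fixes u v :: "real \<Rightarrow> real"
  assumes "\<And>t. u t \<le> v t" "continuous_on UNIV u" "continuous_on UNIV v" "R > 0"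
  shows "1 / (2 * R) * integral {-R..R} u \<le> 1 / (2 * R) * integral {-R..R} v"
proof -
  have i: "u integrable_on {-R..R}" "v integrable_on {-R..R}" for R
    using continuous_on_subset[OF assms(2)] continuous_on_subset[OF assms(3)]
    by (simp_all add: integrable_continuous_interval)
  show ?thesis
    using integral_le[OF i] assms by (intro mult_left_mono) auto
qed

lemma has_mean_le:
  assumes "has_mean u m" "has_mean v n" "continuous_on UNIV u" "continuous_on UNIV v"
    "\<And>t. u t \<le> v t"
  shows "m \<le> n"
proof (rule tendsto_le[OF _ assms(2,1)[unfolded has_mean_def]])
  show "\<forall>\<^sub>F R in at_top. 1 / (2 * R) * integral {- R..R} u \<le> 1 / (2 * R) * integral {- R..R} v"
    using eventually_gt_at_top[of 0] by eventually_elim (use assms mean_int_mono in blast)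
qed simp

text \<open>For \<open>l \<noteq> 0\<close> the antiderivative is bounded, so the average over
  \<open>{-R..R}\<close> is of order \<open>1 / R\<close>. This is the orthogonality behind Parseval
  and behind the recovery of coefficients.\<close>

lemma has_mean_cis:
  "has_mean (\<lambda>t. Re (c * cis (l * t))) (if l = 0 then Re c else 0)"
proof (cases "l = 0")
  case True
  then show ?thesis using has_mean_const[of "Re c"] by simp
next
  case False
  define F where "F = (\<lambda>t. (Re c * sin (l * t) + Im c * cos (l * t)) / l)"
  have F: "(F has_real_derivative Re (c * cis (l * t))) (at t within S)" for t S
    unfolding F_def using False by (auto intro!: derivative_eq_intros simp: field_simps)
  have bd: "norm (F t) \<le> (norm c + norm c) / \<bar>l\<bar>" for t
  proof -
    have "norm (Re c * sin (l * t) + Im c * cos (l * t)) \<le> norm (Re c * sin (l * t)) + norm (Im c * cos (l * t))"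
      by (rule norm_triangle_ineq)
    also have "\<dots> \<le> norm c * 1 + norm c * 1"
      unfolding norm_mult by (intro add_mono mult_mono) (auto simp: abs_Re_le_cmod abs_Im_le_cmod)
    finally show ?thesis unfolding F_def using False by (auto simp: divide_right_mono)
  qed
  have int: "integral {-R..R} (\<lambda>t. Re (c * cis (l * t))) = F R - F (-R)" if "R > 0" for R
    by (intro integral_unique fundamental_theorem_of_calculus)
       (use that F in \<open>auto simp: has_real_derivative_iff_has_vector_derivative\<close>)
  have "((\<lambda>R. 1 / (2 * R) * integral {-R..R} (\<lambda>t. Re (c * cis (l * t)))) \<longlongrightarrow> 0) at_top"
  proof (rule tendsto_0_le[where K = "4 * norm c / \<bar>l\<bar>"])
    show "((\<lambda>R::real. inverse R) \<longlongrightarrow> 0) at_top" by (rule tendsto_inverse_0_at_top) (rule filterlim_ident)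
    show "\<forall>\<^sub>F R in at_top. norm (1 / (2 * R) * integral {-R..R} (\<lambda>t. Re (c * cis (l * t))))
       \<le> norm (inverse R) * (4 * norm c / \<bar>l\<bar>)"
      using eventually_gt_at_top[of 0]
    proof eventually_elim
      case (elim R)
      have "norm (F R - F (-R)) \<le> 4 * norm c / \<bar>l\<bar>"
        using norm_triangle_ineq4[of "F R" "F (-R)"] bd[of R] bd[of "-R"] by simp
      then have "norm (F R - F (-R)) / (2 * R) \<le> (4 * norm c / \<bar>l\<bar>) / (2 * R)"
        using elim by (intro divide_right_mono) auto
      also have "\<dots> \<le> (4 * norm c / \<bar>l\<bar>) / R"
        using elim by (intro divide_left_mono) auto
      finally show ?case unfolding int[OF elim] using elim
        by (simp add: norm_mult field_simps)
    qed
  qed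
  then show ?thesis using False unfolding has_mean_def by simp
qed

lemma trig_poly_has_mean: "trig_poly f \<Longrightarrow> \<exists>m. has_mean (\<lambda>t. Re (f t)) m"
proof (induction rule: trig_poly.induct)
  case (monom c l)
  then show ?case using has_mean_cis by blast
next
  case (add f g)
  then obtain m n where "has_mean (\<lambda>t. Re (f t)) m" "has_mean (\<lambda>t. Re (g t)) n" by auto
  with has_mean_add[OF this] add.hyps show ?case
    by (auto intro!: exI[of _ "m + n"] continuous_intros trig_poly_continuous)
qed

subsection \<open>Uniformly almost periodic functions\<close>

text \<open>The uniform closure of the trigonometric polynomials, which by Bohr's approximation
  theorem is the class of almost periodic functions. \<open>real_ap\<close> compares with real parts
  only, so that real-valued functions need no coercion.\<close>

definition ap :: "(real \<Rightarrow> complex) \<Rightarrow> bool" where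
  "ap f \<longleftrightarrow> (\<forall>e>0. \<exists>q. trig_poly q \<and> (\<forall>t. norm (f t - q t) \<le> e))"

definition real_ap :: "(real \<Rightarrow> real) \<Rightarrow> bool" where
  "real_ap u \<longleftrightarrow> (\<forall>e>0. \<exists>q. trig_poly q \<and> (\<forall>t. \<bar>u t - Re (q t)\<bar> \<le> e))"

lemma ap_trig_poly: "trig_poly f \<Longrightarrow> ap f"
  unfolding ap_def by (metis cancel_comm_monoid_add_class.diff_cancel less_imp_le norm_zero)

lemma ap_bounded:
  assumes "ap f" shows "\<exists>C. \<forall>t. norm (f t) \<le> C"
proof -
  obtain q where q: "trig_poly q" "\<And>t. norm (f t - q t) \<le> 1"
    using assms unfolding ap_def by (meson zero_less_one)
  obtain C where C: "\<And>t. norm (q t) \<le> C" using trig_poly_bounded[OF q(1)] by auto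
  have "norm (f t) \<le> C + 1" for t
    using norm_triangle_ineq[of "f t - q t" "q t"] q(2)[of t] C[of t] by simp
  then show ?thesis by blast
qed

lemma real_ap_continuous:
  assumes "real_ap u" shows "continuous_on S u"
proof -
  have "\<exists>q. trig_poly q \<and> (\<forall>t. \<bar>u t - Re (q t)\<bar> \<le> inverse (real (Suc n)))" for n
    using assms unfolding real_ap_def by simp
  then obtain q where q: "\<And>n. trig_poly (q n)"
      "\<And>n t. \<bar>u t - Re (q n t)\<bar> \<le> inverse (real (Suc n))" by metis
  have "uniform_limit S (\<lambda>n t. Re (q n t)) u sequentially"
  proof (rule uniform_limitI)
    fix e :: real assume "e > 0"
    then obtain n0 where n0: "inverse (real (Suc n0)) < e" using reals_Archimedean by blast
    have "\<bar>u t - Re (q n t)\<bar> < e" if "n \<ge> n0" for n t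
    proof -
      have "inverse (real (Suc n)) \<le> inverse (real (Suc n0))" using that by (intro le_imp_inverse_le) auto
      with q(2)[of t n] n0 show ?thesis by linarith
    qed
    then show "\<forall>\<^sub>F n in sequentially. \<forall>x\<in>S. dist (Re (q n x)) (u x) < e"
      by (auto simp: eventually_sequentially dist_real_def abs_minus_commute)
  qed
  then show ?thesis
    by (rule uniform_limit_theorem[rotated]) (auto intro!: always_eventually continuous_intros trig_poly_continuous q)
qed

text \<open>Averages over the same interval differ by no more than the uniform distance of the
  functions. So the means of the approximants are Cauchy, and their limit is the mean of
  \<open>u\<close>.\<close>

lemma real_ap_has_mean:
  assumes u: "real_ap u" shows "has_mean u (mean u)"
proof -
  have "\<exists>q. trig_poly q \<and> (\<forall>t. \<bar>u t - Re (q t)\<bar> \<le> inverse (real (Suc n)))" for n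
    using assms unfolding real_ap_def by simp
  then obtain q where q: "\<And>n. trig_poly (q n)"
      "\<And>n t. \<bar>u t - Re (q n t)\<bar> \<le> inverse (real (Suc n))" by metis
  have cu: "continuous_on UNIV u" and cq: "continuous_on UNIV (\<lambda>t. Re (q n t))" for n
    using u real_ap_continuous q(1) by (auto intro!: continuous_intros trig_poly_continuous)
  obtain m where m: "\<And>n. has_mean (\<lambda>t. Re (q n t)) (m n)"
    using trig_poly_has_mean[OF q(1)] by metis
  let ?I = "\<lambda>u R. 1 / (2 * R) * integral {-R..R} u"
  have close: "\<bar>?I u R - ?I (\<lambda>t. Re (q n t)) R\<bar> \<le> inverse (real (Suc n))" if "R > 0" for R n
  proof -
    have i: "u integrable_on {-R..R}" "(\<lambda>t. Re (q n t)) integrable_on {-R..R}"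
      by (auto intro!: integrable_continuous_interval intro: continuous_on_subset[OF cu] continuous_on_subset[OF cq])
    have "norm (integral {-R..R} (\<lambda>t. u t - Re (q n t))) \<le> inverse (real (Suc n)) * (R - (-R))"
      using that by (intro integral_bound) (auto intro!: continuous_on_diff simp: q(2) intro: continuous_on_subset[OF cu] continuous_on_subset[OF cq] simp del: of_nat_Suc)
    then have "\<bar>integral {-R..R} u - integral {-R..R} (\<lambda>t. Re (q n t))\<bar> / (2 * R) \<le> inverse (real (Suc n))"
      using that by (simp add: integral_diff[OF i] divide_le_eq del: of_nat_Suc)
    then show ?thesis using that by (simp add: diff_divide_distrib[symmetric] abs_divide del: of_nat_Suc)
  qed
  have evI: "\<forall>\<^sub>F R in at_top. \<bar>?I (\<lambda>t. Re (q n t)) R - m n\<bar> < e" if "e > 0" for n e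
    using m[of n, unfolded has_mean_def, THEN tendstoD, OF that] by (simp add: dist_real_def)
  have mm: "\<bar>m i - m j\<bar> \<le> inverse (real (Suc i)) + inverse (real (Suc j))" for i j
  proof (rule field_le_epsilon)
    fix e :: real assume "e > 0"
    then have "e / 2 > 0" by simp
    then have "\<forall>\<^sub>F R in at_top. R > 0 \<and> \<bar>?I (\<lambda>t. Re (q i t)) R - m i\<bar> < e / 2 \<and> \<bar>?I (\<lambda>t. Re (q j t)) R - m j\<bar> < e / 2"
      by (intro eventually_conj evI eventually_gt_at_top)
    then obtain R where R: "R > 0" "\<bar>?I (\<lambda>t. Re (q i t)) R - m i\<bar> < e / 2" "\<bar>?I (\<lambda>t. Re (q j t)) R - m j\<bar> < e / 2"
      using eventually_happens'[OF trivial_limit_at_top_linorder] by blast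
    with close[OF R(1), of i] close[OF R(1), of j]
    show "\<bar>m i - m j\<bar> \<le> inverse (real (Suc i)) + inverse (real (Suc j)) + e" by linarith
  qed
  have "Cauchy m"
  proof (rule metric_CauchyI)
    fix e :: real assume "e > 0"
    then have "e / 2 > 0" by simp
    then obtain N where N: "inverse (real (Suc N)) < e / 2" using reals_Archimedean by blast
    have "inverse (real (Suc n)) < e / 2" if "n \<ge> N" for n
    proof -
      have "inverse (real (Suc n)) \<le> inverse (real (Suc N))" using that by (intro le_imp_inverse_le) auto
      with N show ?thesis by linarith
    qed
    then have "dist (m i) (m j) < e" if "i \<ge> N" "j \<ge> N" for i j
    proof -
      have "inverse (real (Suc i)) < e / 2" "inverse (real (Suc j)) < e / 2"
        using that \<open>\<And>n. n \<ge> N \<Longrightarrow> inverse (real (Suc n)) < e / 2\<close> by blast+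
      with mm[of i j] show ?thesis unfolding dist_real_def by linarith
    qed
    then show "\<exists>M. \<forall>i\<ge>M. \<forall>n\<ge>M. dist (m i) (m n) < e" by blast
  qed
  then obtain L where L: "m \<longlonglongrightarrow> L" by (auto simp: Cauchy_convergent_iff convergent_def)
  have "has_mean u L"
    unfolding has_mean_def
  proof (rule tendstoI)
    fix e :: real assume e: "e > 0"
    then have "e / 3 > 0" by simp
    have "\<forall>\<^sub>F n in sequentially. dist (m n) L < e / 3 \<and> inverse (real (Suc n)) < e / 3"
      using tendstoD[OF L \<open>e / 3 > 0\<close>] order_tendstoD(2)[OF LIMSEQ_inverse_real_of_nat \<open>e / 3 > 0\<close>]
      by (rule eventually_conj)
    then obtain n where n: "dist (m n) L < e / 3" "inverse (real (Suc n)) < e / 3"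
      using eventually_happens'[OF sequentially_bot] by blast
    show "\<forall>\<^sub>F R in at_top. dist (?I u R) L < e"
      using evI[OF \<open>e / 3 > 0\<close>, of n] eventually_gt_at_top[of 0]
    proof eventually_elim
      case (elim R)
      then show ?case using close[OF elim(2), of n] n unfolding dist_real_def by linarith
    qed
  qed
  then show ?thesis using has_mean_mean by metis
qed

lemma real_ap_const: "real_ap (\<lambda>t. c)"
  unfolding real_ap_def by (intro allI impI exI[of _ "\<lambda>t. of_real c"]) (auto simp: trig_poly_const)

lemma real_ap_add:
  assumes "real_ap u" "real_ap v" shows "real_ap (\<lambda>t. u t + v t)"
  unfolding real_ap_def
proof (intro allI impI)
  fix e :: real assume "e > 0"
  then have "e / 2 > 0" by simp
  obtain q where q: "trig_poly q" "\<And>t. \<bar>u t - Re (q t)\<bar> \<le> e / 2"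
    using assms(1) \<open>e / 2 > 0\<close> unfolding real_ap_def by meson
  obtain r where r: "trig_poly r" "\<And>t. \<bar>v t - Re (r t)\<bar> \<le> e / 2"
    using assms(2) \<open>e / 2 > 0\<close> unfolding real_ap_def by meson
  have "\<bar>u t + v t - Re (q t + r t)\<bar> \<le> e" for t
    using q(2)[of t] r(2)[of t] unfolding plus_complex.sel by linarith
  with q(1) r(1) show "\<exists>q. trig_poly q \<and> (\<forall>t. \<bar>u t + v t - Re (q t)\<bar> \<le> e)"
    by (intro exI[of _ "\<lambda>t. q t + r t"]) (auto intro: trig_poly.add)
qed

lemma real_ap_cmult:
  assumes "real_ap u" shows "real_ap (\<lambda>t. c * u t)"
  unfolding real_ap_def
proof (intro allI impI)
  fix e :: real assume "e > 0"
  then have "e / (\<bar>c\<bar> + 1) > 0" by (simp add: add_nonneg_pos)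
  then obtain q where q: "trig_poly q" "\<And>t. \<bar>u t - Re (q t)\<bar> \<le> e / (\<bar>c\<bar> + 1)"
    using assms unfolding real_ap_def by meson
  have "\<bar>c * u t - Re (of_real c * q t)\<bar> \<le> e" for t
  proof -
    have "\<bar>c * u t - Re (of_real c * q t)\<bar> = \<bar>c\<bar> * \<bar>u t - Re (q t)\<bar>"
      by (simp add: abs_mult[symmetric] algebra_simps)
    also have "\<dots> \<le> (\<bar>c\<bar> + 1) * (e / (\<bar>c\<bar> + 1))"
      by (intro mult_mono q) auto
    also have "\<dots> = e" using abs_ge_zero[of c] by (simp add: field_simps)
    finally show ?thesis .
  qed
  then show "\<exists>q. trig_poly q \<and> (\<forall>t. \<bar>c * u t - Re (q t)\<bar> \<le> e)"
    by (intro exI[of _ "\<lambda>t. of_real c * q t"]) (auto intro: trig_poly_mult trig_poly_const q)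
qed

lemma mean_const: "mean (\<lambda>t. c) = c"
  by (rule has_mean_mean[OF has_mean_const])

lemma mean_add: "real_ap u \<Longrightarrow> real_ap v \<Longrightarrow> mean (\<lambda>t. u t + v t) = mean u + mean v"
  by (intro has_mean_mean has_mean_add real_ap_has_mean real_ap_continuous)

lemma mean_cmult: "real_ap u \<Longrightarrow> mean (\<lambda>t. c * u t) = c * mean u"
  by (intro has_mean_mean has_mean_cmult real_ap_has_mean)

lemma mean_mono: "real_ap u \<Longrightarrow> real_ap v \<Longrightarrow> (\<And>t. u t \<le> v t) \<Longrightarrow> mean u \<le> mean v"
  by (rule has_mean_le[OF real_ap_has_mean real_ap_has_mean]) (auto intro: real_ap_continuous)

lemma real_polynomial_trig_poly:
  assumes "real_polynomial_function (P :: complex \<Rightarrow> real)" "trig_poly q"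
  shows "trig_poly (\<lambda>t. of_real (P (q t)))"
  using assms(1)
proof induction
  case (linear f)
  then interpret bounded_linear f .
  define a b where "a = f 1" and "b = f \<i>"
  \<comment> \<open>Since \<open>Re (- \<i> * z) = Im z\<close>, a real-linear functional is the
    real part of a complex-linear expression, to which the closure properties apply.\<close>
  have "f z = Re (of_real a * z + of_real b * (- \<i> * z))" for z
  proof -
    have "z = Re z *\<^sub>R 1 + Im z *\<^sub>R \<i>" by (simp add: complex_eq_iff)
    then have "f z = Re z * a + Im z * b" unfolding a_def b_def by (metis add scaleR real_scaleR_def)
    then show ?thesis by simp
  qed
  moreover have "trig_poly (\<lambda>t. of_real (Re (of_real a * q t + of_real b * (- \<i> * q t))))"
    by (rule trig_poly_of_real_Re, rule trig_poly.add)
       (rule trig_poly_mult[OF trig_poly_const] trig_poly_mult[OF trig_poly_const trig_poly_mult[OF trig_poly_const]] assms(2))+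
  ultimately show ?case by (simp only:)
next
  case (const c)
  then show ?case by (rule trig_poly_const)
next
  case (add f g)
  show ?case using trig_poly.add[OF add.IH] by simp
next
  case (mult f g)
  show ?case using trig_poly_mult[OF mult.IH] by simp
qed

text \<open>Stone-Weierstrass on a disc containing all values reduces \<phi> to a real polynomial,
  and these preserve trigonometric polynomials. The applications are powers of the modulus and
  \<open>ln (norm z + \<rho>)\<close>.\<close>

lemma real_ap_compose:
  fixes \<phi> :: "complex \<Rightarrow> real"
  assumes f: "ap f" and \<phi>: "continuous_on UNIV \<phi>"
  shows "real_ap (\<lambda>t. \<phi> (f t))"
  unfolding real_ap_def
proof (intro allI impI)
  fix e :: real assume e: "e > 0"
  obtain C where C: "\<And>t. norm (f t) \<le> C" using ap_bounded[OF f] by auto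
  \<comment> \<open>The radius exceeds \<open>C\<close> by 1 so that the approximant
    \<open>q\<close>, within 1 of \<open>f\<close>, also takes its values in the disc.\<close>
  have cpt: "compact (cball (0::complex) (C + 1))" by simp
  have "uniformly_continuous_on (cball 0 (C + 1)) \<phi>"
    by (rule compact_uniformly_continuous[OF continuous_on_subset[OF \<phi>] cpt]) auto
  then obtain d where d: "d > 0" "\<And>x y. x \<in> cball 0 (C + 1) \<Longrightarrow> y \<in> cball 0 (C + 1) \<Longrightarrow> dist x y < d \<Longrightarrow> dist (\<phi> x) (\<phi> y) < e / 2"
    using e unfolding uniformly_continuous_on_def by (metis half_gt_zero)
  have "min (d / 2) 1 > 0" using d by simp
  then obtain q where q: "trig_poly q" "\<And>t. norm (f t - q t) \<le> min (d / 2) 1"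
    using f unfolding ap_def by meson
  obtain P where P: "real_polynomial_function P" "\<And>z. z \<in> cball 0 (C + 1) \<Longrightarrow> \<bar>\<phi> z - P z\<bar> < e / 2"
    using Stone_Weierstrass_real_polynomial_function[OF cpt continuous_on_subset[OF \<phi>], of "e / 2"] e by auto
  have "\<bar>\<phi> (f t) - P (q t)\<bar> \<le> e" for t
  proof -
    have fq: "norm (f t - q t) \<le> 1" "norm (f t - q t) < d"
      using q(2)[of t] d(1) by auto
    have "norm (q t) \<le> C + 1"
      using norm_triangle_ineq2[of "q t" "f t"] fq C[of t] by (simp add: norm_minus_commute)
    moreover have "norm (f t) \<le> C + 1" using C[of t] by simp
    ultimately have "dist (\<phi> (f t)) (\<phi> (q t)) < e / 2" "\<bar>\<phi> (q t) - P (q t)\<bar> < e / 2"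
      using d(2)[of "f t" "q t"] P(2)[of "q t"] fq by (auto simp: dist_norm)
    then show ?thesis unfolding dist_real_def by linarith
  qed
  moreover have "trig_poly (\<lambda>t. of_real (P (q t)))"
    by (rule real_polynomial_trig_poly[OF P(1) q(1)])
  ultimately show "\<exists>q. trig_poly q \<and> (\<forall>t. \<bar>\<phi> (f t) - Re (q t)\<bar> \<le> e)"
    by (intro exI[of _ "\<lambda>t. of_real (P (q t))"]) simp
qed

subsection \<open>Analytic almost periodic functions on the right half-plane\<close>

text \<open>\<open>0 \<le> l\<close> keeps every exponential bounded on the closed right half-plane.
  Arbitrary real frequencies, not only logarithms of integers, make room for the approximate
  logarithm \<open>V\<close> and for multiplication by \<open>M\<^sup>s\<close>.\<close>

inductive analytic_poly :: "(complex \<Rightarrow> complex) \<Rightarrow> bool" where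
  monom: "0 \<le> l \<Longrightarrow> analytic_poly (\<lambda>s. c * exp (- of_real l * s))"
| add: "analytic_poly F \<Longrightarrow> analytic_poly G \<Longrightarrow> analytic_poly (\<lambda>s. F s + G s)"

lemma analytic_poly_const: "analytic_poly (\<lambda>s. c)"
  using analytic_poly.monom[of 0 c] by simp

lemma analytic_poly_mult:
  assumes "analytic_poly F" "analytic_poly G" shows "analytic_poly (\<lambda>s. F s * G s)"
proof -
  have *: "analytic_poly (\<lambda>s. (c * exp (- of_real l * s)) * G s)" if "l \<ge> 0" for c l
    using assms(2)
  proof induction
    case (monom m d)
    have "(\<lambda>s. (c * exp (- of_real l * s)) * (d * exp (- of_real m * s)))
        = (\<lambda>s. (c * d) * exp (- of_real (l + m) * s))"
      by (auto simp: fun_eq_iff exp_add[symmetric] algebra_simps)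
    then show ?case using analytic_poly.monom[of "l + m" "c * d"] monom that by simp
  next
    case (add F G)
    then show ?case using analytic_poly.add[OF add.IH] by (simp add: algebra_simps)
  qed
  from assms(1) show ?thesis
  proof induction
    case (monom l c)
    then show ?case by (rule *)
  next
    case (add F G)
    then show ?case using analytic_poly.add[OF add.IH] by (simp add: algebra_simps)
  qed
qed

lemma analytic_poly_power: "analytic_poly F \<Longrightarrow> analytic_poly (\<lambda>s. F s ^ n)"
  by (induction n) (simp_all add: analytic_poly_const analytic_poly_mult)

lemma analytic_poly_sum:
  "finite I \<Longrightarrow> (\<And>i. i \<in> I \<Longrightarrow> analytic_poly (F i)) \<Longrightarrow> analytic_poly (\<lambda>s. \<Sum>i\<in>I. F i s)"
  by (induction I rule: finite_induct) (simp_all add: analytic_poly_const analytic_poly.add)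

lemma exp_on_line: "exp (- of_real l * Complex \<sigma> t) = of_real (exp (- (l * \<sigma>))) * cis (- l * t)"
  by (subst exp_eq_polar) simp

lemma analytic_poly_trig_poly: "analytic_poly F \<Longrightarrow> trig_poly (\<lambda>t. F (Complex \<sigma> t))"
proof (induction rule: analytic_poly.induct)
  case (monom l c)
  then show ?case
    using trig_poly.monom[of "c * of_real (exp (- (l * \<sigma>)))" "-l"] by (simp only: exp_on_line mult.assoc)
next
  case (add F G)
  then show ?case using trig_poly.add[OF add.IH] by simp
qed

lemma analytic_poly_bounded: "analytic_poly F \<Longrightarrow> \<exists>C. \<forall>s. Re s \<ge> 0 \<longrightarrow> norm (F s) \<le> C"
proof (induction rule: analytic_poly.induct)
  case (monom l c)
  then have "norm (c * exp (- of_real l * s)) \<le> norm c" if "Re s \<ge> 0" for s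
    using that by (simp add: norm_mult mult_left_le)
  then show ?case by blast
next
  case (add F G)
  then obtain C D where "\<forall>s. Re s \<ge> 0 \<longrightarrow> norm (F s) \<le> C" "\<forall>s. Re s \<ge> 0 \<longrightarrow> norm (G s) \<le> D" by auto
  then show ?case by (intro exI[of _ "C + D"]) (meson add_mono norm_triangle_ineq order_trans)
qed

text \<open>The inductive presentation may list a frequency several times; Parseval needs each
  frequency once, hence a set \<open>L\<close> with one coefficient per element.\<close>

lemma analytic_poly_repr:
  "analytic_poly F \<Longrightarrow> \<exists>L c. finite L \<and> (\<forall>l\<in>L. 0 \<le> l) \<and> F = (\<lambda>s. \<Sum>l\<in>L. c l * exp (- of_real l * s))"
proof (induction rule: analytic_poly.induct)
  case (monom l c)
  then show ?case by (intro exI[of _ "{l}"] exI[of _ "\<lambda>_. c"]) auto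
next
  case (add F G)
  then obtain L c M d where
    L: "finite L" "\<forall>l\<in>L. 0 \<le> l" and F: "F = (\<lambda>s. \<Sum>l\<in>L. c l * exp (- of_real l * s))" and
    M: "finite M" "\<forall>l\<in>M. 0 \<le> l" and G: "G = (\<lambda>s. \<Sum>l\<in>M. d l * exp (- of_real l * s))" by blast
  define c' where "c' l = (if l \<in> L then c l else 0)" for l
  define d' where "d' l = (if l \<in> M then d l else 0)" for l
  have "F = (\<lambda>s. \<Sum>l\<in>L \<union> M. c' l * exp (- of_real l * s))"
    unfolding F by (rule ext, rule sum.mono_neutral_cong_left) (use L M in \<open>auto simp: c'_def\<close>)
  moreover have "G = (\<lambda>s. \<Sum>l\<in>L \<union> M. d' l * exp (- of_real l * s))"
    unfolding G by (rule ext, rule sum.mono_neutral_cong_left) (use L M in \<open>auto simp: d'_def\<close>)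
  ultimately have "(\<lambda>s. F s + G s) = (\<lambda>s. \<Sum>l\<in>L \<union> M. (c' l + d' l) * exp (- of_real l * s))"
    by (simp add: sum.distrib distrib_right)
  with L M show ?case by (intro exI[of _ "L \<union> M"] exI[of _ "\<lambda>l. c' l + d' l"]) auto
qed

section \<open>Parseval's identity\<close>

lemma has_mean_sum:
  "finite I \<Longrightarrow> (\<And>i. i \<in> I \<Longrightarrow> has_mean (u i) (m i)) \<Longrightarrow> (\<And>i. i \<in> I \<Longrightarrow> continuous_on UNIV (u i))
    \<Longrightarrow> has_mean (\<lambda>t. \<Sum>i\<in>I. u i t) (\<Sum>i\<in>I. m i)"
proof (induction I rule: finite_induct)
  case empty
  then show ?case using has_mean_const[of 0] by simp
next
  case (insert x F)
  then show ?case by (auto intro!: has_mean_add continuous_intros)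
qed

lemma parseval:
  assumes L: "finite L"
  shows "mean (\<lambda>t. (norm (\<Sum>l\<in>L. c l * cis (- l * t)))\<^sup>2) = (\<Sum>l\<in>L. (norm (c l))\<^sup>2)"
proof -
  have "(norm (\<Sum>l\<in>L. c l * cis (- l * t)))\<^sup>2 = (\<Sum>l\<in>L. \<Sum>k\<in>L. Re (c l * cnj (c k) * cis ((k - l) * t)))" for t
  proof -
    let ?S = "\<Sum>l\<in>L. c l * cis (- l * t)"
    have "(norm ?S)\<^sup>2 = Re (?S * cnj ?S)" by (simp add: complex_mult_cnj cmod_power2 del: cnj_sum)
    also have "?S * cnj ?S = (\<Sum>l\<in>L. \<Sum>k\<in>L. c l * cnj (c k) * cis ((k - l) * t))"
      unfolding cnj_sum sum_product
    proof (intro sum.cong refl)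
      fix l k
      have "cis ((k - l) * t) = cis (- l * t) * cnj (cis (- k * t))"
        unfolding cis_cnj cis_mult by (simp add: algebra_simps)
      then show "c l * cis (- l * t) * cnj (c k * cis (- k * t)) = c l * cnj (c k) * cis ((k - l) * t)"
        by simp
    qed
    finally show ?thesis by simp
  qed
  moreover have "has_mean (\<lambda>t. \<Sum>l\<in>L. \<Sum>k\<in>L. Re (c l * cnj (c k) * cis ((k - l) * t)))
      (\<Sum>l\<in>L. \<Sum>k\<in>L. if k - l = 0 then Re (c l * cnj (c k)) else 0)"
    by (rule has_mean_sum[OF L has_mean_sum[OF L has_mean_cis]]) (auto intro!: continuous_intros)
  moreover have "(\<Sum>l\<in>L. \<Sum>k\<in>L. if k - l = 0 then Re (c l * cnj (c k)) else 0) = (\<Sum>l\<in>L. (norm (c l))\<^sup>2)"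
  proof (rule sum.cong[OF refl])
    fix l assume l: "l \<in> L"
    have "(\<Sum>k\<in>L. if k - l = 0 then Re (c l * cnj (c k)) else 0) = (\<Sum>k\<in>L. if k = l then Re (c l * cnj (c k)) else 0)"
      by (rule sum.cong) auto
    also have "\<dots> = Re (c l * cnj (c l))" using L l by simp
    also have "\<dots> = (norm (c l))\<^sup>2" by (simp add: cmod_power2 flip: power2_eq_square)
    finally show "(\<Sum>k\<in>L. if k - l = 0 then Re (c l * cnj (c k)) else 0) = (norm (c l))\<^sup>2" .
  qed
  ultimately show ?thesis using has_mean_mean by simp
qed

text \<open>
  Approximating on the closed half-plane, not only on its boundary, makes the shift \<open>s \<mapsto> s + \<delta>\<close>
  well behaved without any maximum principle.
\<close>

definition analytic_ap :: "(complex \<Rightarrow> complex) \<Rightarrow> bool" where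
  "analytic_ap F \<longleftrightarrow> (\<forall>e>0. \<exists>Q. analytic_poly Q \<and> (\<forall>s. Re s \<ge> 0 \<longrightarrow> norm (F s - Q s) \<le> e))"

lemma analytic_ap_analytic_poly: "analytic_poly F \<Longrightarrow> analytic_ap F"
  unfolding analytic_ap_def by (intro allI impI exI[of _ F]) auto

lemma analytic_ap_bounded:
  assumes "analytic_ap F" shows "\<exists>C. \<forall>s. Re s \<ge> 0 \<longrightarrow> norm (F s) \<le> C"
proof -
  obtain Q where q: "analytic_poly Q" "\<And>s. Re s \<ge> 0 \<Longrightarrow> norm (F s - Q s) \<le> 1"
    using assms unfolding analytic_ap_def by (meson zero_less_one)
  obtain C where C: "\<And>s. Re s \<ge> 0 \<Longrightarrow> norm (Q s) \<le> C" using analytic_poly_bounded[OF q(1)] by auto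
  have "norm (F s) \<le> C + 1" if "Re s \<ge> 0" for s
    using norm_triangle_ineq[of "F s - Q s" "Q s"] q(2)[OF that] C[OF that] by simp
  then show ?thesis by blast
qed

lemma analytic_ap_ap:
  assumes "analytic_ap F" "\<sigma> \<ge> 0" shows "ap (\<lambda>t. F (Complex \<sigma> t))"
  unfolding ap_def
proof (intro allI impI)
  fix e :: real assume "e > 0"
  then obtain Q where "analytic_poly Q" "\<And>s. Re s \<ge> 0 \<Longrightarrow> norm (F s - Q s) \<le> e"
    using assms(1) unfolding analytic_ap_def by meson
  then show "\<exists>q. trig_poly q \<and> (\<forall>t. norm (F (Complex \<sigma> t) - q t) \<le> e)"
    using assms(2) analytic_poly_trig_poly[of Q \<sigma>] by (intro exI[of _ "\<lambda>t. Q (Complex \<sigma> t)"]) auto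
qed

lemma small_scale:
  fixes e K :: real assumes "e > 0" "K > 0"
  obtains k where "k > 0" "k \<le> 1" "K * k \<le> e"
proof
  have "K * min 1 (e / K) \<le> K * (e / K)" using assms by (intro mult_left_mono) auto
  then show "K * min 1 (e / K) \<le> e" using assms by simp
qed (use assms in auto)

lemma analytic_ap_mult:
  assumes "analytic_ap F" "analytic_ap G" shows "analytic_ap (\<lambda>s. F s * G s)"
  unfolding analytic_ap_def
proof (intro allI impI)
  fix e :: real assume e: "e > 0"
  obtain C where C: "\<And>s. Re s \<ge> 0 \<Longrightarrow> norm (F s) \<le> C" using analytic_ap_bounded[OF assms(1)] by auto
  obtain D where D: "\<And>s. Re s \<ge> 0 \<Longrightarrow> norm (G s) \<le> D" using analytic_ap_bounded[OF assms(2)] by auto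
  have C0: "C \<ge> 0" and D0: "D \<ge> 0"
    using order_trans[OF norm_ge_zero C[of 0]] order_trans[OF norm_ge_zero D[of 0]] by simp_all
  obtain k where k: "k > 0" "k \<le> 1" "(C + D + 1) * k \<le> e"
    using small_scale[OF e, of "C + D + 1"] C0 D0 by auto
  obtain P where P: "analytic_poly P" "\<And>s. Re s \<ge> 0 \<Longrightarrow> norm (F s - P s) \<le> k"
    using assms(1) k unfolding analytic_ap_def by meson
  obtain Q where Q: "analytic_poly Q" "\<And>s. Re s \<ge> 0 \<Longrightarrow> norm (G s - Q s) \<le> k"
    using assms(2) k unfolding analytic_ap_def by meson
  have "norm (F s * G s - P s * Q s) \<le> e" if s: "Re s \<ge> 0" for s
  proof -
    have "norm (Q s) \<le> D + 1"
      using norm_triangle_ineq2[of "Q s" "G s"] Q(2)[OF s] D[OF s] k by (simp add: norm_minus_commute)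
    have "F s * G s - P s * Q s = F s * (G s - Q s) + (F s - P s) * Q s" by (simp add: algebra_simps)
    also have "norm \<dots> \<le> norm (F s) * norm (G s - Q s) + norm (F s - P s) * norm (Q s)"
      by (metis norm_mult norm_triangle_ineq)
    also have "\<dots> \<le> C * k + k * (D + 1)"
      using C[OF s] Q(2)[OF s] P(2)[OF s] \<open>norm (Q s) \<le> D + 1\<close> C0 k by (intro add_mono mult_mono) auto
    also have "\<dots> \<le> e" using k(3) by (simp add: algebra_simps)
    finally show ?thesis .
  qed
  then show "\<exists>R. analytic_poly R \<and> (\<forall>s. Re s \<ge> 0 \<longrightarrow> norm (F s * G s - R s) \<le> e)"
    using analytic_poly_mult[OF P(1) Q(1)] by (intro exI[of _ "\<lambda>s. P s * Q s"]) auto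
qed

text \<open>\<open>V\<close> is bounded on the half-plane, so the Taylor polynomials of the
  exponential converge uniformly there. The result is in general no finite sum of exponentials,
  which is why the larger class is used.\<close>

lemma analytic_ap_exp:
  assumes "analytic_poly V" shows "analytic_ap (\<lambda>s. exp (V s))"
  unfolding analytic_ap_def
proof (intro allI impI)
  fix e :: real assume e: "e > 0"
  obtain C where C: "\<And>s. Re s \<ge> 0 \<Longrightarrow> norm (V s) \<le> C" using analytic_poly_bounded[OF assms] by auto
  have C0: "C \<ge> 0" using order_trans[OF norm_ge_zero C[of 0]] by simp
  have "(\<lambda>n. exp C * (C * (C ^ n / fact n))) \<longlonglongrightarrow> exp C * (C * 0)"
    by (intro tendsto_intros) (use summable_LIMSEQ_zero[OF summable_exp[of C]] in \<open>simp add: divide_inverse mult.commute\<close>)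
  then have "\<forall>\<^sub>F n in sequentially. exp C * (C * (C ^ n / fact n)) < e"
    using e by (intro order_tendstoD) auto
  then obtain n where n: "exp C * (C * (C ^ n / fact n)) < e"
    using eventually_happens'[OF sequentially_bot] by blast
  have "norm (exp (V s) - (\<Sum>k\<le>n. (1 / fact k) * V s ^ k)) \<le> e" if s: "Re s \<ge> 0" for s
  proof -
    have "norm (exp (V s) - (\<Sum>k\<le>n. V s ^ k / fact k)) \<le> exp (norm (V s)) * (norm (V s) ^ Suc n) / fact n"
      by (rule Taylor_exp_field)
    also have "\<dots> \<le> exp C * C ^ Suc n / fact n"
      using C[OF s] C0 by (intro divide_right_mono mult_mono power_mono) auto
    also have "\<dots> \<le> e" using n by simp
    finally show ?thesis by simp
  qed
  moreover have "analytic_poly (\<lambda>s. \<Sum>k\<le>n. (1 / fact k) * V s ^ k)"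
    by (intro analytic_poly_sum finite_atMost analytic_poly_mult[OF analytic_poly_const analytic_poly_power[OF assms]])
  ultimately show "\<exists>Q. analytic_poly Q \<and> (\<forall>s. Re s \<ge> 0 \<longrightarrow> norm (exp (V s) - Q s) \<le> e)" by blast
qed

lemma real_ap_norm2: "ap f \<Longrightarrow> real_ap (\<lambda>t. (norm (f t))\<^sup>2)"
  by (rule real_ap_compose[where \<phi> = "\<lambda>z. (norm z)\<^sup>2"]) (auto intro!: continuous_intros)

lemma ap_diff: 
  assumes "ap f" "ap g" shows "ap (\<lambda>t. f t - g t)"
  unfolding ap_def
proof (intro allI impI)
  fix e :: real assume "e > 0"
  then have e: "e / 2 > 0" by simp
  obtain q where q: "trig_poly q" "\<And>t. norm (f t - q t) \<le> e / 2" using assms(1) e unfolding ap_def by meson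
  obtain r where r: "trig_poly r" "\<And>t. norm (g t - r t) \<le> e / 2" using assms(2) e unfolding ap_def by meson
  have "norm (f t - g t - (q t + (-1) * r t)) \<le> e" for t
    using norm_triangle_ineq4[of "f t - q t" "g t - r t"] q(2)[of t] r(2)[of t] by (simp add: algebra_simps)
  then show "\<exists>q. trig_poly q \<and> (\<forall>t. norm (f t - g t - q t) \<le> e)"
    using trig_poly.add[OF q(1) trig_poly_mult[OF trig_poly_const r(1)]] by blast
qed

lemma mean_le_add:
  assumes "real_ap u" "real_ap v" "\<And>t. u t \<le> v t + e" shows "mean u \<le> mean v + e"
  using mean_mono[OF assms(1) real_ap_add[OF assms(2) real_ap_const[of e]] assms(3)]
  by (simp add: mean_add[OF assms(2) real_ap_const] mean_const)

text \<open>By Parseval the claim reduces to \<open>(1 - x)\<^sup>2 \<le> 1 - x\<^sup>2\<close> for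
  each damping factor \<open>x = exp (- l * \<delta>)\<close> between 0 and 1. It is stronger than
  contraction: the lost energy bounds the displacement, on which the case \<open>p = 1\<close>
  rests.\<close>

lemma analytic_poly_L2:
  assumes "analytic_poly F" "\<delta> \<ge> 0"
  shows "mean (\<lambda>t. (norm (F (Complex 0 t) - F (Complex \<delta> t)))\<^sup>2)
    \<le> mean (\<lambda>t. (norm (F (Complex 0 t)))\<^sup>2) - mean (\<lambda>t. (norm (F (Complex \<delta> t)))\<^sup>2)"
proof -
  obtain L c where L: "finite L" "\<forall>l\<in>L. 0 \<le> l" and F: "F = (\<lambda>s. \<Sum>l\<in>L. c l * exp (- of_real l * s))"
    using analytic_poly_repr[OF assms(1)] by blast
  define x where "x l = exp (- (l * \<delta>))" for l
  have x: "0 \<le> x l" "x l \<le> 1" if "l \<in> L" for l using that L assms by (auto simp: x_def)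
  have 1: "F (Complex 0 t) = (\<Sum>l\<in>L. c l * cis (- l * t))" for t
    unfolding F exp_on_line by simp
  have 2: "F (Complex \<delta> t) = (\<Sum>l\<in>L. (c l * of_real (x l)) * cis (- l * t))" for t
    unfolding F exp_on_line x_def by (simp add: mult.assoc)
  have 3: "F (Complex 0 t) - F (Complex \<delta> t) = (\<Sum>l\<in>L. (c l * of_real (1 - x l)) * cis (- l * t))" for t
    unfolding 1 2 by (simp add: sum_subtractf[symmetric] algebra_simps)
  have "(norm (c l))\<^sup>2 * (1 - x l)\<^sup>2 \<le> (norm (c l))\<^sup>2 * (1 - (x l)\<^sup>2)" if "l \<in> L" for l
  proof (intro mult_left_mono)
    show "(1 - x l)\<^sup>2 \<le> 1 - (x l)\<^sup>2"
      using mult_left_mono[OF x(2)[OF that] x(1)[OF that]] by (simp add: power2_eq_square algebra_simps)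
  qed simp
  then have "(\<Sum>l\<in>L. (norm (c l * of_real (1 - x l)))\<^sup>2) \<le> (\<Sum>l\<in>L. (norm (c l))\<^sup>2 - (norm (c l * of_real (x l)))\<^sup>2)"
    by (intro sum_mono) (auto simp: norm_mult power_mult_distrib algebra_simps norm_of_real simp del: of_real_diff)
  then show ?thesis unfolding 3 unfolding 1 2 parseval[OF L(1)] by (simp add: sum_subtractf)
qed

lemma norm2_close:
  fixes a b :: complex
  assumes "norm (a - b) \<le> e" "norm a \<le> C" "norm b \<le> C"
  shows "(norm a)\<^sup>2 \<le> (norm b)\<^sup>2 + 2 * C * e"
proof -
  have "(norm a)\<^sup>2 - (norm b)\<^sup>2 = (norm a - norm b) * (norm a + norm b)"
    by (simp add: power2_eq_square algebra_simps)
  also have "\<dots> \<le> e * (C + C)"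
  proof (rule mult_mono)
    show "norm a - norm b \<le> e" using norm_triangle_ineq2[of a b] assms by linarith
    show "0 \<le> e" using assms norm_ge_zero order_trans by blast
  qed (use assms in auto)
  finally show ?thesis by (simp add: algebra_simps)
qed

lemma analytic_ap_L2:
  assumes F: "analytic_ap F" and d: "\<delta> \<ge> 0"
  shows "mean (\<lambda>t. (norm (F (Complex 0 t) - F (Complex \<delta> t)))\<^sup>2)
    \<le> mean (\<lambda>t. (norm (F (Complex 0 t)))\<^sup>2) - mean (\<lambda>t. (norm (F (Complex \<delta> t)))\<^sup>2)"
proof (rule field_le_epsilon)
  fix e :: real assume e: "e > 0"
  obtain C where C: "\<And>s. Re s \<ge> 0 \<Longrightarrow> norm (F s) \<le> C" using analytic_ap_bounded[OF F] by auto
  have C0: "C \<ge> 0" using order_trans[OF norm_ge_zero C[of 0]] by simp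
  \<comment> \<open>The replacements of \<open>F\<close> by \<open>Q\<close> cost
    \<open>8 * (C + 1) * k\<close> for the difference and \<open>2 * (C + 1) * k\<close> for each of
    the other two means.\<close>
  obtain k where k: "k > 0" "k \<le> 1" "12 * (C + 1) * k \<le> e"
    using small_scale[OF e, of "12 * (C + 1)"] C0 by auto
  obtain Q where Q: "analytic_poly Q" "\<And>s. Re s \<ge> 0 \<Longrightarrow> norm (F s - Q s) \<le> k"
    using F k unfolding analytic_ap_def by meson
  have QC: "norm (Q s) \<le> C + 1" if s: "Re s \<ge> 0" for s
    using norm_triangle_ineq2[of "Q s" "F s"] Q(2)[OF s] C[OF s] k by (simp add: norm_minus_commute)
  have C1: "norm (F s) \<le> C + 1" if s: "Re s \<ge> 0" for s
    using C[OF s] by simp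
  note hc = analytic_ap_ap[OF F order_refl] analytic_ap_ap[OF F d] analytic_ap_ap[OF analytic_ap_analytic_poly[OF Q(1)] order_refl] analytic_ap_ap[OF analytic_ap_analytic_poly[OF Q(1)] d]
  have a: "mean (\<lambda>t. (norm (F (Complex 0 t) - F (Complex \<delta> t)))\<^sup>2)
     \<le> mean (\<lambda>t. (norm (Q (Complex 0 t) - Q (Complex \<delta> t)))\<^sup>2) + 2 * (2 * (C + 1)) * (2 * k)"
  proof (intro mean_le_add real_ap_norm2 ap_diff hc norm2_close)
    fix t
    show "norm (F (Complex 0 t) - F (Complex \<delta> t) - (Q (Complex 0 t) - Q (Complex \<delta> t))) \<le> 2 * k"
      using norm_triangle_ineq4[of "F (Complex 0 t) - Q (Complex 0 t)" "F (Complex \<delta> t) - Q (Complex \<delta> t)"]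
        Q(2)[of "Complex 0 t"] Q(2)[of "Complex \<delta> t"] d by (simp add: algebra_simps)
    show "norm (F (Complex 0 t) - F (Complex \<delta> t)) \<le> 2 * (C + 1)"
      using norm_triangle_ineq4[of "F (Complex 0 t)" "F (Complex \<delta> t)"] C[of "Complex 0 t"] C[of "Complex \<delta> t"] d by simp
    show "norm (Q (Complex 0 t) - Q (Complex \<delta> t)) \<le> 2 * (C + 1)"
      using norm_triangle_ineq4[of "Q (Complex 0 t)" "Q (Complex \<delta> t)"] QC[of "Complex 0 t"] QC[of "Complex \<delta> t"] d by simp
  qed
  have b: "mean (\<lambda>t. (norm (Q (Complex 0 t)))\<^sup>2) \<le> mean (\<lambda>t. (norm (F (Complex 0 t)))\<^sup>2) + 2 * (C + 1) * k"
    by (intro mean_le_add real_ap_norm2 hc norm2_close)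
       (use Q(2) QC C1 in \<open>auto simp: norm_minus_commute\<close>)
  have c: "mean (\<lambda>t. (norm (F (Complex \<delta> t)))\<^sup>2) \<le> mean (\<lambda>t. (norm (Q (Complex \<delta> t)))\<^sup>2) + 2 * (C + 1) * k"
    by (intro mean_le_add real_ap_norm2 hc norm2_close)
       (use Q(2) QC C1 d in \<open>auto simp: norm_minus_commute\<close>)
  show "mean (\<lambda>t. (norm (F (Complex 0 t) - F (Complex \<delta> t)))\<^sup>2)
    \<le> mean (\<lambda>t. (norm (F (Complex 0 t)))\<^sup>2) - mean (\<lambda>t. (norm (F (Complex \<delta> t)))\<^sup>2) + e"
    using a b c analytic_poly_L2[OF Q(1) d] k(3) by (simp add: algebra_simps)
qed

subsection \<open>Factorization and contractivity of the shift\<close>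

lemma analytic_poly_ap: "analytic_poly F \<Longrightarrow> ap (\<lambda>t. F (Complex \<sigma> t))"
  by (intro ap_trig_poly analytic_poly_trig_poly)

lemma real_ap_norm_powr:
  assumes "ap f" "p > 0" shows "real_ap (\<lambda>t. norm (f t) powr p)"
proof (rule real_ap_compose[where \<phi> = "\<lambda>z. norm z powr p", OF assms(1)])
  show "continuous_on UNIV (\<lambda>z::complex. norm z powr p)"
    by (rule continuous_on_powr') (use assms(2) in \<open>auto intro: continuous_intros\<close>)
qed

lemma mean_nonneg: "real_ap u \<Longrightarrow> (\<And>t. 0 \<le> u t) \<Longrightarrow> 0 \<le> mean u"
  using mean_mono[OF real_ap_const, of u 0] by (simp add: mean_const)

text \<open>Conjugating a coefficient and reversing its frequency does not change the real part, so
  all frequencies can be moved to the analytic side. This plays the role of the harmonic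
  conjugate.\<close>

lemma trig_poly_Re_analytic_poly:
  "trig_poly q \<Longrightarrow> \<exists>V. analytic_poly V \<and> (\<forall>t. Re (V (Complex 0 t)) = Re (q t))"
proof (induction rule: trig_poly.induct)
  case (monom c l)
  show ?case
  proof (cases "l \<le> 0")
    case True
    have "Re (c * exp (- of_real (- l) * Complex 0 t)) = Re (c * cis (l * t))" for t
      unfolding exp_on_line by simp
    with True show ?thesis using analytic_poly.monom[of "-l" c] by (intro exI[of _ "\<lambda>s. c * exp (- of_real (- l) * s)"]) auto
  next
    case False
    have "Re (cnj c * exp (- of_real l * Complex 0 t)) = Re (c * cis (l * t))" for t
      unfolding exp_on_line by simp
    with False show ?thesis using analytic_poly.monom[of l "cnj c"] by (intro exI[of _ "\<lambda>s. cnj c * exp (- of_real l * s)"]) auto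
  qed
next
  case (add f g)
  then obtain V W where "analytic_poly V" "\<forall>t. Re (V (Complex 0 t)) = Re (f t)" "analytic_poly W" "\<forall>t. Re (W (Complex 0 t)) = Re (g t)"
    by blast
  then show ?case by (intro exI[of _ "\<lambda>s. V s + W s"]) (auto intro: analytic_poly.add)
qed

text \<open>Collects the two errors of the factorization: \<open>\<rho>\<close> is added under the
  logarithm, \<open>e\<close> is the uniform error of \<open>Re V\<close>, and \<open>D\<close>
  dominates the factors by which that error gets multiplied.\<close>

lemma powr_perturb:
  fixes p C D \<eta> :: real
  assumes "p > 0" "\<eta> > 0" "C \<ge> 0" "D \<ge> 0"
  obtains \<rho> e where "\<rho> > 0" "e > 0"
    "\<And>x. 0 \<le> x \<Longrightarrow> x \<le> C \<Longrightarrow> (x + \<rho>) powr p * exp (D * e) \<le> x powr p + \<eta>"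
proof -
  have "uniformly_continuous_on {0..C + 1} (\<lambda>x. x powr p)"
  proof (rule compact_uniformly_continuous)
    show "continuous_on {0..C + 1} (\<lambda>x. x powr p)"
      by (rule continuous_on_powr') (use assms(1) in \<open>auto intro: continuous_intros\<close>)
  qed simp
  then obtain d where d: "d > 0" "\<And>x y. x \<in> {0..C+1} \<Longrightarrow> y \<in> {0..C+1} \<Longrightarrow> dist y x < d \<Longrightarrow> dist (y powr p) (x powr p) < \<eta> / 2"
    using assms unfolding uniformly_continuous_on_def by (metis half_gt_zero)
  define \<rho> where "\<rho> = min 1 (d / 2)"
  have \<rho>: "\<rho> > 0" "\<rho> \<le> 1" "\<rho> < d" using d by (auto simp: \<rho>_def)
  define M where "M = (C + 1) powr p"
  have M: "M > 0" using assms by (simp add: M_def)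
  have "((\<lambda>e. M * (exp (D * e) - 1)) \<longlongrightarrow> M * (exp (D * 0) - 1)) (at_right 0)"
    by (intro tendsto_intros)
  then have "\<forall>\<^sub>F e in at_right 0. M * (exp (D * e) - 1) < \<eta> / 2"
    using assms by (intro order_tendstoD) auto
  moreover have "\<forall>\<^sub>F e in at_right (0::real). e > 0" by (simp add: eventually_at_filter)
  ultimately have "\<forall>\<^sub>F e in at_right 0. e > 0 \<and> M * (exp (D * e) - 1) < \<eta> / 2" by eventually_elim simp
  then obtain e where e: "e > 0" "M * (exp (D * e) - 1) < \<eta> / 2"
    using eventually_happens'[OF trivial_limit_at_right_real] by blast
  have "(x + \<rho>) powr p * exp (D * e) \<le> x powr p + \<eta>" if x: "0 \<le> x" "x \<le> C" for x
  proof -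
    have "dist ((x + \<rho>) powr p) (x powr p) < \<eta> / 2"
      using d(2)[of x "x + \<rho>"] x \<rho> by (auto simp: dist_real_def)
    then have 1: "(x + \<rho>) powr p \<le> x powr p + \<eta> / 2" unfolding dist_real_def by linarith
    have "(x + \<rho>) powr p * (exp (D * e) - 1) \<le> M * (exp (D * e) - 1)"
      unfolding M_def using x \<rho> assms e by (intro mult_right_mono powr_mono2) auto
    with 1 e show ?thesis by (simp add: algebra_simps)
  qed
  with \<rho> e show ?thesis using that by blast
qed

text \<open>
  \<open>Re V\<close> approximates \<open>ln (|F| + \<rho>)\<close> on the boundary, so \<open>exp V\<close> plays the role of an outer function with
  modulus \<open>|F|\<close>; adding \<open>\<rho>\<close> removes the singularities of the logarithm at the zeros of \<open>F\<close>.
\<close>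

lemma factorization:
  assumes F: "analytic_poly F" and p: "0 < p" "p \<le> 2 * real j" and eta: "\<eta> > 0"
  obtains V where "analytic_poly V"
    "mean (\<lambda>t. (norm (exp (of_real (p / 2) * V (Complex 0 t))))\<^sup>2)
      \<le> mean (\<lambda>t. norm (F (Complex 0 t)) powr p) + \<eta>"
    "mean (\<lambda>t. (norm (F (Complex 0 t) ^ j * exp (of_real (p / 2 - j) * V (Complex 0 t))))\<^sup>2)
      \<le> mean (\<lambda>t. norm (F (Complex 0 t)) powr p) + \<eta>"
proof -
  let ?f = "\<lambda>t. F (Complex 0 t)"
  note capF = analytic_poly_ap[OF F, of 0]
  obtain C where C: "\<And>t. norm (?f t) \<le> C" using ap_bounded[OF capF] by auto
  have C0: "C \<ge> 0" using order_trans[OF norm_ge_zero C[of 0]] .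
  obtain \<rho> e where re: "\<rho> > 0" "e > 0"
    "\<And>x. 0 \<le> x \<Longrightarrow> x \<le> C \<Longrightarrow> (x + \<rho>) powr p * exp ((2 * real j) * e) \<le> x powr p + \<eta>"
    using powr_perturb[OF p(1) eta C0, of "2 * real j"] by auto
  have "real_ap (\<lambda>t. ln (norm (?f t) + \<rho>))"
    by (rule real_ap_compose[OF capF, where \<phi> = "\<lambda>z. ln (norm z + \<rho>)"])
       (use re in \<open>auto intro!: continuous_intros simp: add_nonneg_pos less_imp_neq[THEN not_sym]\<close>)
  then obtain q where q: "trig_poly q" "\<And>t. \<bar>ln (norm (?f t) + \<rho>) - Re (q t)\<bar> \<le> e"
    using re(2) unfolding real_ap_def by meson
  obtain V where V: "analytic_poly V" "\<And>t. Re (V (Complex 0 t)) = Re (q t)"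
    using trig_poly_Re_analytic_poly[OF q(1)] by blast
  have hcV: "analytic_ap (\<lambda>s. exp (of_real c * V s))" for c
    by (rule analytic_ap_exp[OF analytic_poly_mult[OF analytic_poly_const V(1)]])
  note capG = analytic_ap_ap[OF hcV order_refl]
  have capK: "ap (\<lambda>t. F (Complex 0 t) ^ j * exp (of_real (p / 2 - j) * V (Complex 0 t)))"
    by (rule analytic_ap_ap[OF analytic_ap_mult[OF analytic_ap_analytic_poly[OF analytic_poly_power[OF F]] hcV] order_refl])
  have n2: "(norm (exp (of_real c * z)))\<^sup>2 = exp (2 * c * Re z)" for c z
    by (simp add: power2_eq_square exp_add[symmetric])
  have G: "(norm (exp (of_real (p / 2) * V (Complex 0 t))))\<^sup>2 \<le> norm (?f t) powr p + \<eta>" for t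
  proof -
    let ?w = "norm (?f t) + \<rho>"
    have w: "?w > 0" using re(1) by (simp add: add_nonneg_pos)
    have "Re (q t) \<le> ln ?w + e" using q(2)[of t] by linarith
    then have "(norm (exp (of_real (p / 2) * V (Complex 0 t))))\<^sup>2 \<le> exp (p * (ln ?w + e))"
      unfolding n2 V using p by simp
    also have "\<dots> = ?w powr p * exp (p * e)" using w by (simp add: powr_def exp_add[symmetric] algebra_simps)
    also have "\<dots> \<le> ?w powr p * exp (2 * real j * e)" using p re by (intro mult_left_mono) auto
    also have "\<dots> \<le> norm (?f t) powr p + \<eta>" by (rule re(3)) (use C in auto)
    finally show ?thesis .
  qed
  have K: "(norm (?f t ^ j * exp (of_real (p / 2 - j) * V (Complex 0 t))))\<^sup>2 \<le> norm (?f t) powr p + \<eta>" for t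
  proof -
    let ?w = "norm (?f t) + \<rho>"
    have w: "?w > 0" using re(1) by (simp add: add_nonneg_pos)
    \<comment> \<open>As \<open>p / 2 - j \<le> 0\<close>, it is the lower bound on
      \<open>Re V\<close> that controls the exponential. That exponential may be large near zeros of
      \<open>F\<close>; the factor \<open>F ^ j\<close> compensates.\<close>
    have "Re (q t) \<ge> ln ?w - e" using q(2)[of t] by linarith
    then have "(2 * real j - p) * (ln ?w - e) \<le> (2 * real j - p) * Re (q t)"
      using p by (intro mult_left_mono) auto
    then have "exp (2 * (p / 2 - j) * Re (V (Complex 0 t))) \<le> exp ((p - 2 * real j) * ln ?w + (2 * real j - p) * e)"
      unfolding V by (simp add: algebra_simps)
    also have "\<dots> \<le> exp ((p - 2 * real j) * ln ?w + 2 * real j * e)" using p re by simp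
    finally have "(norm (?f t ^ j * exp (of_real (p / 2 - j) * V (Complex 0 t))))\<^sup>2
       \<le> (norm (?f t) ^ j)\<^sup>2 * exp ((p - 2 * real j) * ln ?w + 2 * real j * e)"
      unfolding norm_mult power_mult_distrib n2 by (intro mult_mono) (auto simp: norm_power)
    also have "\<dots> \<le> (?w ^ j)\<^sup>2 * exp ((p - 2 * real j) * ln ?w + 2 * real j * e)"
      using re by (intro mult_right_mono power_mono) auto
    also have "(?w ^ j)\<^sup>2 = exp (2 * real j * ln ?w)"
      using w by (simp add: exp_of_nat_mult power_mult[symmetric] mult.commute exp_of_nat2_mult
         power2_eq_square exp_add[symmetric] flip: powr_realpow) (simp add: powr_def flip: exp_add)
    also have "\<dots> * exp ((p - 2 * real j) * ln ?w + 2 * real j * e) = ?w powr p * exp (2 * real j * e)"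
      using w by (simp add: powr_def exp_add[symmetric] algebra_simps)
    also have "\<dots> \<le> norm (?f t) powr p + \<eta>" by (rule re(3)) (use C in auto)
    finally show ?thesis .
  qed
  show ?thesis
    using mean_le_add[OF real_ap_norm2[OF capG] real_ap_norm_powr[OF capF p(1)] G]
      mean_le_add[OF real_ap_norm2[OF capK] real_ap_norm_powr[OF capF p(1)] K]
    by (intro that[OF V(1)]) auto
qed

lemma young_nonneg:
  fixes a b :: real
  assumes "0 \<le> \<alpha>" "0 \<le> \<beta>" "\<alpha> + \<beta> = 1" "a \<ge> 0" "b \<ge> 0"
  shows "a powr \<alpha> * b powr \<beta> \<le> \<alpha> * a + \<beta> * b"
proof (cases "a = 0 \<or> b = 0")
  case True
  then show ?thesis using assms by auto
next
  case False
  then show ?thesis using assms by (intro Youngs_inequality_0) auto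
qed

lemma analytic_ap_L2_contract:
  assumes F: "analytic_ap F" and d: "\<delta> \<ge> 0"
  shows "mean (\<lambda>t. (norm (F (Complex \<delta> t)))\<^sup>2) \<le> mean (\<lambda>t. (norm (F (Complex 0 t)))\<^sup>2)"
proof -
  have "0 \<le> mean (\<lambda>t. (norm (F (Complex 0 t) - F (Complex \<delta> t)))\<^sup>2)"
    by (intro mean_nonneg real_ap_norm2 ap_diff analytic_ap_ap F d) auto
  with analytic_ap_L2[OF F d] show ?thesis by linarith
qed

text \<open>The Young estimate \<open>pw\<close> rests on an identity between the moduli of
  \<open>F\<close>, \<open>K\<close> and \<open>G\<close> valid wherever \<open>F\<close> does not
  vanish, while the sizes of \<open>K\<close> and \<open>G\<close> are known only on the boundary.
  The \<open>L\<^sup>2\<close> contraction brings the two together on the shifted line.\<close>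

lemma contraction:
  assumes F: "analytic_poly F" and p: "0 < p" and d: "\<delta> \<ge> 0"
  shows "mean (\<lambda>t. norm (F (Complex \<delta> t)) powr p) \<le> mean (\<lambda>t. norm (F (Complex 0 t)) powr p)"
proof (rule field_le_epsilon)
  fix \<eta> :: real assume eta: "\<eta> > 0"
  \<comment> \<open>The least integer with \<open>p \<le> 2 * j\<close>, which makes both Young
    weights nonnegative. It is an integer because \<open>F\<close> may have zeros, so that its
    fractional powers are in general not analytic.\<close>
  define j where "j = nat \<lceil>p / 2\<rceil>"
  have "real j \<ge> p / 2" unfolding j_def by (rule real_nat_ceiling_ge)
  then have j: "p \<le> 2 * real j" by simp
  then have j0: "real j > 0" using p by auto
  let ?m = "mean (\<lambda>t. norm (F (Complex 0 t)) powr p)"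
  obtain V where V: "analytic_poly V"
    "mean (\<lambda>t. (norm (exp (of_real (p / 2) * V (Complex 0 t))))\<^sup>2) \<le> ?m + \<eta>"
    "mean (\<lambda>t. (norm (F (Complex 0 t) ^ j * exp (of_real (p / 2 - j) * V (Complex 0 t))))\<^sup>2) \<le> ?m + \<eta>"
    using factorization[OF F p j eta] by blast
  define G where "G s = exp (of_real (p / 2) * V s)" for s
  define K where "K s = F s ^ j * exp (of_real (p / 2 - j) * V s)" for s
  have G: "analytic_ap G" unfolding G_def
    by (rule analytic_ap_exp[OF analytic_poly_mult[OF analytic_poly_const V(1)]])
  have K: "analytic_ap K" unfolding K_def
    by (rule analytic_ap_mult[OF analytic_ap_analytic_poly[OF analytic_poly_power[OF F]] analytic_ap_exp[OF analytic_poly_mult[OF analytic_poly_const V(1)]]])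
  define \<alpha> where "\<alpha> = p / (2 * real j)"
  have al: "0 \<le> \<alpha>" "0 \<le> 1 - \<alpha>" using p j j0 by (auto simp: \<alpha>_def)
  have pw: "norm (F s) powr p \<le> \<alpha> * (norm (K s))\<^sup>2 + (1 - \<alpha>) * (norm (G s))\<^sup>2" for s
  proof (cases "F s = 0")
    case True
    then show ?thesis using al p by simp
  next
    case False
    have nK: "(norm (K s))\<^sup>2 = exp (2 * real j * ln (norm (F s)) + (p - 2 * real j) * Re (V s))"
    proof -
      have "norm (F s) = exp (ln (norm (F s)))" using False by simp
      then have "norm (F s) ^ j = exp (real j * ln (norm (F s)))" by (metis exp_of_nat_mult)
      then show ?thesis unfolding K_def
        by (simp add: norm_mult norm_power power2_eq_square exp_add[symmetric] algebra_simps)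
    qed
    have nG: "(norm (G s))\<^sup>2 = exp (p * Re (V s))"
      unfolding G_def by (simp add: power2_eq_square exp_add[symmetric])
    have "\<alpha> * (2 * real j * ln (norm (F s)) + (p - 2 * real j) * Re (V s)) + (1 - \<alpha>) * (p * Re (V s))
       = p * ln (norm (F s))"
      unfolding \<alpha>_def using j0 by (simp add: field_simps)
    then have "norm (F s) powr p = (norm (K s))\<^sup>2 powr \<alpha> * (norm (G s))\<^sup>2 powr (1 - \<alpha>)"
      unfolding nK nG using False by (simp add: powr_def exp_add[symmetric])
    also have "\<dots> \<le> \<alpha> * (norm (K s))\<^sup>2 + (1 - \<alpha>) * (norm (G s))\<^sup>2"
      by (rule young_nonneg) (use al in auto)
    finally show ?thesis .
  qed
  note rK = real_ap_norm2[OF analytic_ap_ap[OF K d]] and rG = real_ap_norm2[OF analytic_ap_ap[OF G d]]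
  have "mean (\<lambda>t. norm (F (Complex \<delta> t)) powr p)
     \<le> mean (\<lambda>t. \<alpha> * (norm (K (Complex \<delta> t)))\<^sup>2 + (1 - \<alpha>) * (norm (G (Complex \<delta> t)))\<^sup>2)"
    by (intro mean_mono real_ap_norm_powr analytic_poly_ap F p real_ap_add real_ap_cmult rK rG pw)
  also have "\<dots> = \<alpha> * mean (\<lambda>t. (norm (K (Complex \<delta> t)))\<^sup>2) + (1 - \<alpha>) * mean (\<lambda>t. (norm (G (Complex \<delta> t)))\<^sup>2)"
    by (simp add: mean_add mean_cmult real_ap_cmult rK rG)
  also have "\<dots> \<le> \<alpha> * (?m + \<eta>) + (1 - \<alpha>) * (?m + \<eta>)"
    using analytic_ap_L2_contract[OF K d] analytic_ap_L2_contract[OF G d] V(2,3) al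
    unfolding G_def K_def by (intro add_mono mult_left_mono) auto
  finally show "mean (\<lambda>t. norm (F (Complex \<delta> t)) powr p) \<le> ?m + \<eta>" by (simp add: algebra_simps)
qed

text \<open>
  With \<open>F = K G\<close> and \<open>|K|\<^sup>2\<close>, \<open>|G|\<^sup>2\<close> close to \<open>|F|\<close> on the boundary, the mean of \<open>|F|\<close> on the shifted line is at
  most half the sum of the squared norms of the shifts of \<open>K\<close> and \<open>G\<close>. So if \<open>F\<close> barely loses
  norm, then neither do \<open>K\<close> and \<open>G\<close>, and in \<open>L\<^sup>2\<close> this means that they barely move.
\<close>

lemma near_isometry_L1:
  assumes F: "analytic_poly F" and d: "\<delta> \<ge> 0" and eta: "0 < \<eta>" "\<eta> \<le> 1"
    and B: "mean (\<lambda>t. norm (F (Complex 0 t))) \<le> B"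
    and near: "mean (\<lambda>t. norm (F (Complex 0 t))) - \<eta> \<le> mean (\<lambda>t. norm (F (Complex \<delta> t)))"
  shows "mean (\<lambda>t. norm (F (Complex 0 t) - F (Complex \<delta> t))) \<le> (B + 5) * sqrt \<eta>"
proof -
  let ?m = "mean (\<lambda>t. norm (F (Complex 0 t)))"
  obtain V where V: "analytic_poly V"
    "mean (\<lambda>t. (norm (exp (of_real (1 / 2) * V (Complex 0 t))))\<^sup>2) \<le> ?m + \<eta>"
    "mean (\<lambda>t. (norm (F (Complex 0 t) ^ 1 * exp (of_real (1 / 2 - real 1) * V (Complex 0 t))))\<^sup>2) \<le> ?m + \<eta>"
    using factorization[OF F, of 1 1 \<eta>] eta by auto
  define G where "G s = exp (of_real (1 / 2) * V s)" for s
  define K where "K s = F s ^ 1 * exp (of_real (1 / 2 - real 1) * V s)" for s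
  have G: "analytic_ap G" unfolding G_def
    by (rule analytic_ap_exp[OF analytic_poly_mult[OF analytic_poly_const V(1)]])
  have K: "analytic_ap K" unfolding K_def
    by (rule analytic_ap_mult[OF analytic_ap_analytic_poly[OF analytic_poly_power[OF F]] analytic_ap_exp[OF analytic_poly_mult[OF analytic_poly_const V(1)]]])
  have FKG: "F s = K s * G s" for s
    unfolding K_def G_def by (simp add: mult.assoc exp_add[symmetric] algebra_simps)
  let ?M = "\<lambda>H \<sigma>. mean (\<lambda>t. (norm (H (Complex \<sigma> t)))\<^sup>2)"
  note r = real_ap_norm2[OF analytic_ap_ap[OF K order_refl]] real_ap_norm2[OF analytic_ap_ap[OF G order_refl]]
    real_ap_norm2[OF analytic_ap_ap[OF K d]] real_ap_norm2[OF analytic_ap_ap[OF G d]]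
    real_ap_norm2[OF ap_diff[OF analytic_ap_ap[OF K order_refl] analytic_ap_ap[OF K d]]]
    real_ap_norm2[OF ap_diff[OF analytic_ap_ap[OF G order_refl] analytic_ap_ap[OF G d]]]
  have rn: "ap f \<Longrightarrow> real_ap (\<lambda>t. norm (f t))" for f
    using real_ap_norm_powr[of f 1] by simp
  have KX: "?M K 0 \<le> ?m + \<eta>" and GX: "?M G 0 \<le> ?m + \<eta>"
    using V unfolding K_def G_def by auto
  have "mean (\<lambda>t. norm (F (Complex \<delta> t))) \<le> mean (\<lambda>t. (1/2) * (norm (K (Complex \<delta> t)))\<^sup>2 + (1/2) * (norm (G (Complex \<delta> t)))\<^sup>2)"
  proof (intro mean_mono rn analytic_poly_ap F real_ap_add real_ap_cmult r)
    fix t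
    have "0 \<le> (norm (K (Complex \<delta> t)) - norm (G (Complex \<delta> t)))\<^sup>2" by simp
    then show "norm (F (Complex \<delta> t)) \<le> (1/2) * (norm (K (Complex \<delta> t)))\<^sup>2 + (1/2) * (norm (G (Complex \<delta> t)))\<^sup>2"
      unfolding FKG norm_mult power2_diff by simp
  qed
  also have "\<dots> = (1/2) * ?M K \<delta> + (1/2) * ?M G \<delta>"
    by (simp only: mean_add mean_cmult real_ap_cmult r)
  finally have sum: "2 * (?m - \<eta>) \<le> ?M K \<delta> + ?M G \<delta>" using near by simp
  have cK: "?M K \<delta> \<le> ?M K 0" and cG: "?M G \<delta> \<le> ?M G 0"
    by (rule analytic_ap_L2_contract[OF K d]) (rule analytic_ap_L2_contract[OF G d])
  \<comment> \<open>The squared norms of \<open>K\<close> and \<open>G\<close> together lose at most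
    \<open>4 * h\<close>, and neither grows, so each of them alone loses at most that much.\<close>
  have gap: "a \<le> 4 * h" if "a \<le> x - y" "2 * (m - h) \<le> y + z" "z \<le> w" "x \<le> m + h" "w \<le> m + h"
    for a x y z w m h :: real
    using that by argo
  have dK: "mean (\<lambda>t. (norm (K (Complex 0 t) - K (Complex \<delta> t)))\<^sup>2) \<le> 4 * \<eta>"
    by (rule gap[OF analytic_ap_L2[OF K d] sum cG KX GX])
  have dG: "mean (\<lambda>t. (norm (G (Complex 0 t) - G (Complex \<delta> t)))\<^sup>2) \<le> 4 * \<eta>"
    by (rule gap[OF analytic_ap_L2[OF G d] sum[unfolded add.commute[of "?M K \<delta>"]] cK GX KX])
  \<comment> \<open>\<open>\<tau> = sqrt \<eta>\<close> balances Young's inequality: the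
    displacements contribute \<open>4 * \<eta> / (2 * \<tau>)\<close> twice and the sizes
    \<open>\<tau> / 2 * (B + 1)\<close> twice, in total \<open>(B + 5) * \<tau>\<close>.\<close>
  define \<tau> where "\<tau> = sqrt \<eta>"
  have tau: "\<tau> > 0" "\<tau> * \<tau> = \<eta>" using eta by (auto simp: \<tau>_def)
  have young: "a * b \<le> (1 / (2 * \<tau>)) * a\<^sup>2 + (\<tau> / 2) * b\<^sup>2" for a b
  proof -
    have "0 \<le> (a - \<tau> * b)\<^sup>2 / (2 * \<tau>)" using tau by simp
    also have "\<dots> = (1 / (2 * \<tau>)) * a\<^sup>2 + (\<tau> / 2) * b\<^sup>2 - a * b"
      using tau by (simp add: power2_eq_square field_simps)
    finally show ?thesis by simp
  qed
  have "mean (\<lambda>t. norm (F (Complex 0 t) - F (Complex \<delta> t)))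
     \<le> mean (\<lambda>t. ((1 / (2 * \<tau>)) * (norm (K (Complex 0 t) - K (Complex \<delta> t)))\<^sup>2 + (\<tau> / 2) * (norm (G (Complex 0 t)))\<^sup>2)
         + ((1 / (2 * \<tau>)) * (norm (G (Complex 0 t) - G (Complex \<delta> t)))\<^sup>2 + (\<tau> / 2) * (norm (K (Complex \<delta> t)))\<^sup>2))"
  proof (intro mean_mono rn ap_diff analytic_poly_ap F real_ap_add real_ap_cmult r)
    fix t
    have "F (Complex 0 t) - F (Complex \<delta> t) = (K (Complex 0 t) - K (Complex \<delta> t)) * G (Complex 0 t)
         + (G (Complex 0 t) - G (Complex \<delta> t)) * K (Complex \<delta> t)"
      unfolding FKG by (simp add: algebra_simps)
    also have "norm \<dots> \<le> norm (K (Complex 0 t) - K (Complex \<delta> t)) * norm (G (Complex 0 t))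
         + norm (G (Complex 0 t) - G (Complex \<delta> t)) * norm (K (Complex \<delta> t))"
      by (metis norm_mult norm_triangle_ineq)
    also have "\<dots> \<le> ((1 / (2 * \<tau>)) * (norm (K (Complex 0 t) - K (Complex \<delta> t)))\<^sup>2 + (\<tau> / 2) * (norm (G (Complex 0 t)))\<^sup>2)
         + ((1 / (2 * \<tau>)) * (norm (G (Complex 0 t) - G (Complex \<delta> t)))\<^sup>2 + (\<tau> / 2) * (norm (K (Complex \<delta> t)))\<^sup>2)"
      by (intro add_mono young)
    finally show "norm (F (Complex 0 t) - F (Complex \<delta> t)) \<le> \<dots>" .
  qed
  also have "\<dots> = ((1 / (2 * \<tau>)) * mean (\<lambda>t. (norm (K (Complex 0 t) - K (Complex \<delta> t)))\<^sup>2) + (\<tau> / 2) * ?M G 0)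
         + ((1 / (2 * \<tau>)) * mean (\<lambda>t. (norm (G (Complex 0 t) - G (Complex \<delta> t)))\<^sup>2) + (\<tau> / 2) * ?M K \<delta>)"
    by (simp only: mean_add mean_cmult real_ap_add real_ap_cmult r)
  also have "\<dots> \<le> ((1 / (2 * \<tau>)) * (4 * \<eta>) + (\<tau> / 2) * (B + 1)) + ((1 / (2 * \<tau>)) * (4 * \<eta>) + (\<tau> / 2) * (B + 1))"
    using dK dG KX GX cK B eta tau by (intro add_mono mult_left_mono) auto
  also have "\<dots> = (B + 5) * \<tau>"
    using tau by (simp add: field_simps flip: tau(2))
  finally show ?thesis unfolding \<tau>_def .
qed

subsection \<open>Convexity and the mean \<open>L\<^sup>p\<close> norm\<close>

lemma powr_convex_nonneg:
  fixes x y p \<theta> :: real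
  assumes "1 \<le> p" "0 \<le> x" "0 \<le> y" "0 \<le> \<theta>" "\<theta> \<le> 1"
  shows "(\<theta> * x + (1 - \<theta>) * y) powr p \<le> \<theta> * x powr p + (1 - \<theta>) * y powr p"
proof -
  have le: "\<theta> powr p \<le> \<theta>" if "0 \<le> \<theta>" "\<theta> \<le> 1" for \<theta> :: real
    using powr_mono'[of 1 p \<theta>] that assms(1) by simp
  consider "x = 0" | "y = 0" | "x > 0" "y > 0" using assms by linarith
  then show ?thesis
  proof cases
    case 1
    then show ?thesis using le[of "1 - \<theta>"] assms by (simp add: powr_mult mult_right_mono)
  next
    case 2
    then show ?thesis using le[of \<theta>] assms by (simp add: powr_mult mult_right_mono)
  next
    case 3
    then show ?thesis using convex_onD[OF powr_convex[OF assms(1)], of "1 - \<theta>" x y] assms by simp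
  qed
qed

text \<open>Strict convexity through the mean value theorem on the two halves: the derivative at
  \<open>\<zeta>\<close> exceeds the one at \<open>\<xi>\<close>. Differentiability is required only
  inside the intervals, so \<open>x = 0\<close> is included.\<close>

lemma powr_midpoint_less:
  fixes x y p :: real
  assumes p: "1 < p" and xy: "0 \<le> x" "x < y"
  shows "((x + y) / 2) powr p < (x powr p + y powr p) / 2"
proof -
  define m where "m = (x + y) / 2"
  have m: "x < m" "m < y" "m - x = y - m" "m > 0" using xy by (auto simp: m_def field_simps)
  have c: "continuous_on {a..b} (\<lambda>t. t powr p)" if "0 \<le> a" for a b
    by (rule continuous_on_powr') (use that p in \<open>auto intro: continuous_intros\<close>)
  have d: "((\<lambda>t. t powr p) has_derivative (*) (p * t powr (p - 1))) (at t)" if "t > 0" for t :: real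
    using has_real_derivative_powr[OF that, of p] by (simp add: has_field_derivative_def)
  have mv: "\<exists>\<xi>\<in>{a<..<b}. b powr p - a powr p = p * \<xi> powr (p - 1) * (b - a)" if ab: "0 \<le> a" "a < b" for a b :: real
  proof -
    obtain \<xi> where "a < \<xi>" "\<xi> < b" "b powr p - a powr p = p * \<xi> powr (p - 1) * (b - a)"
    proof (rule mvt[OF ab(2) c[OF ab(1)]])
      show "((\<lambda>t. t powr p) has_derivative (*) (p * t powr (p - 1))) (at t)" if "a < t" "t < b" for t
        using d[of t] that ab(1) by linarith
    qed
    then show ?thesis by auto
  qed
  obtain \<xi> where xi: "\<xi> \<in> {x<..<m}" "m powr p - x powr p = p * \<xi> powr (p - 1) * (m - x)"
    using mv[OF xy(1) m(1)] by blast
  obtain \<zeta> where ze: "\<zeta> \<in> {m<..<y}" "y powr p - m powr p = p * \<zeta> powr (p - 1) * (y - m)"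
    using mv[OF less_imp_le[OF m(4)] m(2)] by blast
  have "\<xi> powr (p - 1) < \<zeta> powr (p - 1)" using xi ze xy p by (intro powr_less_mono2) auto
  then have "p * \<xi> powr (p - 1) * (m - x) < p * \<zeta> powr (p - 1) * (y - m)"
    unfolding m(3) using p m by (intro mult_strict_right_mono mult_strict_left_mono) auto
  then show ?thesis unfolding xi(2)[symmetric] ze(2)[symmetric] m_def[symmetric] by simp
qed

text \<open>Strictness has two sources: for equal moduli the strict triangle inequality, for
  different moduli the strict convexity of the power.\<close>

lemma norm_powr_midpoint_less:
  fixes a b :: complex
  assumes p: "1 < p" and ab: "a \<noteq> b"
  shows "norm ((a + b) / 2) powr p < (norm a powr p + norm b powr p) / 2"
proof (cases "norm a = norm b")
  case True
  then have pos: "norm a > 0" using ab by auto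
  have "norm (a + b) \<noteq> norm a + norm b"
    using norm_triangle_eq[of a b] True pos ab by auto
  then have "norm ((a + b) / 2) < norm a"
    using norm_triangle_ineq[of a b] True by (simp add: norm_divide)
  then show ?thesis using p True by (auto intro!: powr_less_mono2)
next
  case False
  have "norm ((a + b) / 2) \<le> (norm a + norm b) / 2"
    using norm_triangle_ineq[of a b] by (simp add: norm_divide)
  then have "norm ((a + b) / 2) powr p \<le> ((norm a + norm b) / 2) powr p"
    using p by (intro powr_mono2) auto
  also have "\<dots> < (norm a powr p + norm b powr p) / 2"
  proof (cases "norm a < norm b")
    case True
    then show ?thesis using powr_midpoint_less[OF p] by simp
  next
    case False
    then show ?thesis using powr_midpoint_less[OF p, of "norm b" "norm a"] \<open>norm a \<noteq> norm b\<close>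
      by (simp add: add.commute)
  qed
  finally show ?thesis .
qed

text \<open>A pointwise form of uniform convexity, linear in the powers so that it can be averaged
  over \<open>t\<close>. In place of Clarkson's inequalities it uses that all terms are homogeneous
  of degree \<open>p\<close>: strictness and compactness of a normalized set then suffice, for all
  \<open>p > 1\<close> alike.\<close>

lemma uniform_convexity:
  fixes p \<eta> :: real
  assumes p: "1 < p" and eta: "\<eta> > 0"
  obtains C where "C \<ge> 0" "\<And>a b :: complex. norm (a - b) powr p \<le> \<eta> * (norm a powr p + norm b powr p)
     + C * ((norm a powr p + norm b powr p) / 2 - norm ((a + b) / 2) powr p)"
proof -
  define s where "s z = norm (fst z) powr p + norm (snd z) powr p" for z :: "complex \<times> complex"
  define D where "D z = s z / 2 - norm ((fst z + snd z) / 2) powr p" for z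
  define E where "E z = norm (fst z - snd z) powr p" for z :: "complex \<times> complex"
  have D0: "D z \<ge> 0" for z
    using norm_powr_midpoint_less[OF p, of "fst z" "snd z"] unfolding D_def s_def
    by (cases "fst z = snd z") auto
  have cpow: "continuous_on UNIV (\<lambda>z. norm (f z) powr p)" if "continuous_on UNIV f" for f :: "complex \<times> complex \<Rightarrow> complex"
    by (rule continuous_on_powr') (use that p in \<open>auto intro: continuous_intros\<close>)
  have cs: "continuous_on UNIV s" and cD: "continuous_on UNIV D" and cE: "continuous_on UNIV E"
    unfolding D_def E_def s_def by (intro continuous_intros cpow; simp)+
  \<comment> \<open>Among pairs with \<open>s z = 1\<close>, those outside \<open>S\<close> are
    covered by the term \<open>\<eta> * s z\<close> alone; on the compact set \<open>S\<close> the
    convexity gap \<open>D\<close> has a positive minimum if \<open>S\<close> is nonempty, and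
    \<open>C * D z\<close> takes over.\<close>
  define S where "S = {z. s z = 1 \<and> \<eta> \<le> E z}"
  have "closed S" unfolding S_def
    using cs cE by (intro closed_Collect_conj closed_Collect_eq closed_Collect_le) auto
  moreover have "bounded S"
  proof (rule boundedI)
    fix z assume "z \<in> S"
    then have 1: "norm (fst z) powr p + norm (snd z) powr p = 1" by (simp add: S_def s_def)
    have "norm (fst z) \<le> 1"
    proof (rule ccontr)
      assume "\<not> norm (fst z) \<le> 1"
      then have "norm (fst z) powr p > 1 powr p" using p by (intro powr_less_mono2) auto
      then show False using 1 powr_ge_zero[of "norm (snd z)" p] by simp
    qed
    moreover have "norm (snd z) \<le> 1"
    proof (rule ccontr)
      assume "\<not> norm (snd z) \<le> 1"
      then have "norm (snd z) powr p > 1 powr p" using p by (intro powr_less_mono2) auto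
      then show False using 1 powr_ge_zero[of "norm (fst z)" p] by simp
    qed
    ultimately show "norm z \<le> 2" using norm_Pair_le[of "fst z" "snd z"] by simp
  qed
  ultimately have cS: "compact S" by (simp add: compact_eq_bounded_closed)
  have DS: "D z > 0" if "z \<in> S" for z
  proof -
    have "fst z \<noteq> snd z" using that eta p unfolding S_def E_def by auto
    then show ?thesis using norm_powr_midpoint_less[OF p] unfolding D_def s_def by simp
  qed
  have ES: "E z \<le> 2 powr p * s z" for z
  proof -
    define x where "x = max (norm (fst z)) (norm (snd z))"
    have "norm (fst z - snd z) \<le> 2 * x" using norm_triangle_ineq4[of "fst z" "snd z"] by (simp add: x_def)
    then have "E z \<le> (2 * x) powr p" unfolding E_def using p by (intro powr_mono2) auto
    also have "\<dots> = 2 powr p * x powr p" by (simp add: powr_mult x_def)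
    also have "x powr p \<le> s z" unfolding x_def s_def by (auto simp: max_def)
    finally show ?thesis by simp
  qed
  obtain C where C: "C \<ge> 0" "\<And>z. z \<in> S \<Longrightarrow> E z \<le> C * D z"
  proof (cases "S = {}")
    case True
    then show ?thesis using that[of 0] by auto
  next
    case False
    obtain z0 where z0: "z0 \<in> S" "\<And>z. z \<in> S \<Longrightarrow> D z0 \<le> D z"
      using continuous_attains_inf[OF cS False continuous_on_subset[OF cD]] by blast
    have "E z \<le> 2 powr p / D z0 * D z" if "z \<in> S" for z
    proof -
      have "E z \<le> 2 powr p" using ES[of z] that by (simp add: S_def)
      also have "\<dots> \<le> 2 powr p * (D z / D z0)"
        using DS[OF z0(1)] z0(2)[OF that] mult_left_mono[of 1 "D z / D z0" "2 powr p"] by simp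
      finally show ?thesis by simp
    qed
    then show ?thesis using that[of "2 powr p / D z0"] DS[OF z0(1)] by auto
  qed
  have "E z \<le> \<eta> * s z + C * D z" for z
  proof (cases "s z = 0")
    case True
    then show ?thesis using ES[of z] mult_nonneg_nonneg[OF C(1) D0[of z]] by simp
  next
    case False
    then have s: "s z > 0" unfolding s_def by (metis add_nonneg_nonneg less_eq_real_def powr_ge_zero)
    \<comment> \<open>The scaling that brings \<open>z\<close> to \<open>s = 1\<close>.\<close>
    define k where "k = s z powr (- 1 / p)"
    have "k powr p = s z powr (- 1)" unfolding k_def powr_powr using p by simp
    then have k: "k > 0" "k powr p = 1 / s z" using s by (simp_all add: k_def powr_minus_divide)
    have sc: "norm (k *\<^sub>R w) powr p = norm w powr p / s z" for w :: complex
      using k by (simp add: powr_mult)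
    have 1: "s (k *\<^sub>R z) = 1" using s unfolding s_def[of "k *\<^sub>R z"] fst_scaleR snd_scaleR sc
      by (simp add: s_def add_divide_distrib[symmetric])
    have 2: "E (k *\<^sub>R z) = E z / s z" unfolding E_def fst_scaleR snd_scaleR scaleR_diff_right[symmetric] sc ..
    have 3: "D (k *\<^sub>R z) = D z / s z"
    proof -
      have "(k *\<^sub>R fst z + k *\<^sub>R snd z) / 2 = k *\<^sub>R ((fst z + snd z) / 2)" by (simp add: scaleR_conv_of_real algebra_simps)
      then have "norm ((k *\<^sub>R fst z + k *\<^sub>R snd z) / 2) powr p = norm ((fst z + snd z) / 2) powr p / s z"
        by (simp only: sc)
      then show ?thesis unfolding D_def 1 fst_scaleR snd_scaleR using s by (simp add: diff_divide_distrib)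
    qed
    have "E (k *\<^sub>R z) \<le> \<eta> + C * D (k *\<^sub>R z)"
    proof (cases "k *\<^sub>R z \<in> S")
      case True
      then show ?thesis using C(2)[OF True] eta by linarith
    next
      case False
      then have "E (k *\<^sub>R z) < \<eta>" using 1 by (auto simp: S_def)
      then show ?thesis using C(1) D0[of "k *\<^sub>R z"] by (smt (verit) mult_nonneg_nonneg)
    qed
    then show ?thesis unfolding 2 3 using s by (simp add: field_simps)
  qed
  from this[of "(a, b)" for a b] show ?thesis
    by (intro that[OF C(1)]) (simp add: E_def s_def D_def)
qed

section \<open>The mean \<open>L\<^sup>p\<close> norm of almost periodic functions\<close>

definition Lp :: "real \<Rightarrow> (real \<Rightarrow> complex) \<Rightarrow> real" where
  "Lp p f = mean (\<lambda>t. norm (f t) powr p) powr (1 / p)"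

lemma Lp_nonneg: "0 \<le> Lp p f"
  by (simp add: Lp_def)

lemma Lp_powr: 
  assumes "ap f" "p > 0" shows "Lp p f powr p = mean (\<lambda>t. norm (f t) powr p)"
  using assms mean_nonneg[OF real_ap_norm_powr[OF assms]] by (simp add: Lp_def powr_powr)

lemma Lp_mono:
  assumes "ap f" "p > 0" "mean (\<lambda>t. norm (f t) powr p) \<le> mean (\<lambda>t. norm (g t) powr p)"
  shows "Lp p f \<le> Lp p g"
  unfolding Lp_def using assms mean_nonneg[OF real_ap_norm_powr[OF assms(1,2)]] by (intro powr_mono2) auto

lemma ap_add:
  assumes "ap f" "ap g" shows "ap (\<lambda>t. f t + g t)"
proof -
  have "ap (\<lambda>t. 0 - g t)" by (intro ap_diff ap_trig_poly trig_poly_const assms)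
  from ap_diff[OF assms(1) this] show ?thesis by simp
qed

lemma mean_powr_le:
  assumes "ap f" "p > 0" "Lp p f \<le> c"
  shows "mean (\<lambda>t. norm (f t) powr p) \<le> c powr p"
  using powr_mono2[OF _ Lp_nonneg assms(3), of p] assms(2) by (simp add: Lp_powr[OF assms(1,2)])

lemma Lp_leI:
  assumes "ap f" "p > 0" "c \<ge> 0" "mean (\<lambda>t. norm (f t) powr p) \<le> c powr p"
  shows "Lp p f \<le> c"
proof -
  have "Lp p f \<le> (c powr p) powr (1 / p)"
    unfolding Lp_def using assms mean_nonneg[OF real_ap_norm_powr[OF assms(1,2)]] by (intro powr_mono2) auto
  then show ?thesis using assms by (simp add: powr_powr)
qed

text \<open>Minkowski's inequality directly from convexity of the power, with weights proportional
  to the (slightly enlarged) norms.\<close>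

lemma Lp_triangle:
  assumes f: "ap f" and g: "ap g" and p: "1 \<le> p"
  shows "Lp p (\<lambda>t. f t + g t) \<le> Lp p f + Lp p g"
proof (rule field_le_epsilon)
  fix e :: real assume e: "e > 0"
  \<comment> \<open>The norms are enlarged by \<open>e / 2\<close> so that one may divide by
    them.\<close>
  define \<alpha> \<beta> where "\<alpha> = Lp p f + e / 2" and "\<beta> = Lp p g + e / 2"
  have ab: "\<alpha> > 0" "\<beta> > 0" using e Lp_nonneg[of p f] Lp_nonneg[of p g] by (auto simp: \<alpha>_def \<beta>_def)
  define \<theta> where "\<theta> = \<alpha> / (\<alpha> + \<beta>)"
  have th: "0 \<le> \<theta>" "\<theta> \<le> 1" "1 - \<theta> = \<beta> / (\<alpha> + \<beta>)" using ab by (auto simp: \<theta>_def field_simps)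
  have p0: "p > 0" using p by simp
  let ?P = "(\<alpha> + \<beta>) powr p"
  have pw: "norm (f t + g t) powr p \<le> (?P * \<theta> / \<alpha> powr p) * norm (f t) powr p + (?P * (1 - \<theta>) / \<beta> powr p) * norm (g t) powr p" for t
  proof -
    have "(\<alpha> + \<beta>) * (\<theta> * (norm (f t) / \<alpha>) + (1 - \<theta>) * (norm (g t) / \<beta>)) = norm (f t) + norm (g t)"
    proof -
      have "(\<alpha> + \<beta>) * \<theta> = \<alpha>" "(\<alpha> + \<beta>) * (1 - \<theta>) = \<beta>" unfolding th(3) unfolding \<theta>_def using ab by auto
      then show ?thesis using ab unfolding distrib_left mult.assoc[symmetric] by simp
    qed
    then have "norm (f t + g t) \<le> (\<alpha> + \<beta>) * (\<theta> * (norm (f t) / \<alpha>) + (1 - \<theta>) * (norm (g t) / \<beta>))"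
      using norm_triangle_ineq by simp
    then have "norm (f t + g t) powr p \<le> ((\<alpha> + \<beta>) * (\<theta> * (norm (f t) / \<alpha>) + (1 - \<theta>) * (norm (g t) / \<beta>))) powr p"
      using p by (intro powr_mono2) auto
    also have "\<dots> = ?P * (\<theta> * (norm (f t) / \<alpha>) + (1 - \<theta>) * (norm (g t) / \<beta>)) powr p"
      using ab th by (intro powr_mult)
    also have "\<dots> \<le> ?P * (\<theta> * (norm (f t) / \<alpha>) powr p + (1 - \<theta>) * (norm (g t) / \<beta>) powr p)"
      using p ab th by (intro mult_left_mono powr_convex_nonneg) auto
    also have "\<dots> = (?P * \<theta> / \<alpha> powr p) * norm (f t) powr p + (?P * (1 - \<theta>) / \<beta> powr p) * norm (g t) powr p"
      using ab by (simp add: powr_divide algebra_simps)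
    finally show ?thesis .
  qed
  have "mean (\<lambda>t. norm (f t + g t) powr p)
     \<le> mean (\<lambda>t. (?P * \<theta> / \<alpha> powr p) * norm (f t) powr p + (?P * (1 - \<theta>) / \<beta> powr p) * norm (g t) powr p)"
    by (intro mean_mono real_ap_add real_ap_cmult real_ap_norm_powr ap_add f g p0 pw)
  also have "\<dots> = (?P * \<theta> / \<alpha> powr p) * mean (\<lambda>t. norm (f t) powr p) + (?P * (1 - \<theta>) / \<beta> powr p) * mean (\<lambda>t. norm (g t) powr p)"
    by (simp only: mean_add mean_cmult real_ap_cmult real_ap_norm_powr f g p0)
  also have "\<dots> \<le> (?P * \<theta> / \<alpha> powr p) * \<alpha> powr p + (?P * (1 - \<theta>) / \<beta> powr p) * \<beta> powr p"
    using ab th e by (intro add_mono mult_left_mono mean_powr_le f g p0) (auto simp: \<alpha>_def \<beta>_def)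
  also have "\<dots> = ?P * \<theta> + ?P * (1 - \<theta>)" using ab by simp
  also have "\<dots> = ?P" by (simp add: algebra_simps)
  finally have "Lp p (\<lambda>t. f t + g t) \<le> \<alpha> + \<beta>"
    using ab by (intro Lp_leI ap_add f g p0) auto
  then show "Lp p (\<lambda>t. f t + g t) \<le> Lp p f + Lp p g + e" by (simp add: \<alpha>_def \<beta>_def)
qed

text \<open>Splitting at height \<open>c\<close> gives
  \<open>norm (f t) \<le> c + c powr (1 - p) * norm (f t) powr p\<close>. The constant 2 is crude
  but enough to bound coefficients.\<close>

lemma mean_norm_le_Lp:
  assumes f: "ap f" and p: "1 \<le> p"
  shows "mean (\<lambda>t. norm (f t)) \<le> 2 * Lp p f"
proof (rule field_le_epsilon)
  fix e :: real assume e: "e > 0"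
  have p0: "p > 0" using p by simp
  define c where "c = Lp p f + e / 2"
  have c: "c > 0" "Lp p f \<le> c" using e Lp_nonneg[of p f] by (auto simp: c_def)
  have pw: "norm (f t) \<le> (c / c powr p) * norm (f t) powr p + c" for t
  proof (cases "norm (f t) \<le> c")
    case True
    then show ?thesis using c by (simp add: add_increasing)
  next
    case False
    then have "norm (f t) / c \<le> (norm (f t) / c) powr p"
      using powr_mono[of 1 p "norm (f t) / c"] p c by simp
    then have "c * (norm (f t) / c) \<le> c * (norm (f t) / c) powr p" using c by (intro mult_left_mono) auto
    then show ?thesis using c by (simp add: powr_divide)
  qed
  have rn: "real_ap (\<lambda>t. norm (f t))" using real_ap_norm_powr[OF f, of 1] by simp
  have "mean (\<lambda>t. norm (f t)) \<le> mean (\<lambda>t. (c / c powr p) * norm (f t) powr p) + c"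
    by (intro mean_le_add rn real_ap_cmult real_ap_norm_powr f p0 pw)
  also have "\<dots> = (c / c powr p) * mean (\<lambda>t. norm (f t) powr p) + c"
    by (simp only: mean_cmult real_ap_norm_powr f p0)
  also have "\<dots> \<le> (c / c powr p) * c powr p + c"
    using c by (intro add_mono mult_left_mono mean_powr_le f p0) auto
  also have "\<dots> = 2 * Lp p f + e" using c by (simp add: c_def)
  finally show "mean (\<lambda>t. norm (f t)) \<le> 2 * Lp p f + e" .
qed

subsection \<open>The norm of Dirichlet polynomials\<close>

lemma dpoly_eval_superset:
  assumes "finite S" "{n. a n \<noteq> 0} \<subseteq> S"
  shows "dpoly_eval a s = (\<Sum>n\<in>S. a n * of_nat n powr (- s))"
  unfolding dpoly_eval_def by (rule sum.mono_neutral_left) (use assms in auto)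

lemma dirichlet_polyI: "finite S \<Longrightarrow> {n. a n \<noteq> 0} \<subseteq> S \<Longrightarrow> a 0 = 0 \<Longrightarrow> dirichlet_poly a"
  using finite_subset unfolding dirichlet_poly_def by blast

lemma dirichlet_poly_finite: "dirichlet_poly a \<Longrightarrow> finite {n. a n \<noteq> 0}"
  by (simp add: dirichlet_poly_def)

lemma dirichlet_poly_0: "dirichlet_poly a \<Longrightarrow> a 0 = 0"
  by (simp add: dirichlet_poly_def)

lemma dirichlet_poly_add:
  assumes "dirichlet_poly a" "dirichlet_poly b" shows "dirichlet_poly (\<lambda>n. a n + b n)"
  by (rule dirichlet_polyI[of "{n. a n \<noteq> 0} \<union> {n. b n \<noteq> 0}"])
     (use assms in \<open>auto simp: dirichlet_poly_finite dirichlet_poly_0\<close>)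

lemma dirichlet_poly_diff:
  assumes "dirichlet_poly a" "dirichlet_poly b" shows "dirichlet_poly (\<lambda>n. a n - b n)"
  by (rule dirichlet_polyI[of "{n. a n \<noteq> 0} \<union> {n. b n \<noteq> 0}"])
     (use assms in \<open>auto simp: dirichlet_poly_finite dirichlet_poly_0\<close>)

lemma dirichlet_poly_cut:
  assumes "dirichlet_poly a" shows "dirichlet_poly (\<lambda>n. if Q n then a n else 0)"
  by (rule dirichlet_polyI[of "{n. a n \<noteq> 0}"])
     (use assms in \<open>auto simp: dirichlet_poly_finite dirichlet_poly_0\<close>)

lemma dirichlet_poly_shift:
  assumes "dirichlet_poly a" shows "dirichlet_poly (dirichlet_shift \<epsilon> a)"
  by (rule dirichlet_polyI[of "{n. a n \<noteq> 0}"])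
     (use assms in \<open>auto simp: dirichlet_poly_finite dirichlet_poly_0 dirichlet_shift_def\<close>)

lemma dpoly_eval_add:
  assumes "dirichlet_poly a" "dirichlet_poly b"
  shows "dpoly_eval (\<lambda>n. a n + b n) s = dpoly_eval a s + dpoly_eval b s"
proof -
  let ?S = "{n. a n \<noteq> 0} \<union> {n. b n \<noteq> 0}"
  have S: "finite ?S" using assms by (auto simp: dirichlet_poly_def)
  have sub: "{n. a n \<noteq> 0} \<subseteq> ?S" "{n. b n \<noteq> 0} \<subseteq> ?S" "{n. a n + b n \<noteq> 0} \<subseteq> ?S" by auto
  note ev = dpoly_eval_superset[OF S sub(1)] dpoly_eval_superset[OF S sub(2)] dpoly_eval_superset[OF S sub(3)]
  show ?thesis unfolding ev by (simp add: sum.distrib distrib_right)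
qed

lemma dpoly_eval_diff:
  assumes "dirichlet_poly a" "dirichlet_poly b"
  shows "dpoly_eval (\<lambda>n. a n - b n) s = dpoly_eval a s - dpoly_eval b s"
  using dpoly_eval_add[OF dirichlet_poly_diff[OF assms] assms(2), of s] by simp

lemma of_nat_powr_exp:
  "n \<noteq> 0 \<Longrightarrow> (of_nat n :: complex) powr (- s) = exp (- of_real (ln (real n)) * s)"
  by (simp add: powr_def Ln_of_nat mult.commute)

lemma analytic_poly_dpoly_eval: "dirichlet_poly a \<Longrightarrow> analytic_poly (dpoly_eval a)"
proof -
  assume a: "dirichlet_poly a"
  have "analytic_poly (\<lambda>s. \<Sum>n | a n \<noteq> 0. a n * exp (- of_real (ln (real n)) * s))"
  proof (intro analytic_poly_sum analytic_poly.monom)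
    show "finite {n. a n \<noteq> 0}" using a by (simp add: dirichlet_poly_def)
    fix n assume "n \<in> {n. a n \<noteq> 0}"
    then have "n \<noteq> 0" using a by (auto simp: dirichlet_poly_def intro!: gr0I)
    then show "0 \<le> ln (real n)" by (intro ln_ge_zero) auto
  qed
  moreover have "dpoly_eval a = (\<lambda>s. \<Sum>n | a n \<noteq> 0. a n * exp (- of_real (ln (real n)) * s))"
    unfolding dpoly_eval_def
  proof (intro ext sum.cong refl)
    fix s n assume "n \<in> {n. a n \<noteq> 0}"
    then have n0: "n \<noteq> 0" using a by (metis dirichlet_poly_def mem_Collect_eq)
    show "a n * of_nat n powr (- s) = a n * exp (- of_real (ln (real n)) * s)"
      unfolding of_nat_powr_exp[OF n0] ..
  qed
  ultimately show ?thesis by simp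
qed

lemma ap_dpoly: "dirichlet_poly a \<Longrightarrow> ap (\<lambda>t. dpoly_eval a (Complex \<sigma> t))"
  by (intro analytic_poly_ap analytic_poly_dpoly_eval)

text \<open>The place where the limit defining \<open>dpoly_norm\<close> is shown to exist, which
  opens it to the results on \<open>Lp\<close>.\<close>

lemma dpoly_norm_Lp:
  assumes a: "dirichlet_poly a" and p: "p > 0"
  shows "dpoly_norm p a = Lp p (\<lambda>t. dpoly_eval a (Complex 0 t))"
proof -
  let ?u = "\<lambda>t. norm (dpoly_eval a (Complex 0 t)) powr p"
  have r: "real_ap ?u" by (intro real_ap_norm_powr ap_dpoly a p)
  have eq: "\<i> * of_real t = Complex 0 t" for t by (simp add: complex_eq_iff)
  have "((\<lambda>R. (1 / (2 * R) * integral {-R..R} ?u) powr (1 / p)) \<longlongrightarrow> mean ?u powr (1 / p)) at_top"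
  proof (rule tendsto_powr2[OF real_ap_has_mean[OF r, unfolded has_mean_def] tendsto_const])
    show "\<forall>\<^sub>F R in at_top. 0 \<le> 1 / (2 * R) * integral {- R..R} ?u"
      using eventually_gt_at_top[of 0]
    proof eventually_elim
      case (elim R)
      have "?u integrable_on {-R..R}" by (intro integrable_continuous_interval real_ap_continuous r)
      then have "0 \<le> integral {-R..R} ?u" by (rule integral_nonneg) auto
      then show ?case using elim by simp
    qed
  qed (use p in auto)
  then show ?thesis unfolding dpoly_norm_def Lp_def eq by (intro tendsto_Lim) auto
qed

lemma dpoly_norm_nonneg: 
  assumes "dirichlet_poly a" "1 \<le> p" shows "0 \<le> dpoly_norm p a"
  using assms by (simp add: dpoly_norm_Lp Lp_nonneg)

lemma dpoly_norm_add:
  assumes a: "dirichlet_poly a" and b: "dirichlet_poly b" and p: "1 \<le> p"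
  shows "dpoly_norm p (\<lambda>n. a n + b n) \<le> dpoly_norm p a + dpoly_norm p b"
  using Lp_triangle[OF ap_dpoly[OF a] ap_dpoly[OF b] p, of 0 0] p
  by (simp add: dpoly_norm_Lp a b dirichlet_poly_add dpoly_eval_add)

lemma dpoly_norm_minus_commute:
  assumes a: "dirichlet_poly a" and b: "dirichlet_poly b" and p: "1 \<le> p"
  shows "dpoly_norm p (\<lambda>n. a n - b n) = dpoly_norm p (\<lambda>n. b n - a n)"
  using p by (simp add: dpoly_norm_Lp a b dirichlet_poly_diff dpoly_eval_diff Lp_def norm_minus_commute)

lemma dpoly_norm_zero: "1 \<le> p \<Longrightarrow> dpoly_norm p (\<lambda>n. 0) = 0"
  using dpoly_norm_Lp[of "\<lambda>n. 0" p] by (simp add: dirichlet_poly_def Lp_def dpoly_eval_def mean_const)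

lemma dpoly_norm_diff:
  assumes a: "dirichlet_poly a" and b: "dirichlet_poly b" and p: "1 \<le> p"
  shows "dpoly_norm p (\<lambda>n. a n - b n) \<le> dpoly_norm p a + dpoly_norm p b"
proof -
  have 0: "dirichlet_poly (\<lambda>n. 0)" by (simp add: dirichlet_poly_def)
  have "dpoly_norm p (\<lambda>n. 0 - b n) = dpoly_norm p b"
    using dpoly_norm_minus_commute[OF 0 b p] by simp
  with dpoly_norm_add[OF a dirichlet_poly_diff[OF 0 b] p] show ?thesis by simp
qed

lemma dpoly_norm_diff_triangle:
  assumes a: "dirichlet_poly a" and b: "dirichlet_poly b" and c: "dirichlet_poly c" and p: "1 \<le> p"
  shows "dpoly_norm p (\<lambda>n. a n - c n) \<le> dpoly_norm p (\<lambda>n. a n - b n) + dpoly_norm p (\<lambda>n. b n - c n)"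
  using dpoly_norm_add[OF dirichlet_poly_diff[OF a b] dirichlet_poly_diff[OF b c] p] by simp

lemma dpoly_norm_le_add:
  assumes a: "dirichlet_poly a" and b: "dirichlet_poly b" and p: "1 \<le> p"
  shows "dpoly_norm p a \<le> dpoly_norm p b + dpoly_norm p (\<lambda>n. a n - b n)"
  using dpoly_norm_add[OF b dirichlet_poly_diff[OF a b] p] by simp

lemma dpoly_eval_shift:
  assumes "dirichlet_poly a"
  shows "dpoly_eval (dirichlet_shift \<epsilon> a) (Complex \<sigma> t) = dpoly_eval a (Complex (\<sigma> + \<epsilon>) t)"
proof -
  have 0: "n \<noteq> 0" if "a n \<noteq> 0" for n using assms that by (metis dirichlet_poly_def)
  have "dirichlet_shift \<epsilon> a n * of_nat n powr (- Complex \<sigma> t) = a n * of_nat n powr (- Complex (\<sigma> + \<epsilon>) t)"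
    if "a n \<noteq> 0" for n
  proof -
    have e: "exp (- of_real (ln (real n)) * Complex \<sigma> t) = of_real (exp (- (ln (real n) * \<sigma>))) * cis (- ln (real n) * t)" for \<sigma>
      by (rule exp_on_line)
    have r: "exp (- (ln (real n) * (\<sigma> + \<epsilon>))) = exp (- (ln (real n) * \<sigma>)) / real n powr \<epsilon>"
      using 0[OF that] by (simp add: powr_def exp_diff[symmetric] algebra_simps)
    show ?thesis
      unfolding of_nat_powr_exp[OF 0[OF that]] e r dirichlet_shift_def by simp
  qed
  moreover have "{n. dirichlet_shift \<epsilon> a n \<noteq> 0} \<subseteq> {n. a n \<noteq> 0}" by (auto simp: dirichlet_shift_def)
  ultimately show ?thesis
    using assms dpoly_eval_superset[of "{n. a n \<noteq> 0}" "dirichlet_shift \<epsilon> a"]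
    unfolding dirichlet_poly_def by (auto simp: dpoly_eval_def intro!: sum.cong)
qed

lemma dirichlet_shift_add: "dirichlet_shift \<epsilon> (\<lambda>n. a n + b n) = (\<lambda>n. dirichlet_shift \<epsilon> a n + dirichlet_shift \<epsilon> b n)"
  by (auto simp: dirichlet_shift_def add_divide_distrib)

lemma dirichlet_shift_diff: "dirichlet_shift \<epsilon> (\<lambda>n. a n - b n) = (\<lambda>n. dirichlet_shift \<epsilon> a n - dirichlet_shift \<epsilon> b n)"
  by (auto simp: dirichlet_shift_def diff_divide_distrib)

lemma dirichlet_shift_shift: "dirichlet_shift \<epsilon> (dirichlet_shift \<delta> a) = dirichlet_shift (\<epsilon> + \<delta>) a"
  by (auto simp: dirichlet_shift_def powr_add mult.commute)

lemma dpoly_norm_shift_le: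
  assumes a: "dirichlet_poly a" and p: "1 \<le> p" and e: "\<epsilon> \<ge> 0"
  shows "dpoly_norm p (dirichlet_shift \<epsilon> a) \<le> dpoly_norm p a"
  using p contraction[OF analytic_poly_dpoly_eval[OF a] _ e, of p] 
  by (simp add: dpoly_norm_Lp a dirichlet_poly_shift dpoly_eval_shift Lp_mono ap_dpoly)

text \<open>After multiplication by \<open>M\<^sup>s\<close> the frequencies are still nonnegative.\<close>

lemma dpoly_norm_shift_tail:
  assumes a: "dirichlet_poly a" and p: "1 \<le> p" and e: "\<epsilon> \<ge> 0" and M: "M > 0" "\<And>n. n < M \<Longrightarrow> a n = 0"
  shows "dpoly_norm p (dirichlet_shift \<epsilon> a) \<le> real M powr (- \<epsilon>) * dpoly_norm p a"
proof -
  define F where "F s = (\<Sum>n | a n \<noteq> 0. a n * exp (- of_real (ln (real n) - ln (real M)) * s))" for s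
  have F: "analytic_poly F"
    unfolding F_def
  proof (intro analytic_poly_sum analytic_poly.monom)
    show "finite {n. a n \<noteq> 0}" using a by (simp add: dirichlet_poly_def)
    fix n assume "n \<in> {n. a n \<noteq> 0}"
    then have "n \<ge> M" using M(2) by (metis mem_Collect_eq not_le)
    then show "0 \<le> ln (real n) - ln (real M)" using M by simp
  qed
  have FD: "F s = exp (of_real (ln (real M)) * s) * dpoly_eval a s" for s
    unfolding F_def dpoly_eval_def sum_distrib_left
  proof (intro sum.cong refl)
    fix n assume "n \<in> {n. a n \<noteq> 0}"
    then have n0: "n \<noteq> 0" using a by (metis dirichlet_poly_def mem_Collect_eq)
    show "a n * exp (- of_real (ln (real n) - ln (real M)) * s) = exp (of_real (ln (real M)) * s) * (a n * of_nat n powr (- s))"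
      unfolding of_nat_powr_exp[OF n0] by (simp add: exp_add[symmetric] algebra_simps)
  qed
  have nF: "norm (F (Complex \<sigma> t)) = real M powr \<sigma> * norm (dpoly_eval a (Complex \<sigma> t))" for \<sigma> t
    unfolding FD norm_mult using M by (simp add: powr_def algebra_simps)
  let ?m = "\<lambda>\<sigma>. mean (\<lambda>t. norm (dpoly_eval a (Complex \<sigma> t)) powr p)"
  have p0: "p > 0" using p by simp
  have "(real M powr \<epsilon>) powr p * ?m \<epsilon> \<le> ?m 0"
    using contraction[OF F p0 e] M p0
    by (simp add: nF powr_mult mean_cmult real_ap_norm_powr ap_dpoly a)
  then have "((real M powr \<epsilon>) powr p * ?m \<epsilon>) powr (1 / p) \<le> ?m 0 powr (1 / p)"
    using p0 mean_nonneg[OF real_ap_norm_powr[OF ap_dpoly[OF a] p0]] by (intro powr_mono2) auto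
  then have "real M powr \<epsilon> * Lp p (\<lambda>t. dpoly_eval a (Complex \<epsilon> t)) \<le> Lp p (\<lambda>t. dpoly_eval a (Complex 0 t))"
    using p0 M mean_nonneg[OF real_ap_norm_powr[OF ap_dpoly[OF a] p0]] by (simp add: Lp_def powr_mult powr_powr)
  then have "real M powr \<epsilon> * dpoly_norm p (dirichlet_shift \<epsilon> a) \<le> dpoly_norm p a"
    using p0 by (simp add: dpoly_norm_Lp a dirichlet_poly_shift dpoly_eval_shift)
  then show ?thesis using M by (simp add: powr_minus divide_simps mult.commute)
qed

lemma norm_dpoly_eval_le:
  assumes "finite S" "{n. a n \<noteq> 0} \<subseteq> S" "a 0 = 0"
  shows "norm (dpoly_eval a (Complex 0 t)) \<le> (\<Sum>n\<in>S. norm (a n))"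
  unfolding dpoly_eval_superset[OF assms(1,2)]
proof (rule sum_norm_le)
  fix n
  show "norm (a n * of_nat n powr (- Complex 0 t)) \<le> norm (a n)"
  proof (cases "n = 0")
    case True
    then show ?thesis using assms(3) by simp
  next
    case False
    show ?thesis unfolding of_nat_powr_exp[OF False] norm_mult by simp
  qed
qed

lemma dpoly_norm_le_sum:
  assumes a: "dirichlet_poly a" and p: "1 \<le> p" and S: "finite S" "{n. a n \<noteq> 0} \<subseteq> S"
  shows "dpoly_norm p a \<le> (\<Sum>n\<in>S. norm (a n))"
proof -
  have p0: "p > 0" using p by simp
  let ?c = "\<Sum>n\<in>S. norm (a n)"
  have c: "?c \<ge> 0" by (intro sum_nonneg) auto
  have "mean (\<lambda>t. norm (dpoly_eval a (Complex 0 t)) powr p) \<le> mean (\<lambda>t. ?c powr p)"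
    using a by (intro mean_mono real_ap_norm_powr ap_dpoly real_ap_const p0 powr_mono2 norm_dpoly_eval_le S)
      (use p in \<open>auto simp: dirichlet_poly_def\<close>)
  then show ?thesis using p0 c unfolding dpoly_norm_Lp[OF a p0] mean_const
    by (intro Lp_leI ap_dpoly a)
qed

text \<open>\<open>a m\<close> is the mean of the polynomial against
  \<open>m powr (\<i> * t)\<close>: distinct positive integers have distinct logarithms, so all
  other terms average to 0. The factor 2 comes from \<open>mean_norm_le_Lp\<close>.\<close>

lemma norm_coeff_le:
  assumes a: "dirichlet_poly a" and p: "1 \<le> p"
  shows "norm (a m) \<le> 2 * dpoly_norm p a"
proof (cases "a m = 0")
  case True
  then show ?thesis using dpoly_norm_nonneg[OF a p] by simp
next
  case False
  let ?S = "{n. a n \<noteq> 0}" and ?f = "\<lambda>t. dpoly_eval a (Complex 0 t)"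
  have S: "finite ?S" and n0: "\<And>n. n \<in> ?S \<Longrightarrow> n \<noteq> 0"
    using a unfolding dirichlet_poly_def by (auto intro: gr0I)
  \<comment> \<open>A unimodular factor turning \<open>a m\<close> into its modulus, so that means
    of real functions suffice.\<close>
  define u where "u = cnj (a m) / norm (a m)"
  have u: "norm u = 1" "u * a m = norm (a m)" using False
    using complex_norm_square[of "a m"]
    by (auto simp: u_def norm_divide power2_eq_square field_simps)
  have "(\<lambda>t. \<Sum>n\<in>?S. Re ((u * a n) * cis ((ln m - ln n) * t))) = (\<lambda>t. Re (u * cis (ln m * t) * ?f t))"
  proof
    fix t
    have "?f t = (\<Sum>n\<in>?S. a n * cis (- ln n * t))"
      unfolding dpoly_eval_def
    proof (intro sum.cong refl)
      fix n assume "n \<in> ?S"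
      then have "of_nat n powr (- Complex 0 t) = cis (- ln n * t)"
        unfolding of_nat_powr_exp[OF n0[OF \<open>n \<in> ?S\<close>]] exp_on_line by simp
      then show "a n * of_nat n powr (- Complex 0 t) = a n * cis (- ln n * t)" by simp
    qed
    then have "u * cis (ln m * t) * ?f t = (\<Sum>n\<in>?S. u * a n * (cis (ln m * t) * cis (- ln n * t)))"
      by (simp add: sum_distrib_left mult.assoc mult.left_commute)
    also have "\<dots> = (\<Sum>n\<in>?S. (u * a n) * cis ((ln m - ln n) * t))"
      unfolding cis_mult by (simp add: algebra_simps)
    finally show "(\<Sum>n\<in>?S. Re ((u * a n) * cis ((ln m - ln n) * t))) = Re (u * cis (ln m * t) * ?f t)" by simp
  qed
  moreover have "has_mean (\<lambda>t. \<Sum>n\<in>?S. Re ((u * a n) * cis ((ln m - ln n) * t)))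
      (\<Sum>n\<in>?S. if ln m - ln n = 0 then Re (u * a n) else 0)"
    by (rule has_mean_sum[OF S has_mean_cis]) (auto intro!: continuous_intros)
  moreover have "(\<Sum>n\<in>?S. if ln m - ln n = 0 then Re (u * a n) else 0) = norm (a m)"
  proof -
    have "(\<Sum>n\<in>?S. if ln m - ln n = 0 then Re (u * a n) else 0) = (\<Sum>n\<in>?S. if n = m then Re (u * a n) else 0)"
    proof (intro sum.cong refl)
      fix n assume n: "n \<in> ?S"
      have "ln (real m) - ln (real n) = 0 \<longleftrightarrow> n = m"
        using n0[OF n] n0[of m] False by (metis (mono_tags) eq_iff_diff_eq_0 gr0I ln_inj_iff mem_Collect_eq of_nat_0_less_iff of_nat_eq_iff)
      then show "(if ln m - ln n = 0 then Re (u * a n) else 0) = (if n = m then Re (u * a n) else 0)" by simp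
    qed
    also have "\<dots> = norm (a m)" using S False u(2) by simp
    finally show ?thesis .
  qed
  ultimately have hm: "has_mean (\<lambda>t. Re (u * cis (ln m * t) * ?f t)) (norm (a m))" by simp
  have r: "real_ap (\<lambda>t. norm (?f t))" using real_ap_norm_powr[OF ap_dpoly[OF a], of 1 0] by simp
  have "norm (a m) \<le> mean (\<lambda>t. norm (?f t))"
  proof (rule has_mean_le[OF hm real_ap_has_mean[OF r] _ real_ap_continuous[OF r]])
    show "continuous_on UNIV (\<lambda>t. Re (u * cis (ln m * t) * ?f t))"
      by (intro continuous_intros trig_poly_continuous analytic_poly_trig_poly analytic_poly_dpoly_eval a)
    show "Re (u * cis (ln m * t) * ?f t) \<le> norm (?f t)" for t
      using complex_Re_le_cmod[of "u * cis (ln m * t) * ?f t"] u(1) by (simp add: norm_mult)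
  qed
  also have "\<dots> \<le> 2 * dpoly_norm p a"
    using mean_norm_le_Lp[OF ap_dpoly[OF a] p, of 0] p by (simp add: dpoly_norm_Lp a)
  finally show ?thesis .
qed

subsection \<open>Bounded families of Dirichlet polynomials under the shift\<close>

text \<open>For a single polynomial, finitely many coefficients move continuously with the shift.
  The bound \<open>\<epsilon>0\<close> depends on \<open>a\<close>; uniformity along bounded
  families is the harder matter.\<close>

lemma dpoly_norm_shift_cont:
  assumes a: "dirichlet_poly a" and p: "1 \<le> p" and k: "\<kappa> > 0"
  obtains \<epsilon>0 where "\<epsilon>0 > 0" "\<And>\<epsilon>. 0 \<le> \<epsilon> \<Longrightarrow> \<epsilon> \<le> \<epsilon>0 \<Longrightarrow> dpoly_norm p (\<lambda>n. a n - dirichlet_shift \<epsilon> a n) \<le> \<kappa>"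
proof -
  let ?S = "{n. a n \<noteq> 0}"
  have S: "finite ?S" "\<And>n. n \<in> ?S \<Longrightarrow> n \<noteq> 0"
    using a unfolding dirichlet_poly_def by (auto intro: gr0I)
  have "((\<lambda>\<epsilon>. \<Sum>n\<in>?S. norm (a n - dirichlet_shift \<epsilon> a n)) \<longlongrightarrow> (\<Sum>n\<in>?S. norm (a n - a n / of_real (real n powr 0)))) (nhds 0)"
    unfolding dirichlet_shift_def
    by (intro tendsto_intros filterlim_ident) (use S(2) in auto)
  moreover have "(\<Sum>n\<in>?S. norm (a n - a n / of_real (real n powr 0))) = 0"
    using S(2) by (intro sum.neutral) auto
  ultimately have "\<forall>\<^sub>F \<epsilon> in nhds 0. (\<Sum>n\<in>?S. norm (a n - dirichlet_shift \<epsilon> a n)) < \<kappa>"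
    using k by (intro order_tendstoD) auto
  then obtain d where d: "d > 0" "\<And>\<epsilon>::real. dist \<epsilon> 0 < d \<Longrightarrow> (\<Sum>n\<in>?S. norm (a n - dirichlet_shift \<epsilon> a n)) < \<kappa>"
    unfolding eventually_nhds_metric by blast
  show ?thesis
  proof (rule that[of "d / 2"])
    fix \<epsilon> :: real assume e: "0 \<le> \<epsilon>" "\<epsilon> \<le> d / 2"
    have "dpoly_norm p (\<lambda>n. a n - dirichlet_shift \<epsilon> a n) \<le> (\<Sum>n\<in>?S. norm (a n - dirichlet_shift \<epsilon> a n))"
      by (rule dpoly_norm_le_sum[OF dirichlet_poly_diff[OF a dirichlet_poly_shift[OF a]] p S(1)])
         (auto simp: dirichlet_shift_def)
    also have "\<dots> \<le> \<kappa>" using d(2)[of \<epsilon>] d(1) e by simp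
    finally show "dpoly_norm p (\<lambda>n. a n - dirichlet_shift \<epsilon> a n) \<le> \<kappa>" .
  qed (use d in auto)
qed

text \<open>Cut at \<open>M\<close>: above it the shift damps by
  \<open>real M powr (- \<epsilon>)\<close>, below it there are finitely many coefficients, all
  small. \<open>M\<close> and \<open>\<tau>\<close> depend on the bound \<open>B\<close>, not on the
  polynomial.\<close>

lemma dpoly_norm_shift_small:
  assumes p: "1 \<le> p" and e: "\<epsilon> > 0" and B: "B \<ge> 0" and eta: "\<eta> > 0"
  obtains M \<tau> where "\<tau> > 0" "\<And>a. dirichlet_poly a \<Longrightarrow> dpoly_norm p a \<le> B \<Longrightarrow> (\<forall>n<M. norm (a n) \<le> \<tau>)
     \<Longrightarrow> dpoly_norm p (dirichlet_shift \<epsilon> a) \<le> \<eta>"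
proof -
  have "(\<lambda>M. real M powr (- \<epsilon>)) \<longlonglongrightarrow> 0"
    using e by (intro tendsto_neg_powr filterlim_real_sequentially) auto
  then have "\<forall>\<^sub>F M in sequentially. real M powr (- \<epsilon>) < \<eta> / (2 * (B + 1)) \<and> M > 0"
    using eta B by (intro eventually_conj order_tendstoD eventually_gt_at_top) auto
  then obtain M where M: "real M powr (- \<epsilon>) < \<eta> / (2 * (B + 1))" "M > 0"
    using eventually_happens'[OF sequentially_bot] by blast
  \<comment> \<open>The 1 in \<open>min\<close> keeps the norm of the high part below
    \<open>B + 1\<close>, matching the choice of \<open>M\<close>; \<open>\<eta> / 2\<close> is the
    share of the low part.\<close>
  define \<tau> where "\<tau> = min 1 (\<eta> / 2) / real M"
  have tau: "\<tau> > 0" "real M * \<tau> \<le> 1" "real M * \<tau> \<le> \<eta> / 2" using M(2) eta by (auto simp: \<tau>_def)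
  show ?thesis
  proof (rule that[OF tau(1)])
    fix a assume a: "dirichlet_poly a" and aB: "dpoly_norm p a \<le> B" and sm: "\<forall>n<M. norm (a n) \<le> \<tau>"
    define lo where "lo n = (if n < M then a n else 0)" for n
    define hi where "hi n = a n - lo n" for n
    have lo: "dirichlet_poly lo" unfolding lo_def by (rule dirichlet_poly_cut[OF a])
    have hi: "dirichlet_poly hi" unfolding hi_def by (rule dirichlet_poly_diff[OF a lo])
    have "dpoly_norm p lo \<le> (\<Sum>n<M. norm (lo n))"
      by (rule dpoly_norm_le_sum[OF lo p]) (auto simp: lo_def split: if_splits)
    also have "\<dots> \<le> real M * \<tau>" using sm sum_bounded_above[of "{..<M}" "\<lambda>n. norm (lo n)" \<tau>] by (auto simp: lo_def)
    finally have nlo: "dpoly_norm p lo \<le> real M * \<tau>" .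
    have nhi: "dpoly_norm p hi \<le> B + 1"
      using dpoly_norm_diff[OF a lo p] nlo tau(2) aB unfolding hi_def by linarith
    have "dpoly_norm p (dirichlet_shift \<epsilon> hi) \<le> real M powr (- \<epsilon>) * dpoly_norm p hi"
      by (rule dpoly_norm_shift_tail[OF hi p less_imp_le[OF e] M(2)]) (simp add: hi_def lo_def)
    also have "\<dots> \<le> (\<eta> / (2 * (B + 1))) * (B + 1)"
      using M(1) nhi B eta dpoly_norm_nonneg[OF hi p] by (intro mult_mono) auto
    also have "\<dots> = \<eta> / 2" using B by (simp add: field_simps)
    finally have shi: "dpoly_norm p (dirichlet_shift \<epsilon> hi) \<le> \<eta> / 2" .
    have slo: "dpoly_norm p (dirichlet_shift \<epsilon> lo) \<le> \<eta> / 2"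
      using dpoly_norm_shift_le[OF lo p, of \<epsilon>] e nlo tau(3) by linarith
    have "a = (\<lambda>n. lo n + hi n)" by (simp add: hi_def)
    then have "dirichlet_shift \<epsilon> a = (\<lambda>n. dirichlet_shift \<epsilon> lo n + dirichlet_shift \<epsilon> hi n)"
      by (metis dirichlet_shift_add)
    then show "dpoly_norm p (dirichlet_shift \<epsilon> a) \<le> \<eta>"
      using dpoly_norm_add[OF dirichlet_poly_shift[OF lo] dirichlet_poly_shift[OF hi] p, of \<epsilon> \<epsilon>] slo shi
      by simp
  qed
qed

text \<open>Two sequences with common coefficient limits and independent indices allow three uses:
  \<open>b = c\<close> for the Cauchy property, \<open>c = 0\<close> for null sequences, and
  \<open>c\<close> a representing sequence of the limit series.\<close>

lemma shift_diff_small: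
  assumes p: "1 \<le> p" and e: "\<epsilon> > 0" and eta: "\<eta> > 0"
    and b: "\<And>j. dirichlet_poly (b j)" "\<And>j. dpoly_norm p (b j) \<le> B" "\<And>n. (\<lambda>j. b j n) \<longlonglongrightarrow> a n"
    and c: "\<And>j. dirichlet_poly (c j)" "\<And>j. dpoly_norm p (c j) \<le> B" "\<And>n. (\<lambda>j. c j n) \<longlonglongrightarrow> a n"
  shows "\<exists>J. \<forall>i\<ge>J. \<forall>j\<ge>J. dpoly_norm p (dirichlet_shift \<epsilon> (\<lambda>n. b i n - c j n)) \<le> \<eta>"
proof -
  have B2: "2 * B \<ge> 0" using b(2)[of 0] dpoly_norm_nonneg[OF b(1)[of 0] p] by simp
  obtain \<tau> M where M: "\<tau> > 0" "\<And>a. dirichlet_poly a \<Longrightarrow> dpoly_norm p a \<le> 2 * B \<Longrightarrow> (\<forall>n<M. norm (a n) \<le> \<tau>)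
     \<Longrightarrow> dpoly_norm p (dirichlet_shift \<epsilon> a) \<le> \<eta>"
    using dpoly_norm_shift_small[OF p e B2 eta, of thesis] that by blast
  have t: "\<tau> / 2 > 0" using M(1) by simp
  have "\<forall>\<^sub>F j in sequentially. \<forall>n\<in>{..<M}. norm (b j n - a n) < \<tau> / 2 \<and> norm (c j n - a n) < \<tau> / 2"
    using tendstoD[OF b(3) t] tendstoD[OF c(3) t] unfolding dist_norm
    by (intro eventually_ball_finite ballI eventually_conj finite_lessThan)
  then obtain J where J: "\<And>j n. j \<ge> J \<Longrightarrow> n < M \<Longrightarrow> norm (b j n - a n) < \<tau> / 2 \<and> norm (c j n - a n) < \<tau> / 2"
    unfolding eventually_sequentially by blast
  show ?thesis
  proof (intro exI[of _ J] allI impI)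
    fix i j assume ij: "i \<ge> J" "j \<ge> J"
    show "dpoly_norm p (dirichlet_shift \<epsilon> (\<lambda>n. b i n - c j n)) \<le> \<eta>"
    proof (rule M(2)[OF dirichlet_poly_diff[OF b(1) c(1)]])
      show "dpoly_norm p (\<lambda>n. b i n - c j n) \<le> 2 * B"
        using dpoly_norm_diff[OF b(1) c(1) p, of i j] b(2)[of i] c(2)[of j] by linarith
      show "\<forall>n<M. norm (b i n - c j n) \<le> \<tau>"
      proof (intro allI impI)
        fix n assume "n < M"
        then show "norm (b i n - c j n) \<le> \<tau>"
          using J[OF ij(1), of n] J[OF ij(2), of n] norm_triangle_ineq4[of "b i n - a n" "c j n - a n"] by simp
      qed
    qed
  qed
qed

section \<open>Shifts of a bounded family as the shift tends to 0\<close>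

lemma dpoly_norm_1: "dirichlet_poly a \<Longrightarrow> dpoly_norm 1 a = mean (\<lambda>t. norm (dpoly_eval a (Complex 0 t)))"
  using mean_nonneg[OF real_ap_norm_powr[OF ap_dpoly[of a 0]], of 1] by (simp add: dpoly_norm_Lp Lp_def)

lemma near_isometry_dpoly:
  assumes a: "dirichlet_poly a" and d: "\<delta> \<ge> 0" and eta: "0 < \<eta>" "\<eta> \<le> 1"
    and B: "dpoly_norm 1 a \<le> B" and near: "dpoly_norm 1 a - \<eta> \<le> dpoly_norm 1 (dirichlet_shift \<delta> a)"
  shows "dpoly_norm 1 (\<lambda>n. a n - dirichlet_shift \<delta> a n) \<le> (B + 5) * sqrt \<eta>"
  using near_isometry_L1[OF analytic_poly_dpoly_eval[OF a] d eta] B near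
  by (simp add: dpoly_norm_1 a dirichlet_poly_shift dirichlet_poly_diff dpoly_eval_shift dpoly_eval_diff)

text \<open>The bounds \<open>L + \<eta>\<close> and \<open>L - 5 * \<eta>\<close> are shaped by the
  application, where the norms approach the level \<open>L\<close> and the sum of two shifts loses a
  few multiples of \<open>\<eta>\<close>.\<close>

lemma uniform_convexity_dpoly:
  assumes p: "1 < p" and L: "L \<ge> 0" and k: "\<kappa> > 0"
  obtains \<eta> where "\<eta> > 0" "\<And>f g. dirichlet_poly f \<Longrightarrow> dirichlet_poly g \<Longrightarrow> dpoly_norm p f \<le> L + \<eta> \<Longrightarrow>
    dpoly_norm p g \<le> L + \<eta> \<Longrightarrow> 2 * (L - 5 * \<eta>) \<le> dpoly_norm p (\<lambda>n. f n + g n) \<Longrightarrow>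
    dpoly_norm p (\<lambda>n. f n - g n) \<le> \<kappa>"
proof -
  have p0: "p > 0" using p by simp
  \<comment> \<open>Chosen so that the first term of the pointwise inequality averages to at most
    \<open>\<kappa> powr p / 2\<close> once both norms are at most \<open>L + 1\<close>.\<close>
  define \<eta>1 where "\<eta>1 = \<kappa> powr p / (4 * (L + 1) powr p)"
  have e1: "\<eta>1 > 0" "\<eta>1 * (2 * (L + 1) powr p) = \<kappa> powr p / 2" using L k by (auto simp: \<eta>1_def)
  obtain C where C: "C \<ge> 0" "\<And>a b :: complex. norm (a - b) powr p \<le> \<eta>1 * (norm a powr p + norm b powr p)
     + C * ((norm a powr p + norm b powr p) / 2 - norm ((a + b) / 2) powr p)"
    using uniform_convexity[OF p e1(1)] by blast
  \<comment> \<open>\<open>max 0\<close> protects the power from a negative base, which occurs when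
    \<open>L = 0\<close>.\<close>
  have "((\<lambda>\<eta>. C * ((L + \<eta>) powr p - max 0 (L - 5 * \<eta>) powr p)) \<longlongrightarrow> C * ((L + 0) powr p - max 0 (L - 5 * 0) powr p)) (at_right 0)"
  proof -
    have 1: "((\<lambda>\<eta>. (L + \<eta>) powr p) \<longlongrightarrow> (L + 0) powr p) (at_right 0)"
    proof (rule tendsto_powr2[OF _ tendsto_const])
      show "((\<lambda>\<eta>. L + \<eta>) \<longlongrightarrow> L + 0) (at_right 0)" by (intro tendsto_intros)
      show "\<forall>\<^sub>F x in at_right 0. 0 \<le> L + x" using L by (auto simp: eventually_at_filter)
    qed (use p in auto)
    have 2: "((\<lambda>\<eta>. max 0 (L - 5 * \<eta>) powr p) \<longlongrightarrow> max 0 (L - 5 * 0) powr p) (at_right 0)"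
    proof (rule tendsto_powr2[OF _ tendsto_const])
      show "((\<lambda>\<eta>. max 0 (L - 5 * \<eta>)) \<longlongrightarrow> max 0 (L - 5 * 0)) (at_right 0)" by (intro tendsto_intros)
    qed (use p in auto)
    show ?thesis by (intro tendsto_mult_left tendsto_diff 1 2)
  qed
  then have "\<forall>\<^sub>F \<eta> in at_right 0. C * ((L + \<eta>) powr p - max 0 (L - 5 * \<eta>) powr p) < \<kappa> powr p / 2"
    using L k by (intro order_tendstoD) auto
  moreover have "\<forall>\<^sub>F \<eta> in at_right (0::real). \<eta> > 0" by (simp add: eventually_at_filter)
  moreover have "\<forall>\<^sub>F \<eta> in at_right (0::real). \<eta> < 1" by (intro order_tendstoD[OF tendsto_ident_at]) auto
  ultimately have "\<forall>\<^sub>F \<eta> in at_right 0. \<eta> > 0 \<and> \<eta> < 1 \<and> C * ((L + \<eta>) powr p - max 0 (L - 5 * \<eta>) powr p) < \<kappa> powr p / 2"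
    by eventually_elim simp
  then obtain \<eta> where et: "\<eta> > 0" "\<eta> < 1" "C * ((L + \<eta>) powr p - max 0 (L - 5 * \<eta>) powr p) < \<kappa> powr p / 2"
    using eventually_happens'[OF trivial_limit_at_right_real] by blast
  show ?thesis
  proof (rule that[OF et(1)])
    fix f g assume f: "dirichlet_poly f" and g: "dirichlet_poly g"
      and Nf: "dpoly_norm p f \<le> L + \<eta>" and Ng: "dpoly_norm p g \<le> L + \<eta>"
      and Nfg: "2 * (L - 5 * \<eta>) \<le> dpoly_norm p (\<lambda>n. f n + g n)"
    let ?D = "\<lambda>a t. dpoly_eval a (Complex 0 t)"
    let ?m = "\<lambda>a. mean (\<lambda>t. norm (?D a t) powr p)"
    let ?s = "\<lambda>n. f n + g n" and ?d = "\<lambda>n. f n - g n"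
    have s: "dirichlet_poly ?s" and d: "dirichlet_poly ?d" using f g dirichlet_poly_add dirichlet_poly_diff by auto
    have r: "real_ap (\<lambda>t. norm (?D a t) powr p)" if "dirichlet_poly a" for a
      by (intro real_ap_norm_powr ap_dpoly that p0)
    have mf: "?m f \<le> (L + \<eta>) powr p" and mg: "?m g \<le> (L + \<eta>) powr p"
      using Nf Ng by (auto intro!: mean_powr_le ap_dpoly f g p0 simp: dpoly_norm_Lp f g p0)
    have "max 0 (2 * (L - 5 * \<eta>)) powr p \<le> dpoly_norm p ?s powr p"
      using Nfg p0 dpoly_norm_nonneg[OF s] p by (intro powr_mono2) auto
    also have "\<dots> = ?m ?s" using dpoly_norm_Lp[OF s p0] Lp_powr[OF ap_dpoly[OF s] p0, of 0] by simp
    finally have ms: "max 0 (2 * (L - 5 * \<eta>)) powr p \<le> ?m ?s" .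
    have "max 0 (2 * (L - 5 * \<eta>)) = 2 * max 0 (L - 5 * \<eta>)" by (simp add: max_def)
    then have ms': "max 0 (L - 5 * \<eta>) powr p \<le> (1 / 2 powr p) * ?m ?s"
      using ms by (simp add: powr_mult field_simps)
    have "?m ?d \<le> mean (\<lambda>t. (\<eta>1 + C / 2) * norm (?D f t) powr p + ((\<eta>1 + C / 2) * norm (?D g t) powr p
        + (- C * (1 / 2 powr p)) * norm (?D ?s t) powr p))"
    proof (intro mean_mono real_ap_add real_ap_cmult r f g s d)
      fix t
      show "norm (?D ?d t) powr p \<le> (\<eta>1 + C / 2) * norm (?D f t) powr p + ((\<eta>1 + C / 2) * norm (?D g t) powr p
        + (- C * (1 / 2 powr p)) * norm (?D ?s t) powr p)"
      proof -
        have "norm (z / 2) powr p = (1 / 2 powr p) * norm z powr p" for z :: complex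
          by (simp add: norm_divide powr_divide)
        from C(2)[of "?D f t" "?D g t", unfolded this] show ?thesis
          by (simp add: dpoly_eval_diff dpoly_eval_add f g algebra_simps add_divide_distrib)
      qed
    qed
    also have "\<dots> = (\<eta>1 + C / 2) * ?m f + ((\<eta>1 + C / 2) * ?m g + (- C * (1 / 2 powr p)) * ?m ?s)"
      by (simp only: mean_add mean_cmult real_ap_add real_ap_cmult r f g s)
    also have "\<dots> = \<eta>1 * (?m f + ?m g) + C * ((?m f + ?m g) / 2 - (1 / 2 powr p) * ?m ?s)"
      by (simp add: algebra_simps)
    also have "\<dots> \<le> \<eta>1 * (2 * (L + 1) powr p) + C * ((L + \<eta>) powr p - max 0 (L - 5 * \<eta>) powr p)"
    proof (intro add_mono mult_left_mono)
      have "(L + \<eta>) powr p \<le> (L + 1) powr p" using L et p by (intro powr_mono2) auto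
      then show "?m f + ?m g \<le> 2 * (L + 1) powr p" using mf mg by linarith
      show "(?m f + ?m g) / 2 - (1 / 2 powr p) * ?m ?s \<le> (L + \<eta>) powr p - max 0 (L - 5 * \<eta>) powr p"
        using mf mg ms' by argo
    qed (use e1 C in auto)
    also have "\<dots> \<le> \<kappa> powr p" using e1(2) et(3) by linarith
    finally show "dpoly_norm p ?d \<le> \<kappa>"
      using k p0 unfolding dpoly_norm_Lp[OF d p0] by (intro Lp_leI ap_dpoly d) auto
  qed
qed

text \<open>For fixed \<open>\<epsilon> > 0\<close> the norms converge in \<open>j\<close> by
  \<open>shift_diff_small\<close>, although those of \<open>b j\<close> itself need not.
  \<open>L\<close> is the supremum of these limits; by contractivity a lower bound at one
  \<open>\<gamma>\<close> serves all smaller shifts as well.\<close>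

lemma shift_norm_level:
  assumes p: "1 \<le> p"
    and b: "\<And>j. dirichlet_poly (b j)" "\<And>j. dpoly_norm p (b j) \<le> B" "\<And>n. (\<lambda>j. b j n) \<longlonglongrightarrow> a n"
  obtains L where "0 \<le> L" "L \<le> B"
    "\<And>\<epsilon> \<eta>. \<epsilon> > 0 \<Longrightarrow> \<eta> > 0 \<Longrightarrow> \<forall>\<^sub>F j in sequentially. dpoly_norm p (dirichlet_shift \<epsilon> (b j)) \<le> L + \<eta>"
    "\<And>\<eta>. \<eta> > 0 \<Longrightarrow> \<exists>\<gamma>>0. \<forall>\<^sub>F j in sequentially. L - \<eta> \<le> dpoly_norm p (dirichlet_shift \<gamma> (b j))"
proof -
  let ?N = "\<lambda>\<epsilon> j. dpoly_norm p (dirichlet_shift \<epsilon> (b j))"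
  have "\<exists>l. ?N \<epsilon> \<longlonglongrightarrow> l" if e: "\<epsilon> > 0" for \<epsilon>
  proof -
    have "Cauchy (?N \<epsilon>)"
    proof (rule metric_CauchyI)
      fix \<eta> :: real assume "\<eta> > 0"
      then have "\<eta> / 2 > 0" by simp
      obtain J where J: "\<And>i j. i \<ge> J \<Longrightarrow> j \<ge> J \<Longrightarrow> dpoly_norm p (dirichlet_shift \<epsilon> (\<lambda>n. b i n - b j n)) \<le> \<eta> / 2"
        using shift_diff_small[OF p e \<open>\<eta> / 2 > 0\<close> b b] by blast
      have le: "?N \<epsilon> i \<le> ?N \<epsilon> j + \<eta> / 2" if "i \<ge> J" "j \<ge> J" for i j
      proof -
        have "?N \<epsilon> i \<le> ?N \<epsilon> j + dpoly_norm p (\<lambda>n. dirichlet_shift \<epsilon> (b i) n - dirichlet_shift \<epsilon> (b j) n)"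
          by (rule dpoly_norm_le_add[OF dirichlet_poly_shift[OF b(1)] dirichlet_poly_shift[OF b(1)] p])
        then show ?thesis using J[OF that] by (simp add: dirichlet_shift_diff)
      qed
      have "dist (?N \<epsilon> i) (?N \<epsilon> j) < \<eta>" if "i \<ge> J" "j \<ge> J" for i j
        using le[OF that] le[OF that(2,1)] \<open>\<eta> > 0\<close> unfolding dist_real_def by linarith
      then show "\<exists>M. \<forall>m\<ge>M. \<forall>n\<ge>M. dist (?N \<epsilon> m) (?N \<epsilon> n) < \<eta>" by blast
    qed
    then show ?thesis by (simp add: Cauchy_convergent_iff convergent_def)
  qed
  then obtain l where l: "\<And>\<epsilon>. \<epsilon> > 0 \<Longrightarrow> ?N \<epsilon> \<longlonglongrightarrow> l \<epsilon>" by metis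
  have l0: "0 \<le> l \<epsilon>" if "\<epsilon> > 0" for \<epsilon>
    by (rule tendsto_lowerbound[OF l[OF that]]) (auto intro!: always_eventually dpoly_norm_nonneg dirichlet_poly_shift b p)
  have lB: "l \<epsilon> \<le> B" if "\<epsilon> > 0" for \<epsilon>
  proof (rule tendsto_upperbound[OF l[OF that]])
    have "?N \<epsilon> j \<le> B" for j
      using dpoly_norm_shift_le[OF b(1) p, of \<epsilon> j] that b(2)[of j] by linarith
    then show "\<forall>\<^sub>F j in sequentially. ?N \<epsilon> j \<le> B" by simp
  qed simp
  define L where "L = Sup (l ` {0<..})"
  have bdd: "bdd_above (l ` {0<..})" using lB by (auto intro!: bdd_aboveI[of _ B])
  have lL: "l \<epsilon> \<le> L" if "\<epsilon> > 0" for \<epsilon> unfolding L_def using that bdd by (intro cSup_upper) auto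
  show ?thesis
  proof (rule that[of L])
    show "0 \<le> L" using l0[of 1] lL[of 1] by simp
    show "L \<le> B" unfolding L_def using lB by (intro cSup_least) auto
    show "\<forall>\<^sub>F j in sequentially. ?N \<epsilon> j \<le> L + \<eta>" if "\<epsilon> > 0" "\<eta> > 0" for \<epsilon> \<eta>
    proof -
      have "l \<epsilon> < L + \<eta>" using lL[OF that(1)] that by linarith
      from order_tendstoD(2)[OF l[OF that(1)] this] show ?thesis by eventually_elim simp
    qed
    show "\<exists>\<gamma>>0. \<forall>\<^sub>F j in sequentially. L - \<eta> \<le> ?N \<gamma> j" if "\<eta> > 0" for \<eta>
    proof -
      have "L - \<eta> < L" using that by simp
      then obtain \<gamma> where g: "\<gamma> > 0" "L - \<eta> < l \<gamma>"
        unfolding L_def using less_cSup_iff[OF _ bdd] by fastforce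
      from order_tendstoD(1)[OF l[OF g(1)] g(2)] have "\<forall>\<^sub>F j in sequentially. L - \<eta> \<le> ?N \<gamma> j"
        by eventually_elim simp
      with g show ?thesis by blast
    qed
  qed
qed

text \<open>For positive shifts up to \<open>\<gamma>\<close> the norms eventually lie within
  \<open>\<eta> / 2\<close> of \<open>L\<close>, so passing from \<open>\<epsilon>\<close> to
  \<open>\<epsilon>'\<close> costs at most \<open>\<eta>\<close> and
  \<open>near_isometry_dpoly\<close> applies. \<open>\<epsilon>0\<close> is independent of
  \<open>j\<close>, but the index from which the bound holds may depend on \<open>\<epsilon>\<close>
  and \<open>\<epsilon>'\<close>.\<close>

lemma shift_family_Cauchy_1:
  assumes b: "\<And>j. dirichlet_poly (b j)" "\<And>j. dpoly_norm 1 (b j) \<le> B" "\<And>n. (\<lambda>j. b j n) \<longlonglongrightarrow> a n"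
    and k: "\<kappa> > 0"
  shows "\<exists>\<epsilon>0>0. \<forall>\<epsilon> \<epsilon>'. 0 < \<epsilon> \<longrightarrow> \<epsilon> \<le> \<epsilon>' \<longrightarrow> \<epsilon>' \<le> \<epsilon>0 \<longrightarrow>
    (\<forall>\<^sub>F j in sequentially. dpoly_norm 1 (\<lambda>n. dirichlet_shift \<epsilon> (b j) n - dirichlet_shift \<epsilon>' (b j) n) \<le> \<kappa>)"
proof -
  have p: "1 \<le> (1::real)" by simp
  obtain L where L: "0 \<le> L" "L \<le> B"
    "\<And>\<epsilon> \<eta>. \<epsilon> > 0 \<Longrightarrow> \<eta> > 0 \<Longrightarrow> \<forall>\<^sub>F j in sequentially. dpoly_norm 1 (dirichlet_shift \<epsilon> (b j)) \<le> L + \<eta>"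
    "\<And>\<eta>. \<eta> > 0 \<Longrightarrow> \<exists>\<gamma>>0. \<forall>\<^sub>F j in sequentially. L - \<eta> \<le> dpoly_norm 1 (dirichlet_shift \<gamma> (b j))"
    using shift_norm_level[OF p b] by blast
  obtain x where x: "x > 0" "x \<le> 1" "(B + 5) * x \<le> \<kappa>"
    using small_scale[OF k, of "B + 5"] L by auto
  \<comment> \<open>A square, because the near-isometry estimate is of order
    \<open>sqrt \<eta>\<close>.\<close>
  define \<eta> where "\<eta> = x\<^sup>2"
  have eta: "0 < \<eta>" "\<eta> \<le> 1" "sqrt \<eta> = x" using x by (auto simp: \<eta>_def power_le_one)
  then have "\<eta> / 2 > 0" by simp
  from L(4)[OF this] obtain \<gamma> where g: "\<gamma> > 0" "\<forall>\<^sub>F j in sequentially. L - \<eta> / 2 \<le> dpoly_norm 1 (dirichlet_shift \<gamma> (b j))" by blast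
  show ?thesis
  proof (intro exI[of _ \<gamma>] conjI allI impI g(1))
    fix \<epsilon> \<epsilon>' assume e: "0 < \<epsilon>" "\<epsilon> \<le> \<epsilon>'" "\<epsilon>' \<le> \<gamma>"
    show "\<forall>\<^sub>F j in sequentially. dpoly_norm 1 (\<lambda>n. dirichlet_shift \<epsilon> (b j) n - dirichlet_shift \<epsilon>' (b j) n) \<le> \<kappa>"
      using g(2) L(3)[OF e(1) \<open>\<eta> / 2 > 0\<close>]
    proof eventually_elim
      case (elim j)
      let ?f = "dirichlet_shift \<epsilon> (b j)"
      have f: "dirichlet_poly ?f" by (rule dirichlet_poly_shift[OF b(1)])
      have s: "dirichlet_shift (\<epsilon>' - \<epsilon>) ?f = dirichlet_shift \<epsilon>' (b j)" by (simp add: dirichlet_shift_shift)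
      have "dpoly_norm 1 (dirichlet_shift (\<gamma> - \<epsilon>') (dirichlet_shift \<epsilon>' (b j))) \<le> dpoly_norm 1 (dirichlet_shift \<epsilon>' (b j))"
        using e by (intro dpoly_norm_shift_le dirichlet_poly_shift b(1)) auto
      then have "dpoly_norm 1 ?f - \<eta> \<le> dpoly_norm 1 (dirichlet_shift (\<epsilon>' - \<epsilon>) ?f)"
        using elim unfolding s by (simp add: dirichlet_shift_shift)
      moreover have "dpoly_norm 1 ?f \<le> B"
        using dpoly_norm_shift_le[OF b(1) p, of \<epsilon> j] e b(2)[of j] by linarith
      ultimately have "dpoly_norm 1 (\<lambda>n. ?f n - dirichlet_shift (\<epsilon>' - \<epsilon>) ?f n) \<le> (B + 5) * sqrt \<eta>"
        using e eta by (intro near_isometry_dpoly f) auto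
      then show ?case using x(3) unfolding s eta(3) by linarith
    qed
  qed
qed

text \<open>
  The lower bound on the norm of the sum of two small shifts that uniform convexity asks for is
  obtained after a further shift by a fixed \<open>\<gamma>\<close>, where the family is precompact.
\<close>

lemma shift_family_Cauchy_gt_1:
  assumes p: "1 < p"
    and b: "\<And>j. dirichlet_poly (b j)" "\<And>j. dpoly_norm p (b j) \<le> B" "\<And>n. (\<lambda>j. b j n) \<longlonglongrightarrow> a n"
    and k: "\<kappa> > 0"
  shows "\<exists>\<epsilon>0>0. \<forall>\<epsilon> \<epsilon>'. 0 < \<epsilon> \<longrightarrow> \<epsilon> \<le> \<epsilon>' \<longrightarrow> \<epsilon>' \<le> \<epsilon>0 \<longrightarrow>
    (\<forall>\<^sub>F j in sequentially. dpoly_norm p (\<lambda>n. dirichlet_shift \<epsilon> (b j) n - dirichlet_shift \<epsilon>' (b j) n) \<le> \<kappa>)"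
proof -
  have p1: "1 \<le> p" using p by simp
  obtain L where L: "0 \<le> L" "L \<le> B"
    "\<And>\<epsilon> \<eta>. \<epsilon> > 0 \<Longrightarrow> \<eta> > 0 \<Longrightarrow> \<forall>\<^sub>F j in sequentially. dpoly_norm p (dirichlet_shift \<epsilon> (b j)) \<le> L + \<eta>"
    "\<And>\<eta>. \<eta> > 0 \<Longrightarrow> \<exists>\<gamma>>0. \<forall>\<^sub>F j in sequentially. L - \<eta> \<le> dpoly_norm p (dirichlet_shift \<gamma> (b j))"
    using shift_norm_level[OF p1 b] by blast
  obtain \<eta> where eta: "\<eta> > 0" and uc: "\<And>f g. dirichlet_poly f \<Longrightarrow> dirichlet_poly g \<Longrightarrow> dpoly_norm p f \<le> L + \<eta> \<Longrightarrow>
    dpoly_norm p g \<le> L + \<eta> \<Longrightarrow> 2 * (L - 5 * \<eta>) \<le> dpoly_norm p (\<lambda>n. f n + g n) \<Longrightarrow>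
    dpoly_norm p (\<lambda>n. f n - g n) \<le> \<kappa>"
    using uniform_convexity_dpoly[OF p L(1) k] by blast
  from L(4)[OF eta] obtain \<gamma> where g: "\<gamma> > 0" "\<forall>\<^sub>F j in sequentially. L - \<eta> \<le> dpoly_norm p (dirichlet_shift \<gamma> (b j))" by blast
  let ?S = "\<lambda>\<epsilon> j. dirichlet_shift \<epsilon> (b j)"
  note P = dirichlet_poly_shift[OF b(1)]
  \<comment> \<open>After the shift by \<open>\<gamma>\<close> all late members are within
    \<open>\<eta>\<close> of the single polynomial \<open>?S \<gamma> J\<close>, whose continuity
    under further shifts then serves them all.\<close>
  obtain J where J: "\<And>i j. i \<ge> J \<Longrightarrow> j \<ge> J \<Longrightarrow> dpoly_norm p (dirichlet_shift \<gamma> (\<lambda>n. b i n - b j n)) \<le> \<eta>"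
    using shift_diff_small[OF p1 g(1) eta b b] by blast
  obtain \<epsilon>0 where e0: "\<epsilon>0 > 0" "\<And>\<epsilon>. 0 \<le> \<epsilon> \<Longrightarrow> \<epsilon> \<le> \<epsilon>0 \<Longrightarrow> dpoly_norm p (\<lambda>n. ?S \<gamma> J n - dirichlet_shift \<epsilon> (?S \<gamma> J) n) \<le> \<eta>"
    using dpoly_norm_shift_cont[OF P p1 eta] by blast
  have near: "dpoly_norm p (\<lambda>n. ?S \<gamma> j n - dirichlet_shift \<epsilon> (?S \<gamma> j) n) \<le> 3 * \<eta>" if "j \<ge> J" "0 < \<epsilon>" "\<epsilon> \<le> \<epsilon>0" for j \<epsilon>
  proof -
    have 1: "dpoly_norm p (\<lambda>n. ?S \<gamma> j n - ?S \<gamma> J n) \<le> \<eta>"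
      using J[OF that(1) order_refl] by (simp add: dirichlet_shift_diff)
    have "dpoly_norm p (dirichlet_shift \<epsilon> (\<lambda>n. ?S \<gamma> J n - ?S \<gamma> j n)) \<le> dpoly_norm p (\<lambda>n. ?S \<gamma> J n - ?S \<gamma> j n)"
      using that by (intro dpoly_norm_shift_le dirichlet_poly_diff P p1) auto
    also have "\<dots> \<le> \<eta>" using 1 dpoly_norm_minus_commute[OF P P p1] by metis
    finally have 3: "dpoly_norm p (\<lambda>n. dirichlet_shift \<epsilon> (?S \<gamma> J) n - dirichlet_shift \<epsilon> (?S \<gamma> j) n) \<le> \<eta>"
      by (simp add: dirichlet_shift_diff)
    have 2: "dpoly_norm p (\<lambda>n. ?S \<gamma> J n - dirichlet_shift \<epsilon> (?S \<gamma> J) n) \<le> \<eta>"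
      by (rule e0(2)[OF less_imp_le[OF that(2)] that(3)])
    have "dpoly_norm p (\<lambda>n. ?S \<gamma> j n - dirichlet_shift \<epsilon> (?S \<gamma> j) n)
       \<le> dpoly_norm p (\<lambda>n. ?S \<gamma> j n - ?S \<gamma> J n) + dpoly_norm p (\<lambda>n. ?S \<gamma> J n - dirichlet_shift \<epsilon> (?S \<gamma> j) n)"
      by (rule dpoly_norm_diff_triangle[OF P P dirichlet_poly_shift[OF P] p1])
    moreover have "dpoly_norm p (\<lambda>n. ?S \<gamma> J n - dirichlet_shift \<epsilon> (?S \<gamma> j) n)
       \<le> dpoly_norm p (\<lambda>n. ?S \<gamma> J n - dirichlet_shift \<epsilon> (?S \<gamma> J) n)
        + dpoly_norm p (\<lambda>n. dirichlet_shift \<epsilon> (?S \<gamma> J) n - dirichlet_shift \<epsilon> (?S \<gamma> j) n)"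
      by (rule dpoly_norm_diff_triangle[OF P dirichlet_poly_shift[OF P] dirichlet_poly_shift[OF P] p1])
    ultimately show ?thesis using 1 2 3 by linarith
  qed
  show ?thesis
  proof (intro exI[of _ \<epsilon>0] conjI allI impI e0(1))
    fix \<epsilon> \<epsilon>' assume e: "0 < \<epsilon>" "\<epsilon> \<le> \<epsilon>'" "\<epsilon>' \<le> \<epsilon>0"
    then have e': "0 < \<epsilon>'" by simp
    show "\<forall>\<^sub>F j in sequentially. dpoly_norm p (\<lambda>n. ?S \<epsilon> j n - ?S \<epsilon>' j n) \<le> \<kappa>"
      using g(2) L(3)[OF e(1) eta] L(3)[OF e' eta] eventually_ge_at_top[of J]
    proof eventually_elim
      case (elim j)
      show ?case
      proof (rule uc[OF P P elim(2,3)])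
        let ?G = "?S \<gamma> j" and ?x = "dirichlet_shift \<epsilon> (?S \<gamma> j)" and ?y = "dirichlet_shift \<epsilon>' (?S \<gamma> j)"
        let ?z = "\<lambda>n. ?x n + ?y n"
        have z: "dirichlet_poly ?z" by (intro dirichlet_poly_add dirichlet_poly_shift P)
        \<comment> \<open>Shifts commute, so shifting the sum by \<open>\<gamma>\<close> gives the
          sum of two small shifts of \<open>?G\<close>, both of which are near
          \<open>?G\<close>.\<close>
        have "dirichlet_shift \<gamma> (\<lambda>n. ?S \<epsilon> j n + ?S \<epsilon>' j n) = ?z"
          unfolding dirichlet_shift_add dirichlet_shift_shift by (simp add: add.commute)
        then have zle: "dpoly_norm p ?z \<le> dpoly_norm p (\<lambda>n. ?S \<epsilon> j n + ?S \<epsilon>' j n)"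
          using dpoly_norm_shift_le[OF dirichlet_poly_add[OF P P] p1, of \<gamma> \<epsilon> j \<epsilon>' j] g(1) by simp
        have "dpoly_norm p (\<lambda>n. ?G n + ?G n) \<le> dpoly_norm p ?z + dpoly_norm p (\<lambda>n. (?G n + ?G n) - ?z n)"
          by (rule dpoly_norm_le_add[OF dirichlet_poly_add[OF P P] z p1])
        also have "(\<lambda>n. (?G n + ?G n) - ?z n) = (\<lambda>n. (?G n - ?x n) + (?G n - ?y n))" by auto
        also have "dpoly_norm p \<dots> \<le> dpoly_norm p (\<lambda>n. ?G n - ?x n) + dpoly_norm p (\<lambda>n. ?G n - ?y n)"
          by (intro dpoly_norm_add dirichlet_poly_diff dirichlet_poly_shift P p1)
        finally have "dpoly_norm p (\<lambda>n. ?G n + ?G n) \<le> dpoly_norm p ?z + 6 * \<eta>"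
          using near[OF elim(4) e(1)] near[OF elim(4) e' e(3)] e by simp
        moreover have "dpoly_norm p (\<lambda>n. ?G n + ?G n) = 2 * dpoly_norm p ?G"
        proof -
          have p0: "p > 0" using p by simp
          have "Lp p (\<lambda>t. u t + u t) = 2 * Lp p u" if "ap u" for u
          proof -
            have "norm (u t + u t) = 2 * norm (u t)" for t by (simp flip: mult_2 add: norm_mult)
            then show ?thesis unfolding Lp_def using p0 mean_nonneg[OF real_ap_norm_powr[OF that p0]]
              by (simp add: powr_mult mean_cmult real_ap_norm_powr[OF that p0] powr_powr)
          qed
          from this[OF ap_dpoly[OF P]] show ?thesis
            unfolding dpoly_norm_Lp[OF dirichlet_poly_add[OF P P] p0] dpoly_norm_Lp[OF P p0]
            by (simp only: dpoly_eval_add[OF P P])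
        qed
        \<comment> \<open>Twice the level bound minus the two displacements is
          \<open>2 * (L - \<eta>) - 6 * \<eta>\<close>, slightly more than required.\<close>
        ultimately show "2 * (L - 5 * \<eta>) \<le> dpoly_norm p (\<lambda>n. ?S \<epsilon> j n + ?S \<epsilon>' j n)"
          using zle elim(1) eta by argo
      qed
    qed
  qed
qed

subsection \<open>Elements of the Hardy space\<close>

lemma dpoly_CauchyD:
  assumes "dpoly_Cauchy p P"
  shows "dirichlet_poly (P j)"
    "e > 0 \<Longrightarrow> \<exists>M. \<forall>i\<ge>M. \<forall>j\<ge>M. dpoly_norm p (\<lambda>n. P i n - P j n) < e"
  using assms unfolding dpoly_Cauchy_def by blast+

lemma dpoly_Cauchy_diff:
  assumes P: "dpoly_Cauchy p P" and Q: "dpoly_Cauchy p Q" and p: "1 \<le> p"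
  shows "dpoly_Cauchy p (\<lambda>j n. P j n - Q j n)"
  unfolding dpoly_Cauchy_def
proof (intro conjI allI impI)
  show "dirichlet_poly (\<lambda>n. P j n - Q j n)" for j
    by (intro dirichlet_poly_diff dpoly_CauchyD(1)[OF P] dpoly_CauchyD(1)[OF Q])
  fix e :: real assume "e > 0"
  then have e: "e / 2 > 0" by simp
  obtain M where M: "\<And>i j. i \<ge> M \<Longrightarrow> j \<ge> M \<Longrightarrow> dpoly_norm p (\<lambda>n. P i n - P j n) < e / 2"
    using dpoly_CauchyD(2)[OF P e] by blast
  obtain M' where M': "\<And>i j. i \<ge> M' \<Longrightarrow> j \<ge> M' \<Longrightarrow> dpoly_norm p (\<lambda>n. Q i n - Q j n) < e / 2"
    using dpoly_CauchyD(2)[OF Q e] by blast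
  have "dpoly_norm p (\<lambda>n. (P i n - Q i n) - (P j n - Q j n)) < e" if "i \<ge> max M M'" "j \<ge> max M M'" for i j
  proof -
    have "dpoly_norm p (\<lambda>n. (P i n - Q i n) - (P j n - Q j n)) = dpoly_norm p (\<lambda>n. (P i n - P j n) - (Q i n - Q j n))"
      by (simp add: algebra_simps)
    also have "\<dots> \<le> dpoly_norm p (\<lambda>n. P i n - P j n) + dpoly_norm p (\<lambda>n. Q i n - Q j n)"
      by (intro dpoly_norm_diff dirichlet_poly_diff dpoly_CauchyD(1)[OF P] dpoly_CauchyD(1)[OF Q] p)
    finally show ?thesis using M[of i j] M'[of i j] that by simp
  qed
  then show "\<exists>M. \<forall>i\<ge>M. \<forall>j\<ge>M. dpoly_norm p (\<lambda>n. (P i n - Q i n) - (P j n - Q j n)) < e" by blast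
qed

lemma dpoly_Cauchy_norm_convergent:
  assumes P: "dpoly_Cauchy p P" and p: "1 \<le> p"
  shows "convergent (\<lambda>j. dpoly_norm p (P j))"
proof -
  have le: "dpoly_norm p (P i) \<le> dpoly_norm p (P j) + dpoly_norm p (\<lambda>n. P i n - P j n)" for i j
    by (intro dpoly_norm_le_add dpoly_CauchyD(1)[OF P] p)
  have "Cauchy (\<lambda>j. dpoly_norm p (P j))"
  proof (rule metric_CauchyI)
    fix e :: real assume "e > 0"
    then obtain M where M: "\<And>i j. i \<ge> M \<Longrightarrow> j \<ge> M \<Longrightarrow> dpoly_norm p (\<lambda>n. P i n - P j n) < e"
      using dpoly_CauchyD(2)[OF P] by blast
    have "dist (dpoly_norm p (P i)) (dpoly_norm p (P j)) < e" if "i \<ge> M" "j \<ge> M" for i j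
      using le[of i j] le[of j i] M[OF that] M[OF that(2,1)] unfolding dist_real_def by linarith
    then show "\<exists>M. \<forall>i\<ge>M. \<forall>j\<ge>M. dist (dpoly_norm p (P i)) (dpoly_norm p (P j)) < e" by blast
  qed
  then show ?thesis by (simp add: Cauchy_convergent_iff)
qed

text \<open>A shift can be undone at small cost only for one fixed polynomial. So
  \<open>\<epsilon>\<close> is fitted to \<open>P M\<close>, and the Cauchy property moves between
  \<open>P j\<close> and \<open>P M\<close> both before and after the shift.\<close>

lemma dpoly_Cauchy_null:
  assumes P: "dpoly_Cauchy p P" and p: "1 \<le> p" and z: "\<And>n. (\<lambda>j. P j n) \<longlonglongrightarrow> 0"
  shows "(\<lambda>j. dpoly_norm p (P j)) \<longlonglongrightarrow> 0"
proof (rule LIMSEQ_I)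
  fix e :: real assume "e > 0"
  \<comment> \<open>Four errors occur, so a fifth of \<open>e\<close> for each leaves the final
    inequality strict.\<close>
  then have e: "e / 5 > 0" by simp
  note D = dpoly_CauchyD(1)[OF P]
  obtain M where M: "\<And>i j. i \<ge> M \<Longrightarrow> j \<ge> M \<Longrightarrow> dpoly_norm p (\<lambda>n. P i n - P j n) < e / 5"
    using dpoly_CauchyD(2)[OF P e] by blast
  obtain \<epsilon> where eps: "\<epsilon> > 0" "dpoly_norm p (\<lambda>n. P M n - dirichlet_shift \<epsilon> (P M) n) \<le> e / 5"
    using dpoly_norm_shift_cont[OF D p e] by (metis less_imp_le order_refl)
  define b where "b j = P (M + j)" for j
  define c where "c j = (\<lambda>n::nat. 0::complex)" for j :: nat
  define B where "B = dpoly_norm p (P M) + e / 5"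
  have B: "B \<ge> 0" using dpoly_norm_nonneg[OF D p] e by (simp add: B_def add_nonneg_nonneg)
  have b: "dirichlet_poly (b j)" "(\<lambda>j. b j n) \<longlonglongrightarrow> 0" for j n
    unfolding b_def using D LIMSEQ_ignore_initial_segment[OF z[of n], of M] by (auto simp: add.commute)
  have bB: "dpoly_norm p (b j) \<le> B" for j
  proof -
    have "dpoly_norm p (P (M + j)) \<le> dpoly_norm p (P M) + dpoly_norm p (\<lambda>n. P (M + j) n - P M n)"
      by (intro dpoly_norm_le_add D p)
    then show ?thesis using M[of "M + j" M] by (simp add: b_def B_def)
  qed
  have c: "dirichlet_poly (c j)" "(\<lambda>j. c j n) \<longlonglongrightarrow> 0" "dpoly_norm p (c j) \<le> B" for j n
    using B p by (auto simp: c_def dirichlet_poly_def dpoly_norm_zero)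
  obtain J where J: "\<And>i j. i \<ge> J \<Longrightarrow> j \<ge> J \<Longrightarrow> dpoly_norm p (dirichlet_shift \<epsilon> (\<lambda>n. b i n - c j n)) \<le> e / 5"
    using shift_diff_small[OF p eps(1) e b(1) bB b(2) c(1) c(3) c(2)] by blast
  show "\<exists>no. \<forall>j\<ge>no. norm (dpoly_norm p (P j) - 0) < e"
  proof (intro exI[of _ "M + J"] allI impI)
    fix j assume j: "j \<ge> M + J"
    let ?S = "dirichlet_shift \<epsilon>"
    have S: "dirichlet_poly (?S (P j))" for j by (rule dirichlet_poly_shift[OF D])
    have 1: "dpoly_norm p (?S (P j)) \<le> e / 5"
      using J[of "j - M" J] j by (simp add: b_def c_def)
    have 2: "dpoly_norm p (\<lambda>n. ?S (P M) n - ?S (P j) n) \<le> e / 5"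
    proof -
      have "dpoly_norm p (?S (\<lambda>n. P M n - P j n)) \<le> dpoly_norm p (\<lambda>n. P M n - P j n)"
        by (intro dpoly_norm_shift_le dirichlet_poly_diff D p less_imp_le[OF eps(1)])
      then show ?thesis using M[of M j] j by (simp add: dirichlet_shift_diff)
    qed
    have "dpoly_norm p (P j) \<le> dpoly_norm p (P M) + dpoly_norm p (\<lambda>n. P j n - P M n)"
      by (intro dpoly_norm_le_add D p)
    moreover have "dpoly_norm p (P M) \<le> dpoly_norm p (?S (P M)) + dpoly_norm p (\<lambda>n. P M n - ?S (P M) n)"
      by (intro dpoly_norm_le_add D S p)
    moreover have "dpoly_norm p (?S (P M)) \<le> dpoly_norm p (?S (P j)) + dpoly_norm p (\<lambda>n. ?S (P M) n - ?S (P j) n)"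
      by (intro dpoly_norm_le_add S p)
    ultimately have "dpoly_norm p (P j) < e" using 1 2 eps(2) M[of j M] j e by simp
    then show "norm (dpoly_norm p (P j) - 0) < e" using dpoly_norm_nonneg[OF D p, of j] by simp
  qed
qed

text \<open>Gives the description in \<open>Hp_norm\<close> its value: two representing sequences
  differ by a Cauchy sequence with vanishing coefficients, which is null. Later estimates of
  \<open>Hp_norm\<close> go through this limit.\<close>

lemma Hp_norm_tendsto:
  assumes P: "Hp_represents p P a" and p: "1 \<le> p"
  shows "(\<lambda>j. dpoly_norm p (P j)) \<longlonglongrightarrow> Hp_norm p a"
proof -
  have PC: "dpoly_Cauchy p P" and Pa: "\<And>n. (\<lambda>j. P j n) \<longlonglongrightarrow> a n"
    using P unfolding Hp_represents_def by auto
  obtain L where L: "(\<lambda>j. dpoly_norm p (P j)) \<longlonglongrightarrow> L"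
    using dpoly_Cauchy_norm_convergent[OF PC p] by (auto simp: convergent_def)
  have "Hp_norm p a = L"
    unfolding Hp_norm_def
  proof (rule the_equality)
    show "\<exists>P. Hp_represents p P a \<and> (\<lambda>j. dpoly_norm p (P j)) \<longlonglongrightarrow> L" using P L by blast
    fix L' assume "\<exists>P. Hp_represents p P a \<and> (\<lambda>j. dpoly_norm p (P j)) \<longlonglongrightarrow> L'"
    then obtain Q where QC: "dpoly_Cauchy p Q" and Qa: "\<And>n. (\<lambda>j. Q j n) \<longlonglongrightarrow> a n"
      and L': "(\<lambda>j. dpoly_norm p (Q j)) \<longlonglongrightarrow> L'" unfolding Hp_represents_def by auto
    have d: "(\<lambda>j. dpoly_norm p (\<lambda>n. P j n - Q j n)) \<longlonglongrightarrow> 0"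
    proof (rule dpoly_Cauchy_null[OF dpoly_Cauchy_diff[OF PC QC p] p])
      show "(\<lambda>j. P j n - Q j n) \<longlonglongrightarrow> 0" for n
        using tendsto_diff[OF Pa[of n] Qa[of n]] by simp
    qed
    have D: "dirichlet_poly (P j)" "dirichlet_poly (Q j)" for j
      using dpoly_CauchyD(1)[OF PC] dpoly_CauchyD(1)[OF QC] by auto
    have le: "dpoly_norm p (P j) \<le> dpoly_norm p (Q j) + dpoly_norm p (\<lambda>n. P j n - Q j n)"
         "dpoly_norm p (Q j) \<le> dpoly_norm p (P j) + dpoly_norm p (\<lambda>n. P j n - Q j n)" for j
      by (rule dpoly_norm_le_add[OF D p])
         (use dpoly_norm_le_add[OF D(2,1) p, of j j] dpoly_norm_minus_commute[OF D p, of j j] in simp)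
    have "L \<le> L' + 0"
      by (rule tendsto_le[OF _ tendsto_add[OF L' d] L]) (use le in auto)
    moreover have "L' \<le> L + 0"
      by (rule tendsto_le[OF _ tendsto_add[OF L d] L']) (use le in auto)
    ultimately show "L' = L" by simp
  qed
  with L show ?thesis by simp
qed

lemma Hp_represents_diff:
  assumes "Hp_represents p P a" "Hp_represents p Q b" "1 \<le> p"
  shows "Hp_represents p (\<lambda>j n. P j n - Q j n) (\<lambda>n. a n - b n)"
  using assms unfolding Hp_represents_def by (auto intro!: dpoly_Cauchy_diff tendsto_diff)

lemma dirichlet_shift_tendsto:
  "(\<lambda>j. P j n) \<longlonglongrightarrow> a n \<Longrightarrow> (\<lambda>j. dirichlet_shift \<epsilon> (P j) n) \<longlonglongrightarrow> dirichlet_shift \<epsilon> a n"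
  unfolding dirichlet_shift_def divide_inverse by (rule tendsto_mult_right)

lemma Hp_represents_shift:
  assumes P: "Hp_represents p P a" and p: "1 \<le> p" and e: "\<epsilon> \<ge> 0"
  shows "Hp_represents p (\<lambda>j. dirichlet_shift \<epsilon> (P j)) (dirichlet_shift \<epsilon> a)"
proof -
  have PC: "dpoly_Cauchy p P" and Pa: "\<And>n. (\<lambda>j. P j n) \<longlonglongrightarrow> a n"
    using P unfolding Hp_represents_def by auto
  note D = dpoly_CauchyD(1)[OF PC]
  have le: "dpoly_norm p (\<lambda>n. dirichlet_shift \<epsilon> (P i) n - dirichlet_shift \<epsilon> (P j) n) \<le> dpoly_norm p (\<lambda>n. P i n - P j n)" for i j
    using dpoly_norm_shift_le[OF dirichlet_poly_diff[OF D D] p e] by (simp add: dirichlet_shift_diff)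
  have "dpoly_Cauchy p (\<lambda>j. dirichlet_shift \<epsilon> (P j))"
    unfolding dpoly_Cauchy_def
  proof (intro conjI allI impI dirichlet_poly_shift D)
    fix e :: real assume "e > 0"
    then obtain M where "\<And>i j. i \<ge> M \<Longrightarrow> j \<ge> M \<Longrightarrow> dpoly_norm p (\<lambda>n. P i n - P j n) < e"
      using dpoly_CauchyD(2)[OF PC] by blast
    then show "\<exists>M. \<forall>i\<ge>M. \<forall>j\<ge>M. dpoly_norm p (\<lambda>n. dirichlet_shift \<epsilon> (P i) n - dirichlet_shift \<epsilon> (P j) n) < e"
      using le order_le_less_trans by blast
  qed
  then show ?thesis unfolding Hp_represents_def using dirichlet_shift_tendsto[of P _ a] Pa by blast
qed

section \<open>Coefficientwise limits of bounded families\<close>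

lemma shift_family_Cauchy:
  assumes p: "1 \<le> p"
    and b: "\<And>j. dirichlet_poly (b j)" "\<And>j. dpoly_norm p (b j) \<le> B" "\<And>n. (\<lambda>j. b j n) \<longlonglongrightarrow> a n"
    and k: "\<kappa> > 0"
  obtains \<epsilon>0 where "\<epsilon>0 > 0" "\<And>\<epsilon> \<epsilon>'. 0 < \<epsilon> \<Longrightarrow> \<epsilon> \<le> \<epsilon>0 \<Longrightarrow> 0 < \<epsilon>' \<Longrightarrow> \<epsilon>' \<le> \<epsilon>0 \<Longrightarrow>
    \<forall>\<^sub>F j in sequentially. dpoly_norm p (\<lambda>n. dirichlet_shift \<epsilon> (b j) n - dirichlet_shift \<epsilon>' (b j) n) \<le> \<kappa>"
proof -
  have "\<exists>\<epsilon>0>0. \<forall>\<epsilon> \<epsilon>'. 0 < \<epsilon> \<longrightarrow> \<epsilon> \<le> \<epsilon>' \<longrightarrow> \<epsilon>' \<le> \<epsilon>0 \<longrightarrow>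
    (\<forall>\<^sub>F j in sequentially. dpoly_norm p (\<lambda>n. dirichlet_shift \<epsilon> (b j) n - dirichlet_shift \<epsilon>' (b j) n) \<le> \<kappa>)"
  proof (cases "p = 1")
    case True
    show ?thesis unfolding True
      by (rule shift_family_Cauchy_1[OF b(1) b(2)[unfolded True] b(3) k])
  next
    case False
    then show ?thesis using p by (intro shift_family_Cauchy_gt_1[OF _ b k]) auto
  qed
  then obtain \<epsilon>0 where e0: "\<epsilon>0 > 0" "\<And>\<epsilon> \<epsilon>'. 0 < \<epsilon> \<Longrightarrow> \<epsilon> \<le> \<epsilon>' \<Longrightarrow> \<epsilon>' \<le> \<epsilon>0 \<Longrightarrow>
    \<forall>\<^sub>F j in sequentially. dpoly_norm p (\<lambda>n. dirichlet_shift \<epsilon> (b j) n - dirichlet_shift \<epsilon>' (b j) n) \<le> \<kappa>"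
    by blast
  have sym: "dpoly_norm p (\<lambda>n. dirichlet_shift \<epsilon> (b j) n - dirichlet_shift \<epsilon>' (b j) n)
      = dpoly_norm p (\<lambda>n. dirichlet_shift \<epsilon>' (b j) n - dirichlet_shift \<epsilon> (b j) n)" for \<epsilon> \<epsilon>' j
    by (rule dpoly_norm_minus_commute[OF dirichlet_poly_shift[OF b(1)] dirichlet_poly_shift[OF b(1)] p])
  show ?thesis
  proof (rule that[OF e0(1)])
    fix \<epsilon> \<epsilon>' assume e: "0 < \<epsilon>" "\<epsilon> \<le> \<epsilon>0" "0 < \<epsilon>'" "\<epsilon>' \<le> \<epsilon>0"
    show "\<forall>\<^sub>F j in sequentially. dpoly_norm p (\<lambda>n. dirichlet_shift \<epsilon> (b j) n - dirichlet_shift \<epsilon>' (b j) n) \<le> \<kappa>"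
    proof (cases "\<epsilon> \<le> \<epsilon>'")
      case True
      then show ?thesis using e0(2) e by blast
    next
      case False
      then have "\<epsilon>' \<le> \<epsilon>" by simp
      from e0(2)[OF e(3) this e(2)] show ?thesis unfolding sym[of \<epsilon>] .
    qed
  qed
qed

text \<open>The representing sequence is diagonal: shift by \<open>1 / (k + 1)\<close> and go so far
  along \<open>b\<close> that the shifted members have settled up to \<open>1 / (k + 1)\<close>.
  Contractivity keeps the bound \<open>B\<close>, so that \<open>shift_diff_small\<close> can later
  compare with \<open>c\<close>.\<close>

lemma bounded_coefficientwise_limit_Hp:
  assumes p: "1 \<le> p"
    and b: "\<And>j. dirichlet_poly (b j)" "\<And>j. dpoly_norm p (b j) \<le> B" "\<And>n. (\<lambda>j. b j n) \<longlonglongrightarrow> a n"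
  obtains c where "Hp_represents p c a" "\<And>j. dpoly_norm p (c j) \<le> B"
proof -
  let ?e = "\<lambda>k. 1 / (real k + 1)"
  have e: "?e k > 0" for k by simp
  have "\<exists>J\<ge>k. \<forall>i\<ge>J. \<forall>j\<ge>J. dpoly_norm p (dirichlet_shift (?e k) (\<lambda>n. b i n - b j n)) \<le> ?e k" for k
  proof -
    obtain J where J: "\<And>i j. i \<ge> J \<Longrightarrow> j \<ge> J \<Longrightarrow> dpoly_norm p (dirichlet_shift (?e k) (\<lambda>n. b i n - b j n)) \<le> ?e k"
      using shift_diff_small[OF p e e b b, of k k] by blast
    then show ?thesis by (intro exI[of _ "max k J"]) auto
  qed
  then obtain J where J: "\<And>k. J k \<ge> k" "\<And>k i j. i \<ge> J k \<Longrightarrow> j \<ge> J k \<Longrightarrow> dpoly_norm p (dirichlet_shift (?e k) (\<lambda>n. b i n - b j n)) \<le> ?e k"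
    by metis
  define c where "c k = dirichlet_shift (?e k) (b (J k))" for k
  have c: "dirichlet_poly (c k)" for k unfolding c_def by (rule dirichlet_poly_shift[OF b(1)])
  have cB: "dpoly_norm p (c k) \<le> B" for k
    using dpoly_norm_shift_le[OF b(1) p less_imp_le[OF e], of k "J k"] b(2)[of "J k"] unfolding c_def by linarith
  have "dpoly_Cauchy p c"
    unfolding dpoly_Cauchy_def
  proof (intro conjI allI impI c)
    fix \<kappa> :: real assume "\<kappa> > 0"
    then have k: "\<kappa> / 4 > 0" by simp
    obtain \<epsilon>0 where e0: "\<epsilon>0 > 0" "\<And>\<epsilon> \<epsilon>'. 0 < \<epsilon> \<Longrightarrow> \<epsilon> \<le> \<epsilon>0 \<Longrightarrow> 0 < \<epsilon>' \<Longrightarrow> \<epsilon>' \<le> \<epsilon>0 \<Longrightarrow>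
       \<forall>\<^sub>F j in sequentially. dpoly_norm p (\<lambda>n. dirichlet_shift \<epsilon> (b j) n - dirichlet_shift \<epsilon>' (b j) n) \<le> \<kappa> / 4"
      using shift_family_Cauchy[OF p b k, of thesis] that by blast
    have "?e \<longlonglongrightarrow> 0" using LIMSEQ_inverse_real_of_nat by (simp add: inverse_eq_divide add.commute)
    then have "\<forall>\<^sub>F k in sequentially. ?e k < min \<epsilon>0 (\<kappa> / 4)" using e0(1) k by (intro order_tendstoD) auto
    then obtain K where K: "\<And>i. i \<ge> K \<Longrightarrow> ?e i < min \<epsilon>0 (\<kappa> / 4)" unfolding eventually_sequentially by blast
    have "dpoly_norm p (\<lambda>n. c i n - c l n) < \<kappa>" if il: "i \<ge> K" "l \<ge> K" for i l
    proof -
      have ei: "?e i \<le> \<epsilon>0" "?e i \<le> \<kappa> / 4" "?e l \<le> \<epsilon>0" "?e l \<le> \<kappa> / 4"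
        using K[OF il(1)] K[OF il(2)] by auto
      have "\<forall>\<^sub>F j in sequentially. dpoly_norm p (\<lambda>n. dirichlet_shift (?e i) (b j) n - dirichlet_shift (?e l) (b j) n) \<le> \<kappa> / 4
         \<and> j \<ge> J i \<and> j \<ge> J l"
        by (intro eventually_conj eventually_ge_at_top e0(2) e ei)
      \<comment> \<open>\<open>c i\<close> and \<open>c l\<close> use different members of
        \<open>b\<close> and different shifts; a common late index \<open>j\<close> separates the
        two changes.\<close>
      then obtain j where j: "dpoly_norm p (\<lambda>n. dirichlet_shift (?e i) (b j) n - dirichlet_shift (?e l) (b j) n) \<le> \<kappa> / 4"
         "j \<ge> J i" "j \<ge> J l" using eventually_happens'[OF sequentially_bot] by blast
      have 1: "dpoly_norm p (\<lambda>n. c i n - dirichlet_shift (?e i) (b j) n) \<le> \<kappa> / 4"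
        using J(2)[OF order_refl j(2)] ei(2) unfolding c_def dirichlet_shift_diff by linarith
      have 2: "dpoly_norm p (\<lambda>n. dirichlet_shift (?e l) (b j) n - c l n) \<le> \<kappa> / 4"
        using J(2)[OF j(3) order_refl] ei(4) unfolding c_def dirichlet_shift_diff by linarith
      have "dpoly_norm p (\<lambda>n. c i n - c l n) \<le> dpoly_norm p (\<lambda>n. c i n - dirichlet_shift (?e i) (b j) n)
          + dpoly_norm p (\<lambda>n. dirichlet_shift (?e i) (b j) n - c l n)"
        by (intro dpoly_norm_diff_triangle c dirichlet_poly_shift b p)
      moreover have "dpoly_norm p (\<lambda>n. dirichlet_shift (?e i) (b j) n - c l n)
          \<le> dpoly_norm p (\<lambda>n. dirichlet_shift (?e i) (b j) n - dirichlet_shift (?e l) (b j) n)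
          + dpoly_norm p (\<lambda>n. dirichlet_shift (?e l) (b j) n - c l n)"
        by (intro dpoly_norm_diff_triangle c dirichlet_poly_shift b p)
      ultimately show ?thesis using 1 2 j(1) \<open>\<kappa> > 0\<close> by linarith
    qed
    then show "\<exists>M. \<forall>i\<ge>M. \<forall>j\<ge>M. dpoly_norm p (\<lambda>n. c i n - c j n) < \<kappa>" by blast
  qed
  moreover have "(\<lambda>k. c k n) \<longlonglongrightarrow> a n" for n
  proof (cases "n = 0")
    \<comment> \<open>\<open>0 powr x = 0\<close> also at \<open>x = 0\<close>, so the factor at
      index 0 does not tend to 1; there the coefficients vanish instead.\<close>
    case True
    have "b j 0 = 0" for j by (rule dirichlet_poly_0[OF b(1)])
    then have "a 0 = 0" using LIMSEQ_unique[OF b(3)[of 0]] by simp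
    then show ?thesis using True by (simp add: c_def dirichlet_shift_def)
  next
    case False
    have "filterlim J at_top sequentially"
      by (rule filterlim_at_top_mono[OF filterlim_ident]) (use J(1) in auto)
    then have 1: "(\<lambda>k. b (J k) n) \<longlonglongrightarrow> a n" by (rule filterlim_compose[OF b(3)])
    have "?e \<longlonglongrightarrow> 0" using LIMSEQ_inverse_real_of_nat by (simp add: inverse_eq_divide add.commute)
    then have "(\<lambda>k. b (J k) n / of_real (real n powr ?e k)) \<longlonglongrightarrow> a n / of_real (real n powr 0)"
      by (intro tendsto_intros 1) (use False in auto)
    then show ?thesis using False by (simp add: c_def dirichlet_shift_def)
  qed
  ultimately show ?thesis using cB by (intro that[of c]) (auto simp: Hp_represents_def)
qed

section \<open>Selection of the subsequence and conclusion\<close>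

lemma bounded_diagonal_subseq:
  fixes f :: "nat \<Rightarrow> nat \<Rightarrow> complex"
  assumes bd: "\<And>k n. norm (f k n) \<le> M"
  obtains r a where "strict_mono (r :: nat \<Rightarrow> nat)" "\<And>n. (\<lambda>k. f (r k) n) \<longlonglongrightarrow> a n"
proof -
  interpret nat: subseqs "\<lambda>n s. convergent (\<lambda>k. f (s k) n)"
  proof
    fix n :: nat and s :: "nat \<Rightarrow> nat" assume s: "strict_mono s"
    have "bounded (range (\<lambda>k. f (s k) n))" using bd by (auto intro!: boundedI)
    then obtain l r where "strict_mono r" "((\<lambda>k. f (s k) n) \<circ> r) \<longlonglongrightarrow> l"
      using bounded_imp_convergent_subsequence by blast
    then show "\<exists>r'. strict_mono r' \<and> convergent (\<lambda>k. f ((s \<circ> r') k) n)"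
      by (auto simp: convergent_def o_def)
  qed
  have "convergent (\<lambda>k. f (nat.diagseq k) n)" for n
  proof -
    \<comment> \<open>The tail from index \<open>Suc n\<close> on is where the diagonal sequence is
      known to refine the \<open>n\<close>-th selection; the initial segment is irrelevant for
      convergence.\<close>
    have "convergent (\<lambda>k. f ((nat.diagseq \<circ> (+) (Suc n)) k) n)"
    proof (rule nat.diagseq_holds)
      fix r s :: "nat \<Rightarrow> nat" and n assume "strict_mono r" "convergent (\<lambda>k. f (s k) n)"
      then show "convergent (\<lambda>k. f ((s \<circ> r) k) n)"
        using convergent_subseq_convergent[of "\<lambda>k. f (s k) n" r] by (simp add: o_def)
    qed
    then have "convergent (\<lambda>k. f (nat.diagseq (k + Suc n)) n)" by (simp add: add.commute)
    then show ?thesis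
      using convergent_ignore_initial_segment[of "\<lambda>k. f (nat.diagseq k) n" "Suc n"] by blast
  qed
  then have "(\<lambda>k. f (nat.diagseq k) n) \<longlonglongrightarrow> lim (\<lambda>k. f (nat.diagseq k) n)" for n
    by (rule convergent_LIMSEQ_iff[THEN iffD1])
  then show ?thesis by (rule that[OF nat.subseq_diagseq])
qed

theorem theorem6:
  fixes p :: real and A :: "nat \<Rightarrow> nat \<Rightarrow> complex"
  assumes "1 \<le> p"
    and "Hp_bounded_seq p A"
  shows "\<exists>a \<in> Hp p. \<exists>r :: nat \<Rightarrow> nat. strict_mono r \<and>
    (\<forall>\<epsilon>>0. Hp_converges p (\<lambda>k. dirichlet_shift \<epsilon> (A (r k))) (dirichlet_shift \<epsilon> a))"
proof -
  note p = assms(1)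
  obtain B where AB: "\<And>N. A N \<in> Hp p" "\<And>N. Hp_norm p (A N) \<le> B"
    using assms(2) unfolding Hp_bounded_seq_def by auto
  have "\<exists>P. Hp_represents p P (A N)" for N
    using AB(1)[of N] unfolding Hp_def by simp
  then obtain P where P: "\<And>N. Hp_represents p (P N) (A N)" by metis
  have PC: "dpoly_Cauchy p (P N)" and PA: "\<And>n. (\<lambda>j. P N j n) \<longlonglongrightarrow> A N n" for N
    using P[of N] unfolding Hp_represents_def by auto
  note D = dpoly_CauchyD(1)[OF PC]
  let ?e = "\<lambda>N. 1 / (real N + 1)"
  have e: "?e N > 0" for N by simp
  \<comment> \<open>Each \<open>A N\<close> is replaced by one polynomial within
    \<open>1 / (N + 1)\<close>, in the sense that all later members of its representing sequence are
    that close.\<close>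
  have "\<exists>m. dpoly_norm p (P N m) \<le> B + 1 \<and> (\<forall>i\<ge>m. dpoly_norm p (\<lambda>n. P N i n - P N m n) \<le> ?e N)" for N
  proof -
    obtain M where M: "\<And>i j. i \<ge> M \<Longrightarrow> j \<ge> M \<Longrightarrow> dpoly_norm p (\<lambda>n. P N i n - P N j n) < ?e N"
      using dpoly_CauchyD(2)[OF PC e] by blast
    have "Hp_norm p (A N) < B + 1" using AB(2)[of N] by simp
    from order_tendstoD(2)[OF Hp_norm_tendsto[OF P p] this]
    have "\<forall>\<^sub>F m in sequentially. dpoly_norm p (P N m) < B + 1 \<and> m \<ge> M"
      by (intro eventually_conj eventually_ge_at_top)
    then obtain m where "dpoly_norm p (P N m) < B + 1" "m \<ge> M"
      using eventually_happens'[OF sequentially_bot] by blast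
    then show ?thesis using M[of _ m] by (intro exI[of _ m]) (auto intro!: less_imp_le)
  qed
  then obtain m where m: "\<And>N. dpoly_norm p (P N (m N)) \<le> B + 1"
    "\<And>N i. i \<ge> m N \<Longrightarrow> dpoly_norm p (\<lambda>n. P N i n - P N (m N) n) \<le> ?e N" by metis
  \<comment> \<open>Bounds on single coefficients feed the diagonal argument; no
    \<open>\<epsilon>\<close> enters, so one subsequence serves all shifts.\<close>
  have "norm (P N (m N) n) \<le> 2 * (B + 1)" for N n
    by (rule order_trans[OF norm_coeff_le[OF D p] mult_left_mono[OF m(1)]]) simp
  then obtain r a where r: "strict_mono r" and ra: "\<And>n. (\<lambda>k. P (r k) (m (r k)) n) \<longlonglongrightarrow> a n"
    using bounded_diagonal_subseq[of "\<lambda>N. P N (m N)" "2 * (B + 1)", of thesis] that by blast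
  define b where "b k = P (r k) (m (r k))" for k
  have b: "dirichlet_poly (b k)" "dpoly_norm p (b k) \<le> B + 1" "(\<lambda>k. b k n) \<longlonglongrightarrow> a n" for k n
    unfolding b_def using D m(1) ra by auto
  obtain c where c: "Hp_represents p c a" and cB: "\<And>j. dpoly_norm p (c j) \<le> B + 1"
    using bounded_coefficientwise_limit_Hp[OF p b] by blast
  have cp: "dirichlet_poly (c j)" and ca: "(\<lambda>j. c j n) \<longlonglongrightarrow> a n" for j n
    using c dpoly_CauchyD(1) unfolding Hp_represents_def by blast+
  have "Hp_converges p (\<lambda>k. dirichlet_shift \<epsilon> (A (r k))) (dirichlet_shift \<epsilon> a)" if eps: "\<epsilon> > 0" for \<epsilon>
  proof -
    let ?S = "dirichlet_shift \<epsilon>"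
    have rep: "Hp_represents p (\<lambda>j. ?S (P N j)) (?S (A N))" "Hp_represents p (\<lambda>j. ?S (c j)) (?S a)" for N
      using eps by (intro Hp_represents_shift P c p; simp)+
    let ?h = "\<lambda>k. Hp_norm p (\<lambda>n. ?S (A (r k)) n - ?S a n)"
    \<comment> \<open>The norm in the completion is reached through polynomials, as a limit of norms
      of differences of shifted members.\<close>
    have lim: "(\<lambda>j. dpoly_norm p (\<lambda>n. ?S (P (r k) j) n - ?S (c j) n)) \<longlonglongrightarrow> ?h k" for k
      by (rule Hp_norm_tendsto[OF Hp_represents_diff[OF rep p] p])
    have "?h \<longlonglongrightarrow> 0"
    proof (rule LIMSEQ_I)
      fix \<kappa> :: real assume "\<kappa> > 0"
      then have k: "\<kappa> / 4 > 0" by simp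
      obtain J where J: "\<And>i j. i \<ge> J \<Longrightarrow> j \<ge> J \<Longrightarrow> dpoly_norm p (?S (\<lambda>n. b i n - c j n)) \<le> \<kappa> / 4"
        using shift_diff_small[OF p eps k b cp cB ca] by blast
      have "?e \<longlonglongrightarrow> 0" using LIMSEQ_inverse_real_of_nat by (simp add: inverse_eq_divide add.commute)
      then have "\<forall>\<^sub>F k in sequentially. ?e k < \<kappa> / 4" using k by (intro order_tendstoD) auto
      then obtain K where K: "\<And>i. i \<ge> K \<Longrightarrow> ?e i < \<kappa> / 4" unfolding eventually_sequentially by blast
      have "norm (?h i - 0) < \<kappa>" if i: "i \<ge> max J K" for i
      proof -
        have "?e (r i) < \<kappa> / 4" using K[of "r i"] i seq_suble[OF r, of i] by simp
        \<comment> \<open>\<open>b i\<close> is the bridge: it is near the late members of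
          \<open>P (r i)\<close> already before the shift, whereas nearness to \<open>c j\<close> is
          available only after it.\<close>
        have "dpoly_norm p (\<lambda>n. ?S (P (r i) j) n - ?S (c j) n) \<le> \<kappa> / 2" if j: "j \<ge> max J (m (r i))" for j
        proof -
          have "dpoly_norm p (\<lambda>n. ?S (P (r i) j) n - ?S (c j) n)
             \<le> dpoly_norm p (\<lambda>n. ?S (P (r i) j) n - ?S (b i) n) + dpoly_norm p (\<lambda>n. ?S (b i) n - ?S (c j) n)"
            by (intro dpoly_norm_diff_triangle dirichlet_poly_shift D b cp p)
          moreover have "dpoly_norm p (\<lambda>n. ?S (b i) n - ?S (c j) n) \<le> \<kappa> / 4"
            using J[of i j] i j by (simp add: dirichlet_shift_diff)
          moreover have "dpoly_norm p (?S (\<lambda>n. P (r i) j n - b i n)) \<le> dpoly_norm p (\<lambda>n. P (r i) j n - b i n)"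
            by (intro dpoly_norm_shift_le dirichlet_poly_diff D b p less_imp_le[OF eps])
          moreover have "dpoly_norm p (\<lambda>n. P (r i) j n - b i n) \<le> ?e (r i)"
            using m(2)[of "r i" j] j unfolding b_def by simp
          ultimately show ?thesis using \<open>?e (r i) < \<kappa> / 4\<close> by (simp add: dirichlet_shift_diff)
        qed
        then have "\<forall>\<^sub>F j in sequentially. dpoly_norm p (\<lambda>n. ?S (P (r i) j) n - ?S (c j) n) \<le> \<kappa> / 2"
          unfolding eventually_sequentially by blast
        then have "?h i \<le> \<kappa> / 2" by (intro tendsto_upperbound[OF lim]) auto
        moreover have "0 \<le> ?h i"
          by (rule tendsto_lowerbound[OF lim])
             (auto intro!: always_eventually dpoly_norm_nonneg dirichlet_poly_diff dirichlet_poly_shift D cp p)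
        ultimately show ?thesis using \<open>\<kappa> > 0\<close> by simp
      qed
      then show "\<exists>no. \<forall>i\<ge>no. norm (?h i - 0) < \<kappa>" by blast
    qed
    moreover have "?S (A (r k)) \<in> Hp p" "?S a \<in> Hp p" for k
      using rep unfolding Hp_def by blast+
    ultimately show ?thesis unfolding Hp_converges_def by blast
  qed
  moreover have "a \<in> Hp p" using c unfolding Hp_def by blast
  ultimately show ?thesis using r by blast
qed

end
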